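(* Let $n\ge 2$, $0<\alpha<n$, $M\geq 1$, $q_1,\dots,q_M\in(0,1)$, and let $\sigma_1,\dots,\sigma_M,\omega\in\mathcal M^+(\mathbb R^n)$ with $(\sigma_1,\dots,\sigma_M,\omega)\neq(0,\dots,0,0)$. Consider the problem $$(P)\qquad (-\Delta)^{\frac{\alpha}{2}}u=\sum_{i=1}^M\sigma_i u^{q_i}+\omega,\quad u\ge 0\ \text{ in }\mathbb R^n,\qquad \liminf_{x\to\infty}u(x)=0,$$ with solutions understood in the sense of the integral equation given in the context. For $0<\gamma<\infty$ consider the conditions $$(A_\gamma)\quad \mathcal I_\alpha\sigma_i\in L^{\frac{\gamma+q_i}{1-q_i}}(\mathbb R^n,d\sigma_i)\ \text{ for } i=1,\dots,M,\qquad (B_\gamma)\quad \mathcal I_\alpha\omega\in L^{\gamma}(\mathbb R^n,d\omega).$$ (1) If $(A_\gamma)$ and $(B_\gamma)$ hold for some $0<\gamma<\infty$, then there exists a positive minimal solution $u\in L^{r,\rho}(\mathbb R^n)$ to $(P)$, where $r=\frac{n(\gamma+1)}{n-\alpha}$ and $\rho=\gamma+1$. (2) In particular, conditions $(A_\gamma)$ and $(B_\gamma)$ hold with $\gamma=1$ if and only if there exists a positive (minimal) finite energy solution $u\in\dot H^{\frac{\alpha}{2}}(\mathbb R^n)$ to $(P)$. In this case, $u$ is the only solution to $(P)$ in $\dot H^{\frac{\alpha}{2}}(\mathbb R^n)$ provided $0<\alpha\le 2$.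
   Context: $\mathcal M^+(\mathbb R^n)$ is the set of nonnegative locally finite Borel measures on $\mathbb R^n$. Riesz potential: for $\mu\in\mathcal M^+(\mathbb R^n)$ and $0<\alpha<n$, $\mathcal I_\alpha\mu(x)=(-\Delta)^{-\frac{\alpha}{2}}\mu(x)=(n-\alpha)c(n,\alpha)\int_0^\infty\frac{\mu(B(x,r))}{r^{n-\alpha}}\frac{dr}{r}$, $x\in\mathbb R^n$, where $B(x,r)$ is the open ball of center $x$ and radius $r$ and $c(n,\alpha)>0$ is a normalization constant (omitted from the notation in the source). Solution: a solution to $(P)$ is a nonnegative measurable function $u$ on $\mathbb R^n$ with $u\in L^{q_i}_{loc}(\mathbb R^n,d\sigma_i)$ for all $i=1,\dots,M$ such that $u=\sum_{i=1}^M\mathcal I_\alpha(u^{q_i}d\sigma_i)+\mathcal I_\alpha\omega$ in $\mathbb R^n$. If "$=$" is replaced by "$\ge$", $u$ is called a supersolution. A nontrivial solution $u$ is minimal if $u\le v$ in $\mathbb R^n$ for any nontrivial supersolution $v$ to $(P)$. Lorentz space: for $0<r,\rho<\infty$, $L^{r,\rho}(\mathbb R^n)$ is the set of measurable $f$ with $\|f\|_{L^{r,\rho}}=\big(\int_0^\infty (t^{1/r}f^*(t))^\rho\frac{dt}{t}\big)^{1/\rho}<\infty$, $f^*$ being the decreasing rearrangement of $f$ with respect to Lebesgue measure. Homogeneous Sobolev space: $\dot H^{\frac{\alpha}{2}}(\mathbb R^n)=\{u: u=\mathcal I_{\frac{\alpha}{2}}f,\ f\in L^2(\mathbb R^n)\}$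 with norm $\|u\|_{\dot H^{\alpha/2}}=\|f\|_{L^2}$. A finite energy solution to $(P)$ is a nonnegative function $u$ belonging to $L^{q_i}_{loc}(\mathbb R^n,d\sigma_i)\cap\dot H^{\frac{\alpha}{2}}(\mathbb R^n)$ for all $i=1,\dots,M$ that satisfies the integral equation $u=\sum_{i=1}^M\mathcal I_\alpha(u^{q_i}d\sigma_i)+\mathcal I_\alpha\omega$ in $\mathbb R^n$.
   Formalization: "Nontrivial" is read as not zero a.e. for all of σ_1,…,σ_M, ω (else, for ω=0, the indicator of a σ_i-null point is a supersolution violating minimality), and uniqueness in part (2) is among nontrivial solutions (for ω=0, u=0 also solves the equation). *)

theory Defs
  imports "HOL-Analysis.Analysis"
begin

text \<open>Functions such as potentials and solutions may take the value \<open>\<infinity>\<close> on small sets and are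
  therefore \<open>ennreal\<close>-valued and defined everywhere. The power below is meant for exponents
  \<open>p > 0\<close>, with \<open>\<infinity>\<close> raised to \<open>p\<close> equal to \<open>\<infinity>\<close>.\<close>

definition enn_powr :: "ennreal \<Rightarrow> real \<Rightarrow> ennreal" (infixr "epowr" 80) where
  "x epowr p = (if x = \<infinity> then \<infinity> else ennreal (enn2real x powr p))"

definition locally_finite_borel :: "'a::euclidean_space measure \<Rightarrow> bool" where
  "locally_finite_borel \<mu> \<longleftrightarrow>
     sets \<mu> = sets borel \<and> (\<forall>x. \<exists>U. open U \<and> x \<in> U \<and> emeasure \<mu> U < \<infinity>)"

definition in_Lp :: "real \<Rightarrow> 'a::euclidean_space measure \<Rightarrow> ('a \<Rightarrow> ennreal) \<Rightarrow> bool" where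
  "in_Lp p \<mu> f \<longleftrightarrow> f \<in> borel_measurable \<mu> \<and> (\<integral>\<^sup>+x. f x epowr p \<partial>\<mu>) < \<infinity>"

definition in_Lp_loc :: "real \<Rightarrow> 'a::euclidean_space measure \<Rightarrow> ('a \<Rightarrow> ennreal) \<Rightarrow> bool" where
  "in_Lp_loc p \<mu> f \<longleftrightarrow> f \<in> borel_measurable \<mu> \<and>
     (\<forall>K. compact K \<longrightarrow> (\<integral>\<^sup>+x\<in>K. f x epowr p \<partial>\<mu>) < \<infinity>)"

text \<open>The constant for which convolution with \<open>c(n,\<alpha>) |x|\<^bsup>\<alpha>-n\<^esup>\<close> is the Fourier multiplier
  \<open>|\<xi>|\<^bsup>-\<alpha>\<^esup>\<close>, i.e. the operator \<open>(-\<Delta>)\<^bsup>-\<alpha>/2\<^esup>\<close>. The factor \<open>n - \<alpha>\<close> in \<open>riesz_potential\<close> comes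
  from writing this convolution as an integral over the radius.\<close>

definition riesz_const :: "real \<Rightarrow> real \<Rightarrow> real" where
  "riesz_const n \<alpha> = Gamma ((n - \<alpha>) / 2) / (2 powr \<alpha> * pi powr (n / 2) * Gamma (\<alpha> / 2))"

definition riesz_potential :: "real \<Rightarrow> 'a::euclidean_space measure \<Rightarrow> 'a \<Rightarrow> ennreal" where
  "riesz_potential \<alpha> \<mu> x =
     ennreal ((real DIM('a) - \<alpha>) * riesz_const (real DIM('a)) \<alpha>) *
     (\<integral>\<^sup>+r\<in>{0<..}. emeasure \<mu> (ball x r) * ennreal (1 / r powr (real DIM('a) - \<alpha>) / r) \<partial>lborel)"

text \<open>For signed \<open>f\<close> the potential is the difference of the potentials of the positive and the
  negative part (\<open>ennreal\<close> sends negative reals to \<open>0\<close>). For \<open>f \<in> L\<^sup>2\<close> and \<open>0 < s < n/2\<close> both are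
  finite almost everywhere, so the value chosen for \<open>\<infinity> - \<infinity>\<close> plays no role below.\<close>

definition riesz_potential_fun :: "real \<Rightarrow> ('a::euclidean_space \<Rightarrow> real) \<Rightarrow> 'a \<Rightarrow> ereal" where
  "riesz_potential_fun s f x =
     enn2ereal (riesz_potential s (density lborel (\<lambda>y. ennreal (f y))) x) -
     enn2ereal (riesz_potential s (density lborel (\<lambda>y. ennreal (- f y))) x)"

definition homogeneous_sobolev :: "real \<Rightarrow> ('a::euclidean_space \<Rightarrow> ereal) set" where
  "homogeneous_sobolev s =
     {u. \<exists>f. f \<in> borel_measurable lborel \<and> integrable lborel (\<lambda>x. (f x)\<^sup>2) \<and>
          (AE x in lborel. u x = riesz_potential_fun s f x)}"

definition decreasing_rearrangement :: "('a::euclidean_space \<Rightarrow> ennreal) \<Rightarrow> real \<Rightarrow> ennreal" where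
  "decreasing_rearrangement f t = Inf {s. emeasure lborel {x. s < f x} \<le> ennreal t}"

definition lorentz_norm :: "real \<Rightarrow> real \<Rightarrow> ('a::euclidean_space \<Rightarrow> ennreal) \<Rightarrow> ennreal" where
  "lorentz_norm r \<rho> f =
     (\<integral>\<^sup>+t\<in>{0<..}. (ennreal (t powr (1 / r)) * decreasing_rearrangement f t) epowr \<rho>
        * ennreal (1 / t) \<partial>lborel) epowr (1 / \<rho>)"

definition lorentz_space :: "real \<Rightarrow> real \<Rightarrow> ('a::euclidean_space \<Rightarrow> ennreal) set" where
  "lorentz_space r \<rho> = {f. f \<in> borel_measurable borel \<and> lorentz_norm r \<rho> f < \<infinity>}"

text \<open>Right-hand side of the integral equation; \<open>density (\<sigma> i) (\<lambda>y. u y epowr q i)\<close> is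
  \<open>u\<^bsup>q\<^sub>i\<^esup> d\<sigma>\<^sub>i\<close>.\<close>

definition potential_operator ::
  "real \<Rightarrow> nat \<Rightarrow> (nat \<Rightarrow> real) \<Rightarrow> (nat \<Rightarrow> 'a::euclidean_space measure) \<Rightarrow> 'a measure
    \<Rightarrow> ('a \<Rightarrow> ennreal) \<Rightarrow> 'a \<Rightarrow> ennreal" where
  "potential_operator \<alpha> M q \<sigma> \<omega> u x =
     (\<Sum>i = 1..M. riesz_potential \<alpha> (density (\<sigma> i) (\<lambda>y. u y epowr q i)) x) + riesz_potential \<alpha> \<omega> x"

definition is_solution ::
  "real \<Rightarrow> nat \<Rightarrow> (nat \<Rightarrow> real) \<Rightarrow> (nat \<Rightarrow> 'a::euclidean_space measure) \<Rightarrow> 'a measure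
    \<Rightarrow> ('a \<Rightarrow> ennreal) \<Rightarrow> bool" where
  "is_solution \<alpha> M q \<sigma> \<omega> u \<longleftrightarrow>
     u \<in> borel_measurable borel \<and> (\<forall>i\<in>{1..M}. in_Lp_loc (q i) (\<sigma> i) u) \<and>
     (\<forall>x. u x = potential_operator \<alpha> M q \<sigma> \<omega> u x)"

definition is_supersolution ::
  "real \<Rightarrow> nat \<Rightarrow> (nat \<Rightarrow> real) \<Rightarrow> (nat \<Rightarrow> 'a::euclidean_space measure) \<Rightarrow> 'a measure
    \<Rightarrow> ('a \<Rightarrow> ennreal) \<Rightarrow> bool" where
  "is_supersolution \<alpha> M q \<sigma> \<omega> u \<longleftrightarrow>
     u \<in> borel_measurable borel \<and> (\<forall>i\<in>{1..M}. in_Lp_loc (q i) (\<sigma> i) u) \<and>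
     (\<forall>x. u x \<ge> potential_operator \<alpha> M q \<sigma> \<omega> u x)"

text \<open>Nontriviality is understood with respect to the measures of the problem. For solutions this
  just means \<open>u \<noteq> 0\<close>. For supersolutions \<open>u \<noteq> 0\<close> would be too weak: if \<open>\<omega> = 0\<close>, the indicator of a
  nonempty set that is null for all \<open>\<sigma>\<^sub>i\<close> is a supersolution, and it dominates no positive function.\<close>

definition nontrivial ::
  "nat \<Rightarrow> (nat \<Rightarrow> 'a::euclidean_space measure) \<Rightarrow> 'a measure \<Rightarrow> ('a \<Rightarrow> ennreal) \<Rightarrow> bool" where
  "nontrivial M \<sigma> \<omega> u \<longleftrightarrow>
     \<not> ((\<forall>i\<in>{1..M}. AE x in \<sigma> i. u x = 0) \<and> (AE x in \<omega>. u x = 0))"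

definition is_minimal_solution ::
  "real \<Rightarrow> nat \<Rightarrow> (nat \<Rightarrow> real) \<Rightarrow> (nat \<Rightarrow> 'a::euclidean_space measure) \<Rightarrow> 'a measure
    \<Rightarrow> ('a \<Rightarrow> ennreal) \<Rightarrow> bool" where
  "is_minimal_solution \<alpha> M q \<sigma> \<omega> u \<longleftrightarrow>
     is_solution \<alpha> M q \<sigma> \<omega> u \<and> nontrivial M \<sigma> \<omega> u \<and>
     (\<forall>v. is_supersolution \<alpha> M q \<sigma> \<omega> v \<and> nontrivial M \<sigma> \<omega> v \<longrightarrow> (\<forall>x. u x \<le> v x))"

definition is_finite_energy_solution ::
  "real \<Rightarrow> nat \<Rightarrow> (nat \<Rightarrow> real) \<Rightarrow> (nat \<Rightarrow> 'a::euclidean_space measure) \<Rightarrow> 'a measure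
    \<Rightarrow> ('a \<Rightarrow> ennreal) \<Rightarrow> bool" where
  "is_finite_energy_solution \<alpha> M q \<sigma> \<omega> u \<longleftrightarrow>
     is_solution \<alpha> M q \<sigma> \<omega> u \<and> (\<lambda>x. enn2ereal (u x)) \<in> homogeneous_sobolev (\<alpha> / 2)"

definition cond_A ::
  "real \<Rightarrow> nat \<Rightarrow> (nat \<Rightarrow> real) \<Rightarrow> (nat \<Rightarrow> 'a::euclidean_space measure) \<Rightarrow> real \<Rightarrow> bool" where
  "cond_A \<alpha> M q \<sigma> \<gamma> \<longleftrightarrow>
     (\<forall>i\<in>{1..M}. in_Lp ((\<gamma> + q i) / (1 - q i)) (\<sigma> i) (riesz_potential \<alpha> (\<sigma> i)))"

definition cond_B :: "real \<Rightarrow> 'a::euclidean_space measure \<Rightarrow> real \<Rightarrow> bool" where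
  "cond_B \<alpha> \<omega> \<gamma> \<longleftrightarrow> in_Lp \<gamma> \<omega> (riesz_potential \<alpha> \<omega>)"

end

theory Submission
  imports Defs
begin

text \<open>
Write \<open>G \<mu>\<close> for the Riesz potential of \<open>\<mu>\<close> and \<open>\<mu>\<^sub>u = \<Sum>\<^sub>i u\<^bsup>q\<^sub>i\<^esup> \<sigma>\<^sub>i + \<omega>\<close>, so that the equation reads
\<open>u = G \<mu>\<^sub>u\<close>. Every nontrivial supersolution dominates constant multiples of the functions
\<open>(G \<sigma>\<^sub>i)\<^bsup>1/(1-q\<^sub>i)\<^esup>\<close>. Iterating the equation from these functions, with the measures truncated to
have bounded potentials, gives the minimal solution, provided that \<open>\<integral> u\<^bsup>\<gamma>\<^esup> d\<mu>\<^sub>u\<close> stays bounded.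

The bound rests on one level set argument: if the potential of \<open>\<mu>\<close> restricted to \<open>{w \<le> s}\<close> is at
most \<open>C s\<close> for all \<open>s\<close>, and likewise for \<open>\<nu>\<close> and \<open>w'\<close>, then symmetry of the kernel yields
\<open>\<nu> {G \<mu> > s} \<le> \<nu> {w' > s} + 2 C \<mu> {w > s/(2C)}\<close>. By the weak maximum principle \<open>w = G \<mu>\<close> is
admissible for \<open>\<mu>\<close>, and \<open>max (\<delta> u) (B (G \<sigma>)\<^bsup>1/(1-q)\<^esup>)\<close> for \<open>u\<^bsup>q\<^esup> \<sigma>\<close>; a small \<open>\<delta>\<close> allows absorption.
With Lebesgue measure in the place of \<open>\<nu>\<close> the same argument gives the Lorentz estimate.

For \<open>\<gamma> = 1\<close> the semigroup property of Riesz potentials identifies \<open>\<integral> u d\<mu>\<^sub>u < \<infinity>\<close> with membership in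
the homogeneous Sobolev space. Uniqueness follows from minimality and
\<open>\<integral> v d\<mu>\<^sub>u = \<integral> u d\<mu>\<^sub>v\<close>.
\<close>

section \<open>Powers of extended nonnegative reals\<close>

text \<open>The obstacle is sublinearity: for \<open>\<omega> = 0\<close> the zero function solves
  the equation, so an iteration has to start above zero and yet below every nontrivial
  supersolution. Both demands meet because a multiple of the potential of
  \<open>G \<nu> epowr p\<close> with respect to \<open>\<nu>\<close> dominates
  \<open>G \<nu> epowr (1 + p)\<close>. For \<open>p = q / (1 - q)\<close> the equation then acts on
  multiples of \<open>G \<nu> epowr (1 / (1 - q))\<close> by
  \<open>t \<mapsto> t powr q / iter_const p\<close>. As \<open>q < 1\<close>, its positive fixed
  point attracts every positive start, so one constant yields both a subsolution and a universal
  lower bound. The a priori bound has the unknown integral on both sides, and absorbing it requires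
  finiteness beforehand. Truncation to finite mass and bounded potential makes all iterates bounded,
  while the resulting bound does not depend on the truncation. Level sets treat all
  \<open>\<gamma> > 0\<close> alike. The exponent \<open>(\<gamma> + q) / (1 - q)\<close> is what
  \<open>\<gamma> + q\<close> becomes when \<open>u\<close> is replaced by
  \<open>G \<sigma> epowr (1 / (1 - q))\<close>. The passage from the Sobolev space to finite energy
  is again an absorption, with mollification providing the finiteness.\<close>

lemma epowr_top [simp]: "\<infinity> epowr p = \<infinity>" "top epowr p = top"
  by (simp_all add: enn_powr_def)

lemma epowr_zero [simp]: "0 epowr p = 0"
  by (simp add: enn_powr_def)

lemma epowr_ennreal: "0 \<le> x \<Longrightarrow> ennreal x epowr p = ennreal (x powr p)"
  by (simp add: enn_powr_def)

lemma epowr_one [simp]: "x epowr 1 = x"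
  by (cases x) (auto simp: enn_powr_def)

lemma epowr_mono: "0 \<le> p \<Longrightarrow> x \<le> y \<Longrightarrow> x epowr p \<le> y epowr p"
  by (cases x; cases y) (auto simp: epowr_ennreal ennreal_le_iff top_unique intro!: ennreal_leI powr_mono2)

lemma epowr_mult: "0 < p \<Longrightarrow> (x * y) epowr p = x epowr p * y epowr p"
  by (cases x; cases y)
    (auto simp: epowr_ennreal ennreal_mult[symmetric] powr_mult ennreal_top_mult ennreal_mult_top
      zero_less_iff_neq_zero)

lemma epowr_add: "x epowr (a + b) = x epowr a * x epowr b"
  by (cases x) (auto simp: epowr_ennreal ennreal_mult[symmetric] powr_add)

lemma epowr_epowr: "(x epowr a) epowr b = x epowr (a * b)"
  by (cases x) (auto simp: epowr_ennreal powr_powr)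

lemma epowr_pos: "0 < x \<Longrightarrow> 0 < x epowr p"
  by (cases x) (auto simp: epowr_ennreal)

lemma epowr_lt_top: "x < \<infinity> \<Longrightarrow> x epowr p < \<infinity>"
  by (cases x) (auto simp: epowr_ennreal)

lemma measurable_epowr [measurable (raw)]:
  "f \<in> borel_measurable M \<Longrightarrow> (\<lambda>x. f x epowr p) \<in> borel_measurable M"
  using powr_real_measurable[of "\<lambda>x. enn2real (f x)" M "\<lambda>_. p"]
  unfolding enn_powr_def infinity_ennreal_def by (intro measurable_If) auto

text \<open>A positive power is an order isomorphism with inverse \<open>epowr (1 / p)\<close>;
  transporting the supremum back through the inverse gives the nontrivial direction.\<close>

lemma epowr_SUP:
  assumes "0 < p"
  shows "(SUP i\<in>I. f i) epowr p = (SUP i\<in>I. f i epowr p)"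
proof (rule antisym)
  have "f i \<le> (SUP i\<in>I. f i epowr p) epowr (1 / p)" if "i \<in> I" for i
  proof -
    have "f i = (f i epowr p) epowr (1 / p)"
      using assms by (simp add: epowr_epowr)
    also have "\<dots> \<le> (SUP i\<in>I. f i epowr p) epowr (1 / p)"
      using assms that by (intro epowr_mono SUP_upper) auto
    finally show ?thesis .
  qed
  then have "(SUP i\<in>I. f i) \<le> (SUP i\<in>I. f i epowr p) epowr (1 / p)"
    by (rule SUP_least)
  then have "(SUP i\<in>I. f i) epowr p \<le> ((SUP i\<in>I. f i epowr p) epowr (1 / p)) epowr p"
    using assms by (intro epowr_mono) auto
  then show "(SUP i\<in>I. f i) epowr p \<le> (SUP i\<in>I. f i epowr p)"
    using assms by (simp add: epowr_epowr)
  show "(SUP i\<in>I. f i epowr p) \<le> (SUP i\<in>I. f i) epowr p"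
    using assms by (intro SUP_least epowr_mono SUP_upper) auto
qed

text \<open>Bounding the sum by its cardinality times the largest term gives one constant for all
  \<open>p > 0\<close>, with no distinction between concave and convex powers.\<close>

lemma epowr_sum_le:
  fixes f :: "'i \<Rightarrow> ennreal"
  assumes "finite I" "0 < p"
  shows "(\<Sum>i\<in>I. f i) epowr p \<le> ennreal (real (card I) powr p) * (\<Sum>i\<in>I. f i epowr p)"
proof (cases "I = {}")
  case False
  define m where "m = Max (f ` I)"
  have "m \<in> f ` I"
    unfolding m_def using False assms(1) by (intro Max_in) auto
  then obtain j where j: "j \<in> I" "m = f j"
    by auto
  have "(\<Sum>i\<in>I. f i) \<le> (\<Sum>i\<in>I. m)"
    using assms(1) by (intro sum_mono) (auto simp: m_def)
  also have "\<dots> = ennreal (real (card I)) * m"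
    by (simp add: ennreal_of_nat_eq_real_of_nat)
  finally have "(\<Sum>i\<in>I. f i) epowr p \<le> (ennreal (real (card I)) * m) epowr p"
    using assms by (intro epowr_mono) auto
  also have "\<dots> = ennreal (real (card I) powr p) * f j epowr p"
    using assms(2) j by (simp add: epowr_mult epowr_ennreal)
  also have "\<dots> \<le> ennreal (real (card I) powr p) * (\<Sum>i\<in>I. f i epowr p)"
    using j assms(1) by (intro mult_left_mono member_le_sum) auto
  finally show ?thesis .
qed auto

section \<open>Power integrals and the layer cake formula\<close>

lemma nn_integral_powr_from_0:
  assumes "- 1 < e" "0 \<le> c"
  shows "(\<integral>\<^sup>+s. ennreal (s powr e) * indicator {0..c} s \<partial>lborel) = ennreal (c powr (e + 1) / (e + 1))"
proof -
  have "(\<integral>\<^sup>+s. ennreal (s powr e) * indicator {0..c} s \<partial>lborel)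
      = (\<integral>\<^sup>+s. ennreal (s powr e * indicator {0..c} s) \<partial>lborel)"
    by (intro nn_integral_cong) (auto split: split_indicator)
  also have "\<dots> = ennreal (c powr (e + 1) / (e + 1))"
  proof (rule nn_integral_has_integral_lborel)
    have "((\<lambda>x. if x \<in> {0..c} then x powr e else 0) has_integral (c powr (e + 1) / (e + 1))) UNIV"
      using has_integral_powr_from_0[OF assms] by (simp only: has_integral_restrict_UNIV)
    then show "((\<lambda>s. s powr e * indicator {0..c} s) has_integral (c powr (e + 1) / (e + 1))) UNIV"
      by (rule has_integral_eq_rhs[OF has_integral_eq[rotated]]) (auto split: split_indicator)
  qed auto
  finally show ?thesis .
qed

lemma nn_integral_powr_to_inf:
  assumes "e < - 1" "0 < c"
  shows "(\<integral>\<^sup>+s. ennreal (s powr e) * indicator {c..} s \<partial>lborel) = ennreal (c powr (e + 1) / (- e - 1))"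
proof -
  have "(\<integral>\<^sup>+s. ennreal (s powr e) * indicator {c..} s \<partial>lborel)
      = (\<integral>\<^sup>+s. ennreal (s powr e * indicator {c..} s) \<partial>lborel)"
    by (intro nn_integral_cong) (auto split: split_indicator)
  also have "\<dots> = ennreal (- (c powr (e + 1)) / (e + 1))"
  proof (rule nn_integral_has_integral_lborel)
    have "((\<lambda>x. if x \<in> {c..} then x powr e else 0) has_integral (- (c powr (e + 1)) / (e + 1))) UNIV"
      using has_integral_powr_to_inf[OF assms] by (simp only: has_integral_restrict_UNIV)
    then show "((\<lambda>s. s powr e * indicator {c..} s) has_integral (- (c powr (e + 1)) / (e + 1))) UNIV"
      by (rule has_integral_eq_rhs[OF has_integral_eq[rotated]]) (auto split: split_indicator)
  qed auto
  also have "- (c powr (e + 1)) / (e + 1) = c powr (e + 1) / (- e - 1)"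
    using assms by (simp add: field_simps)
  finally show ?thesis .
qed

lemma nn_integral_AE_singleton:
  fixes f g :: "real \<Rightarrow> ennreal"
  assumes "\<And>s. s \<noteq> c \<Longrightarrow> f s = g s"
  shows "(\<integral>\<^sup>+s. f s \<partial>lborel) = (\<integral>\<^sup>+s. g s \<partial>lborel)"
  using AE_lborel_singleton[of c] assms by (intro nn_integral_cong_AE) auto

text \<open>Pointwise layer cake formula: \<open>a epowr p\<close> is the integral of the derivative
  of the power over the levels below \<open>a\<close>.\<close>

lemma epowr_eq_nn_integral:
  assumes "0 < p"
  shows "a epowr p = (\<integral>\<^sup>+s\<in>{0<..}. ennreal (p * s powr (p - 1)) * indicator {s. ennreal s < a} s \<partial>lborel)"
proof -
  have real: "ennreal b epowr p =
      (\<integral>\<^sup>+s\<in>{0<..}. ennreal (p * s powr (p - 1)) * indicator {s. ennreal s < ennreal b} s \<partial>lborel)"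
    if "0 \<le> b" for b
  proof -
    have "(\<integral>\<^sup>+s\<in>{0<..}. ennreal (p * s powr (p - 1)) * indicator {s. ennreal s < ennreal b} s \<partial>lborel)
      = (\<integral>\<^sup>+s. ennreal p * (ennreal (s powr (p - 1)) * indicator {0..b} s) \<partial>lborel)"
      using that assms
      by (intro nn_integral_AE_singleton[of b])
        (auto split: split_indicator simp: ennreal_mult ennreal_less_iff)
    also have "\<dots> = ennreal p * ennreal (b powr p / p)"
      using assms that by (subst nn_integral_cmult) (auto simp: nn_integral_powr_from_0)
    also have "\<dots> = ennreal b epowr p"
      using assms that by (simp add: ennreal_mult[symmetric] epowr_ennreal)
    finally show ?thesis by simp
  qed
  show ?thesis
  proof (cases a)
    case top
    \<comment> \<open>For \<open>a = \<infinity>\<close>, the real case at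
      \<open>b powr (1 / p)\<close> shows that the integral exceeds every real
      \<open>b\<close>.\<close>
    have *: "ennreal b \<le> (\<integral>\<^sup>+s\<in>{0<..}. ennreal (p * s powr (p - 1)) * indicator {s. ennreal s < a} s \<partial>lborel)"
      if "0 \<le> b" for b
    proof -
      have "ennreal b = ennreal (b powr (1 / p)) epowr p"
        using that assms by (simp add: epowr_ennreal powr_powr)
      also have "\<dots> \<le> (\<integral>\<^sup>+s\<in>{0<..}. ennreal (p * s powr (p - 1)) * indicator {s. ennreal s < a} s \<partial>lborel)"
        by (subst real) (auto intro!: nn_integral_mono split: split_indicator simp: top)
      finally show ?thesis .
    qed
    show ?thesis
    proof (rule ccontr)
      assume "\<not> ?thesis"
      then obtain r where "0 \<le> r"
        "(\<integral>\<^sup>+s\<in>{0<..}. ennreal (p * s powr (p - 1)) * indicator {s. ennreal s < a} s \<partial>lborel) = ennreal r"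
        using top by (cases "(\<integral>\<^sup>+s\<in>{0<..}. ennreal (p * s powr (p - 1)) * indicator {s. ennreal s < a} s \<partial>lborel)") auto
      with *[of "r + 1"] show False by (simp add: ennreal_le_iff)
    qed
  qed (use real in auto)
qed

lemma (in sigma_finite_measure) nn_integral_epowr_layer_cake:
  assumes [measurable]: "f \<in> borel_measurable M" and "0 < p"
  shows "(\<integral>\<^sup>+x. f x epowr p \<partial>M) =
    (\<integral>\<^sup>+s\<in>{0<..}. ennreal (p * s powr (p - 1)) * emeasure M {x\<in>space M. ennreal s < f x} \<partial>lborel)"
proof -
  interpret pair_sigma_finite M "lborel :: real measure" ..
  have "(\<integral>\<^sup>+x. f x epowr p \<partial>M) = (\<integral>\<^sup>+x. (\<integral>\<^sup>+s. ennreal (p * s powr (p - 1)) *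
      indicator {s. ennreal s < f x} s * indicator {0<..} s \<partial>lborel) \<partial>M)"
    by (simp add: epowr_eq_nn_integral[OF assms(2)])
  also have "\<dots> = (\<integral>\<^sup>+s. (\<integral>\<^sup>+x. ennreal (p * s powr (p - 1)) *
      indicator {s. ennreal s < f x} s * indicator {0<..} s \<partial>M) \<partial>lborel)"
    by (rule Fubini'[symmetric]) measurable
  also have "\<dots> = (\<integral>\<^sup>+s. (\<integral>\<^sup>+x. (ennreal (p * s powr (p - 1)) * indicator {0<..} s) *
      indicator {x\<in>space M. ennreal s < f x} x \<partial>M) \<partial>lborel)"
    by (intro nn_integral_cong) (auto split: split_indicator)
  also have "\<dots> = (\<integral>\<^sup>+s\<in>{0<..}. ennreal (p * s powr (p - 1)) * emeasure M {x\<in>space M. ennreal s < f x} \<partial>lborel)"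
    by (subst nn_integral_cmult) (auto simp: mult_ac)
  finally show ?thesis .
qed

section \<open>Riesz kernels and the weak maximum principle\<close>

text \<open>The class in which Tonelli is applied. It contains Lebesgue measure, the locally finite
  measures of the problem and the finite measures made from them by truncation and
  mollification.\<close>

definition sigma_finite_borel :: "'a::euclidean_space measure \<Rightarrow> bool" where
  "sigma_finite_borel \<mu> \<longleftrightarrow> sets \<mu> = sets borel \<and> sigma_finite_measure \<mu>"

lemma sigma_finite_borelD:
  assumes "sigma_finite_borel \<mu>"
  shows "sets \<mu> = sets borel" "space \<mu> = UNIV" "sigma_finite_measure \<mu>"
  using assms sets_eq_imp_space_eq[of \<mu> borel] by (auto simp: sigma_finite_borel_def)

lemma borel_measurable_sigma_finite_borel [simp]:
  "sigma_finite_borel \<mu> \<Longrightarrow> borel_measurable \<mu> = borel_measurable borel"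
  using measurable_cong_sets[of \<mu> borel] by (auto simp: sigma_finite_borel_def)

lemma sigma_finite_borel_lborel [simp]: "sigma_finite_borel lborel"
  by (simp add: sigma_finite_borel_def lborel.sigma_finite_measure_axioms)

lemma AE_False_imp_null:
  assumes "sigma_finite_borel \<mu>" "AE x in \<mu>. False"
  shows "emeasure \<mu> UNIV = 0"
  using assms AE_iff_measurable[of UNIV \<mu> "\<lambda>_. False"] by (auto simp: sigma_finite_borelD)

lemma locally_finite_borel_compact:
  assumes "locally_finite_borel \<mu>" "compact K"
  shows "emeasure \<mu> K < \<infinity>"
proof -
  have sets: "sets \<mu> = sets borel"
    using assms(1) by (simp add: locally_finite_borel_def)
  obtain U where U: "\<And>x. open (U x)" "\<And>x. x \<in> U x" "\<And>x. emeasure \<mu> (U x) < \<infinity>"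
    using assms(1) unfolding locally_finite_borel_def by metis
  obtain C where C: "C \<subseteq> K" "finite C" "K \<subseteq> (\<Union>x\<in>C. U x)"
    using compactE_image[OF assms(2), of K U] U by blast
  have "emeasure \<mu> K \<le> emeasure \<mu> (\<Union>x\<in>C. U x)"
    using C U by (intro emeasure_mono) (auto simp: sets)
  also have "\<dots> \<le> (\<Sum>x\<in>C. emeasure \<mu> (U x))"
    using C U by (intro emeasure_subadditive_finite) (auto simp: sets)
  also have "\<dots> < \<infinity>"
    using C U by (simp add: ennreal_sum_less_top)
  finally show ?thesis .
qed

lemma sigma_finite_borelI:
  assumes "sets \<mu> = sets borel" "\<And>m::nat. emeasure \<mu> (cball 0 (real m)) < \<infinity>"
  shows "sigma_finite_borel \<mu>"
  unfolding sigma_finite_borel_def sigma_finite_measure_def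
proof (intro conjI exI[of _ "range (\<lambda>m. cball 0 (real m) :: 'a set)"])
  have "(\<Union>m. cball 0 (real m)) = (UNIV :: 'a set)"
    by (auto simp: real_arch_simple)
  then show "\<Union> (range (\<lambda>m. cball 0 (real m) :: 'a set)) = space \<mu>"
    using sets_eq_imp_space_eq[OF assms(1)] by simp
qed (use assms in \<open>auto simp: less_top\<close>)

lemma locally_finite_borel_sigma_finite:
  "locally_finite_borel \<mu> \<Longrightarrow> sigma_finite_borel \<mu>"
  using locally_finite_borel_compact[of \<mu>]
  by (intro sigma_finite_borelI) (auto simp: locally_finite_borel_def)

lemma sigma_finite_borel_finite:
  assumes "sets \<mu> = sets borel" "emeasure \<mu> UNIV < \<infinity>"
  shows "sigma_finite_borel \<mu>"
  using assms
  by (intro sigma_finite_borelI) (auto intro: le_less_trans[OF emeasure_mono])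

lemma Tonelli_borel:
  assumes "sigma_finite_borel \<mu>" "sigma_finite_borel \<nu>"
    and [measurable]: "(\<lambda>p. f (fst p) (snd p)) \<in> borel_measurable (borel \<Otimes>\<^sub>M borel)"
  shows "(\<integral>\<^sup>+x. (\<integral>\<^sup>+y. f x y \<partial>\<nu>) \<partial>\<mu>) = (\<integral>\<^sup>+y. (\<integral>\<^sup>+x. f x y \<partial>\<mu>) \<partial>\<nu>)"
proof -
  have [measurable_cong]: "sets \<mu> = sets borel" "sets \<nu> = sets borel"
    using assms by (auto dest: sigma_finite_borelD)
  interpret pair_sigma_finite \<mu> \<nu>
    using assms by (auto simp: sigma_finite_borel_def pair_sigma_finite_def)
  show ?thesis
    by (rule Fubini'[symmetric]) measurable
qed

text \<open>\<open>0 powr\<close> anything is \<open>0\<close>, so the singular value on the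
  diagonal has to be put in by hand. It makes the potential of a measure infinite at its
  atoms.\<close>

definition riesz_kernel :: "real \<Rightarrow> 'a::euclidean_space \<Rightarrow> 'a \<Rightarrow> ennreal" where
  "riesz_kernel \<alpha> x y =
     (if x = y then \<infinity>
      else ennreal (riesz_const (real DIM('a)) \<alpha> * dist x y powr (\<alpha> - real DIM('a))))"

text \<open>The convolution form of \<open>riesz_potential\<close>; the two agree on sigma-finite
  Borel measures by \<open>riesz_potential_eq\<close>.\<close>

definition potential :: "real \<Rightarrow> 'a::euclidean_space measure \<Rightarrow> 'a \<Rightarrow> ennreal" where
  "potential \<alpha> \<mu> x = (\<integral>\<^sup>+y. riesz_kernel \<alpha> x y \<partial>\<mu>)"

lemma riesz_kernel_commute: "riesz_kernel \<alpha> x y = riesz_kernel \<alpha> y x"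
  by (auto simp: riesz_kernel_def dist_commute)

lemma measurable_riesz_kernel [measurable (raw)]:
  fixes f g :: "'b \<Rightarrow> 'a::euclidean_space"
  assumes [measurable]: "f \<in> measurable M borel" "g \<in> measurable M borel"
  shows "(\<lambda>x. riesz_kernel \<alpha> (f x) (g x)) \<in> borel_measurable M"
proof -
  have *: "riesz_kernel \<alpha> x y = (if dist x y = 0 then \<infinity>
      else ennreal (riesz_const (real DIM('a)) \<alpha> * dist x y powr (\<alpha> - real DIM('a))))" for x y :: 'a
    by (simp add: riesz_kernel_def)
  show ?thesis
    unfolding * by measurable
qed

lemma measurable_potential_density [measurable (raw)]:
  assumes \<mu>: "sigma_finite_borel \<mu>" and [measurable]: "f \<in> borel_measurable borel"
  shows "(\<lambda>x. potential \<alpha> (density \<mu> f) x) \<in> borel_measurable borel"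
proof -
  have [measurable_cong]: "sets \<mu> = sets borel"
    using \<mu> by (rule sigma_finite_borelD)
  interpret sigma_finite_measure \<mu>
    using \<mu> by (rule sigma_finite_borelD)
  have "potential \<alpha> (density \<mu> f) x = (\<integral>\<^sup>+y. f y * riesz_kernel \<alpha> x y \<partial>\<mu>)" for x
    unfolding potential_def by (rule nn_integral_density) measurable
  then show ?thesis by simp
qed

lemma potential_density:
  assumes \<mu>: "sets \<mu> = sets borel" and [measurable]: "f \<in> borel_measurable borel"
  shows "potential \<alpha> (density \<mu> f) x = (\<integral>\<^sup>+y. f y * riesz_kernel \<alpha> x y \<partial>\<mu>)"
proof -
  note \<mu> [measurable_cong]
  show ?thesis
    unfolding potential_def by (rule nn_integral_density) measurable
qed

lemma measurable_potential [measurable (raw)]: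
  assumes "sigma_finite_borel \<mu>"
  shows "(\<lambda>x. potential \<alpha> \<mu> x) \<in> borel_measurable borel"
  using measurable_potential_density[OF assms, of "\<lambda>_. 1"] by (simp add: density_1)

text \<open>Symmetry of the kernel and Tonelli. The weights let the same identity serve restrictions
  to level sets, mollified densities and, with constant weight \<open>1\<close>, plain
  measures.\<close>

lemma potential_symmetric:
  assumes \<mu>: "sigma_finite_borel \<mu>" and \<nu>: "sigma_finite_borel \<nu>"
    and [measurable]: "f \<in> borel_measurable borel" "g \<in> borel_measurable borel"
  shows "(\<integral>\<^sup>+x. g x * potential \<alpha> (density \<mu> f) x \<partial>\<nu>) = (\<integral>\<^sup>+y. f y * potential \<alpha> (density \<nu> g) y \<partial>\<mu>)"
proof -
  note [measurable_cong] = sigma_finite_borelD(1)[OF \<mu>] sigma_finite_borelD(1)[OF \<nu>]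
  have "(\<integral>\<^sup>+x. g x * potential \<alpha> (density \<mu> f) x \<partial>\<nu>)
      = (\<integral>\<^sup>+x. (\<integral>\<^sup>+y. g x * (f y * riesz_kernel \<alpha> x y) \<partial>\<mu>) \<partial>\<nu>)"
    by (subst nn_integral_cmult) (auto simp: potential_density sigma_finite_borelD(1)[OF \<mu>])
  also have "\<dots> = (\<integral>\<^sup>+y. (\<integral>\<^sup>+x. g x * (f y * riesz_kernel \<alpha> x y) \<partial>\<nu>) \<partial>\<mu>)"
    by (rule Tonelli_borel[OF \<nu> \<mu>]) measurable
  also have "\<dots> = (\<integral>\<^sup>+y. (\<integral>\<^sup>+x. f y * (g x * riesz_kernel \<alpha> y x) \<partial>\<nu>) \<partial>\<mu>)"
    by (simp add: riesz_kernel_commute mult_ac)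
  also have "\<dots> = (\<integral>\<^sup>+y. f y * potential \<alpha> (density \<nu> g) y \<partial>\<mu>)"
    by (subst nn_integral_cmult) (auto simp: potential_density sigma_finite_borelD(1)[OF \<nu>])
  finally show ?thesis .
qed

lemma potential_mono_density:
  assumes "sigma_finite_borel \<mu>" and [measurable]: "f \<in> borel_measurable borel" "g \<in> borel_measurable borel"
    and "AE y in \<mu>. f y \<le> g y"
  shows "potential \<alpha> (density \<mu> f) x \<le> potential \<alpha> (density \<mu> g) x"
proof -
  have "AE y in \<mu>. f y * riesz_kernel \<alpha> x y \<le> g y * riesz_kernel \<alpha> x y"
    using assms(4) by eventually_elim (rule mult_right_mono, auto)
  then show ?thesis
    by (simp add: potential_density sigma_finite_borelD(1)[OF assms(1)] nn_integral_mono_AE)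
qed

text \<open>The order is a parameter because the results are also used at
  \<open>2 * \<alpha>\<close> and \<open>\<alpha> / 2\<close>. \<open>ty\<close> only fixes the
  underlying space.\<close>

locale riesz =
  fixes \<alpha> N c :: real and ty :: "'a::euclidean_space itself"
  assumes \<alpha>_pos: "0 < \<alpha>" and \<alpha>_less: "\<alpha> < N"
    and N_def: "N = real DIM('a)" and c_def: "c = riesz_const N \<alpha>"
begin

abbreviation k :: "'a \<Rightarrow> 'a \<Rightarrow> ennreal" where "k \<equiv> riesz_kernel \<alpha>"
abbreviation G :: "'a measure \<Rightarrow> 'a \<Rightarrow> ennreal" where "G \<equiv> potential \<alpha>"

lemma c_pos: "0 < c"
  using \<alpha>_pos \<alpha>_less by (simp add: c_def riesz_const_def Gamma_real_pos)

lemma kernel_eq: "k x y = (if x = y then \<infinity> else ennreal (c * dist x y powr (\<alpha> - N)))"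
  by (simp add: riesz_kernel_def c_def N_def)

text \<open>Integrating \<open>r powr (\<alpha> - N - 1)\<close> from \<open>dist x y\<close> to
  infinity gives \<open>dist x y powr (\<alpha> - N) / (N - \<alpha>)\<close>; on the diagonal the
  integral diverges at zero.\<close>

lemma riesz_kernel_radial:
  "k x y = ennreal ((N - \<alpha>) * c) *
     (\<integral>\<^sup>+r\<in>{0<..}. indicator (ball x r) y * ennreal (1 / r powr (N - \<alpha>) / r) \<partial>lborel)"
proof -
  have pw: "1 / r powr (N - \<alpha>) / r = r powr (\<alpha> - N - 1)" if "0 < r" for r :: real
    using that by (simp add: powr_diff)
  have ind: "indicator (ball x r) y * ennreal (1 / r powr (N - \<alpha>) / r) * indicator {0<..} r
      = ennreal (r powr (\<alpha> - N - 1)) * indicator {r. 0 < r \<and> dist x y < r} r" for r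
    using pw[of r] by (auto split: split_indicator)
  show ?thesis
  proof (cases "x = y")
    case False
    have "(\<integral>\<^sup>+r\<in>{0<..}. indicator (ball x r) y * ennreal (1 / r powr (N - \<alpha>) / r) \<partial>lborel)
      = (\<integral>\<^sup>+r. ennreal (r powr (\<alpha> - N - 1)) * indicator {dist x y..} r \<partial>lborel)"
    proof -
      have "0 < r" if "dist x y \<le> r" for r
        using False that zero_less_dist_iff[of x y] by linarith
      then show ?thesis
        unfolding ind by (intro nn_integral_AE_singleton[of "dist x y"]) (auto split: split_indicator)
    qed
    also have "\<dots> = ennreal (dist x y powr (\<alpha> - N) / (N - \<alpha>))"
      using False \<alpha>_less by (subst nn_integral_powr_to_inf) auto
    finally show ?thesis
      using False \<alpha>_less c_pos by (simp add: kernel_eq ennreal_mult[symmetric])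
  next
    case True
    define J where "J = (\<integral>\<^sup>+r. ennreal (r powr (\<alpha> - N - 1)) * indicator {0<..} r \<partial>lborel)"
    have "ennreal B \<le> J" if "0 \<le> B" for B
    proof -
      \<comment> \<open>Chosen such that the part of the integral beyond \<open>d\<close> equals
        \<open>B + 1\<close>.\<close>
      define d where "d = ((B + 1) * (N - \<alpha>)) powr (1 / (\<alpha> - N))"
      have d: "0 < d" using that \<alpha>_less by (simp add: d_def)
      have "ennreal B \<le> ennreal (d powr (\<alpha> - N) / (N - \<alpha>))"
        using that \<alpha>_less by (intro ennreal_leI) (simp add: d_def powr_powr)
      also have "\<dots> = (\<integral>\<^sup>+r. ennreal (r powr (\<alpha> - N - 1)) * indicator {d..} r \<partial>lborel)"
        using d \<alpha>_less by (subst nn_integral_powr_to_inf) auto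
      also have "\<dots> \<le> J"
        using d unfolding J_def by (intro nn_integral_mono) (auto split: split_indicator)
      finally show ?thesis .
    qed
    note * = this
    have "J = \<infinity>"
    proof (rule ccontr)
      assume "J \<noteq> \<infinity>"
      then obtain b where "0 \<le> b" "J = ennreal b" by (cases J) auto
      with *[of "b + 1"] show False by (simp add: ennreal_le_iff)
    qed
    moreover have "(\<integral>\<^sup>+r\<in>{0<..}. indicator (ball x r) y * ennreal (1 / r powr (N - \<alpha>) / r) \<partial>lborel) = J"
      unfolding J_def ind using True by (intro nn_integral_cong) (auto split: split_indicator)
    ultimately show ?thesis
      using True c_pos \<alpha>_less by (simp add: kernel_eq ennreal_mult_top)
  qed
qed

text \<open>Stated for densities because \<open>f\<close> may be infinite, so that
  \<open>density \<mu> f\<close> need not be sigma-finite; Tonelli is applied to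
  \<open>\<mu>\<close> instead.\<close>

lemma riesz_potential_density:
  assumes \<mu>: "sigma_finite_borel \<mu>" and [measurable]: "f \<in> borel_measurable borel"
  shows "riesz_potential \<alpha> (density \<mu> f) x = G (density \<mu> f) x"
proof -
  note [measurable_cong] = sigma_finite_borelD(1)[OF \<mu>]
  have [measurable]: "(\<lambda>p. indicator (ball x (fst p)) (snd p) :: ennreal) \<in> borel_measurable (borel \<Otimes>\<^sub>M borel)"
    by (subst measurable_cong[where g = "\<lambda>p. indicator {p. dist x (snd p) < fst p} p"])
      (auto split: split_indicator)
  have "(\<integral>\<^sup>+r\<in>{0<..}. emeasure (density \<mu> f) (ball x r) * ennreal (1 / r powr (N - \<alpha>) / r) \<partial>lborel)
    = (\<integral>\<^sup>+r. (\<integral>\<^sup>+y. f y * (indicator (ball x r) y * ennreal (1 / r powr (N - \<alpha>) / r) * indicator {0<..} r) \<partial>\<mu>) \<partial>lborel)"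
  proof (intro nn_integral_cong)
    fix r
    have "emeasure (density \<mu> f) (ball x r) * (ennreal (1 / r powr (N - \<alpha>) / r) * indicator {0<..} r)
      = (\<integral>\<^sup>+y. f y * indicator (ball x r) y * (ennreal (1 / r powr (N - \<alpha>) / r) * indicator {0<..} r) \<partial>\<mu>)"
    proof -
      have [measurable]: "f \<in> borel_measurable \<mu>" by measurable
      have B: "ball x r \<in> sets \<mu>" by (simp add: sigma_finite_borelD(1)[OF \<mu>])
      have "emeasure (density \<mu> f) (ball x r) = (\<integral>\<^sup>+y. f y * indicator (ball x r) y \<partial>\<mu>)"
        using B by (intro emeasure_density) auto
      moreover have "(\<lambda>y. f y * indicator (ball x r) y) \<in> borel_measurable \<mu>"
        using B by (intro borel_measurable_times_ennreal borel_measurable_indicator) auto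
      ultimately show ?thesis
        by (simp add: nn_integral_multc)
    qed
    then show "emeasure (density \<mu> f) (ball x r) * ennreal (1 / r powr (N - \<alpha>) / r) * indicator {0<..} r
      = (\<integral>\<^sup>+y. f y * (indicator (ball x r) y * ennreal (1 / r powr (N - \<alpha>) / r) * indicator {0<..} r) \<partial>\<mu>)"
      by (simp add: mult.assoc)
  qed
  also have "\<dots> = (\<integral>\<^sup>+y. (\<integral>\<^sup>+r. f y * (indicator (ball x r) y * ennreal (1 / r powr (N - \<alpha>) / r) * indicator {0<..} r) \<partial>lborel) \<partial>\<mu>)"
    by (rule Tonelli_borel[OF _ \<mu>]) (simp, measurable)
  also have "\<dots> = (\<integral>\<^sup>+y. f y * (\<integral>\<^sup>+r\<in>{0<..}. indicator (ball x r) y * ennreal (1 / r powr (N - \<alpha>) / r) \<partial>lborel) \<partial>\<mu>)"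
  proof (intro nn_integral_cong nn_integral_cmult)
    fix y
    have eq: "indicator (ball x r) y = (indicator {dist x y<..} r :: ennreal)" for r
      by (auto split: split_indicator)
    show "(\<lambda>r. indicator (ball x r) y * ennreal (1 / r powr (N - \<alpha>) / r) * indicator {0<..} r) \<in> borel_measurable lborel"
      unfolding eq by measurable
  qed
  finally have "riesz_potential \<alpha> (density \<mu> f) x = ennreal ((N - \<alpha>) * c) *
     (\<integral>\<^sup>+y. f y * (\<integral>\<^sup>+r\<in>{0<..}. indicator (ball x r) y * ennreal (1 / r powr (N - \<alpha>) / r) \<partial>lborel) \<partial>\<mu>)"
    by (simp add: riesz_potential_def N_def c_def)
  also have "\<dots> = (\<integral>\<^sup>+y. ennreal ((N - \<alpha>) * c) * (f y *
      (\<integral>\<^sup>+r\<in>{0<..}. indicator (ball x r) y * ennreal (1 / r powr (N - \<alpha>) / r) \<partial>lborel)) \<partial>\<mu>)"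
  proof (rule nn_integral_cmult[symmetric])
    have "(\<integral>\<^sup>+r\<in>{0<..}. indicator (ball x r) y * ennreal (1 / r powr (N - \<alpha>) / r) \<partial>lborel)
        = ennreal (1 / ((N - \<alpha>) * c)) * k x y" for y
      using \<alpha>_less c_pos
      by (simp add: riesz_kernel_radial mult.assoc[symmetric] ennreal_mult[symmetric])
    then have "(\<lambda>y. \<integral>\<^sup>+r\<in>{0<..}. indicator (ball x r) y * ennreal (1 / r powr (N - \<alpha>) / r) \<partial>lborel) \<in> borel_measurable borel"
      by simp
    then show "(\<lambda>y. f y * (\<integral>\<^sup>+r\<in>{0<..}. indicator (ball x r) y * ennreal (1 / r powr (N - \<alpha>) / r) \<partial>lborel)) \<in> borel_measurable \<mu>"
      by measurable
  qed
  also have "\<dots> = G (density \<mu> f) x"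
    by (simp add: potential_density sigma_finite_borelD(1)[OF \<mu>] riesz_kernel_radial mult_ac)
  finally show ?thesis .
qed

lemma riesz_potential_eq: "sigma_finite_borel \<mu> \<Longrightarrow> riesz_potential \<alpha> \<mu> = G \<mu>"
  using riesz_potential_density[of \<mu> "\<lambda>_. 1"] by (auto simp: density_1)

section \<open>Pointwise estimates of the kernel\<close>

lemma kernel_lower:
  assumes "dist x y \<le> R" "0 < R"
  shows "ennreal (c * R powr (\<alpha> - N)) \<le> k x y"
  using assms \<alpha>_less c_pos
  by (auto simp: kernel_eq intro!: ennreal_leI mult_left_mono powr_mono2')

lemma kernel_upper:
  assumes "R \<le> dist x y" "0 < R"
  shows "k x y \<le> ennreal (c * R powr (\<alpha> - N))"
  using assms \<alpha>_less c_pos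
  by (auto simp: kernel_eq intro!: ennreal_leI mult_left_mono powr_mono2')

lemma kernel_le_kernel:
  assumes "dist y z \<le> t * dist x z" "0 < t"
  shows "k x z \<le> ennreal (t powr (N - \<alpha>)) * k y z"
proof (cases "x = z \<or> y = z")
  case True
  then show ?thesis
    using assms by (auto simp: kernel_eq ennreal_mult_top)
next
  case False
  have "dist x z powr (\<alpha> - N) = t powr (N - \<alpha>) * (t * dist x z) powr (\<alpha> - N)"
    using assms(2) by (simp add: powr_mult powr_add[symmetric] mult.assoc[symmetric])
  also have "\<dots> \<le> t powr (N - \<alpha>) * dist y z powr (\<alpha> - N)"
    using False assms \<alpha>_less by (intro mult_left_mono powr_mono2') auto
  finally show ?thesis
    using False c_pos by (simp add: kernel_eq ennreal_mult[symmetric] ennreal_le_iff mult_left_mono mult.left_commute)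
qed

text \<open>Moving \<open>x\<close> to an almost nearest point of \<open>S\<close> at most doubles the distances to the points
  of \<open>S\<close>.\<close>

lemma weak_maximum_principle:
  assumes \<mu>: "sigma_finite_borel \<mu>" and S: "S \<in> sets borel"
    and m: "\<And>y. y \<in> S \<Longrightarrow> (\<integral>\<^sup>+z\<in>S. k y z \<partial>\<mu>) \<le> m"
  shows "(\<integral>\<^sup>+z\<in>S. k x z \<partial>\<mu>) \<le> ennreal (2 powr (N - \<alpha>)) * m"
proof -
  note S [measurable] and [measurable_cong] = sigma_finite_borelD(1)[OF \<mu>]
  consider "S = {}" | "x \<in> S" | "x \<notin> S" "S \<noteq> {}" by blast
  then show ?thesis
  proof cases
    case 2
    have "m \<le> ennreal (2 powr (N - \<alpha>)) * m"
      using mult_right_mono[of 1 "ennreal (2 powr (N - \<alpha>))" m] \<alpha>_less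
      by (auto simp: ge_one_powr_ge_zero)
    with m[OF 2] show ?thesis by (rule order_trans)
  next
    case 3
    \<comment> \<open>The slack \<open>1 / Suc j\<close> is there because a nearest point of
      \<open>S\<close> need not exist. With the factor \<open>2 powr (N - \<alpha>)\<close> undoing
      the doubled distance, \<open>g j z\<close> increases to \<open>k x z\<close> for
      \<open>z\<close> in \<open>S\<close>, where \<open>z\<close> differs from
      \<open>x\<close>.\<close>
    define g where "g j z = ennreal (c * (2 powr (N - \<alpha>) * (2 * dist x z + 1 / Suc j) powr (\<alpha> - N)))" for j z
    have le: "(\<integral>\<^sup>+z\<in>S. g j z \<partial>\<mu>) \<le> ennreal (2 powr (N - \<alpha>)) * m" for j
    proof -
      obtain y where y: "y \<in> S" "dist x y < infdist x S + 1 / Suc j"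
        using 3 cInf_lessD[of "dist x ` S" "infdist x S + 1 / Suc j"] by (auto simp: infdist_def)
      have "g j z \<le> ennreal (2 powr (N - \<alpha>)) * k y z" if "z \<in> S" for z
      proof -
        have "dist y z \<le> 2 * dist x z + 1 / Suc j"
          using dist_triangle[of y z x] infdist_le[OF that, of x] y by (simp add: dist_commute)
        then have "ennreal (c * (2 * dist x z + 1 / Suc j) powr (\<alpha> - N)) \<le> k y z"
          by (intro kernel_lower) (auto intro: add_nonneg_pos)
        then show ?thesis
          using c_pos mult_left_mono[of "ennreal (c * (2 * dist x z + 1 / Suc j) powr (\<alpha> - N))" "k y z" "ennreal (2 powr (N - \<alpha>))"]
          by (simp add: g_def ennreal_mult[symmetric] mult.left_commute)
      qed
      then have "(\<integral>\<^sup>+z\<in>S. g j z \<partial>\<mu>) \<le> (\<integral>\<^sup>+z. ennreal (2 powr (N - \<alpha>)) * (k y z * indicator S z) \<partial>\<mu>)"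
        by (intro nn_integral_mono) (auto split: split_indicator)
      also have "\<dots> \<le> ennreal (2 powr (N - \<alpha>)) * m"
        by (subst nn_integral_cmult) (auto intro!: mult_left_mono m y)
      finally show ?thesis .
    qed
    have g_mono: "g i z \<le> g j z" if "i \<le> j" for i j z
      unfolding g_def using that \<alpha>_less c_pos
      by (intro ennreal_leI mult_left_mono powr_mono2' add_left_mono)
         (auto intro!: divide_left_mono add_nonneg_pos)
    have g_lim: "(\<lambda>j. g j z) \<longlonglongrightarrow> k x z" if "z \<in> S" for z
    proof -
      have ne: "x \<noteq> z" using 3 that by auto
      have "(\<lambda>j. (2 * dist x z + 1 / Suc j) powr (\<alpha> - N)) \<longlonglongrightarrow> (2 * dist x z + 0) powr (\<alpha> - N)"
        using ne by (intro tendsto_intros LIMSEQ_Suc[OF lim_1_over_n]) auto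
      then have "(\<lambda>j. g j z) \<longlonglongrightarrow> ennreal (c * (2 powr (N - \<alpha>) * (2 * dist x z + 0) powr (\<alpha> - N)))"
        unfolding g_def by (intro tendsto_ennrealI tendsto_mult tendsto_const)
      also have "c * (2 powr (N - \<alpha>) * (2 * dist x z + 0) powr (\<alpha> - N)) = c * dist x z powr (\<alpha> - N)"
        by (simp add: powr_mult powr_add[symmetric] mult.assoc[symmetric])
      finally show ?thesis
        using ne by (simp add: kernel_eq)
    qed
    have "(SUP j. g j z * indicator S z) = k x z * indicator S z" for z
    proof (cases "z \<in> S")
      case True
      have "(SUP j. g j z) = k x z"
        using g_lim[OF True] by (intro LIMSEQ_unique[OF LIMSEQ_SUP]) (auto simp: incseq_def g_mono)
      then show ?thesis using True by simp
    qed auto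
    then have "(\<integral>\<^sup>+z\<in>S. k x z \<partial>\<mu>) = (\<integral>\<^sup>+z. (SUP j. g j z * indicator S z) \<partial>\<mu>)"
      by simp
    also have "\<dots> = (SUP j. \<integral>\<^sup>+z. g j z * indicator S z \<partial>\<mu>)"
    proof (intro nn_integral_monotone_convergence_SUP)
      show "incseq (\<lambda>j z. g j z * indicator S z)"
        by (auto simp: incseq_def le_fun_def g_mono intro!: mult_right_mono)
      show "(\<lambda>z. g j z * indicator S z) \<in> borel_measurable \<mu>" for j
        unfolding g_def by measurable
    qed
    also have "\<dots> \<le> ennreal (2 powr (N - \<alpha>)) * m"
      using le by (intro SUP_least)
    finally show ?thesis .
  qed auto
qed

end

section \<open>Comparison of potentials\<close>

lemma (in sigma_finite_measure) measurable_emeasure_level: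
  assumes [measurable]: "f \<in> borel_measurable M"
  shows "(\<lambda>s::real. emeasure M {x\<in>space M. ennreal s < f x}) \<in> borel_measurable borel"
proof -
  have "emeasure M {x\<in>space M. ennreal s < f x} = (\<integral>\<^sup>+x. (if ennreal s < f x then 1 else 0) \<partial>M)" for s :: real
  proof -
    have "(\<integral>\<^sup>+x. (if ennreal s < f x then 1 else 0) \<partial>M) = (\<integral>\<^sup>+x. indicator {x\<in>space M. ennreal s < f x} x \<partial>M)"
      by (intro nn_integral_cong) auto
    then show ?thesis by simp
  qed
  then show ?thesis by simp
qed

lemma potential_SUP:
  assumes \<sigma>: "sigma_finite_borel \<sigma>"
    and [measurable]: "\<And>m::nat. f m \<in> borel_measurable borel" "g \<in> borel_measurable borel"
    and mono: "\<And>m y. f m y \<le> f (Suc m) y"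
    and sup: "AE y in \<sigma>. (SUP m. f m y) = g y"
  shows "potential \<alpha> (density \<sigma> g) x = (SUP m. potential \<alpha> (density \<sigma> (f m)) x)"
proof -
  note [measurable_cong] = sigma_finite_borelD(1)[OF \<sigma>]
  have "potential \<alpha> (density \<sigma> g) x = (\<integral>\<^sup>+y. (SUP m. f m y * riesz_kernel \<alpha> x y) \<partial>\<sigma>)"
    unfolding potential_density[OF sigma_finite_borelD(1)[OF \<sigma>] assms(3)]
  proof (intro nn_integral_cong_AE)
    show "AE y in \<sigma>. g y * riesz_kernel \<alpha> x y = (SUP m. f m y * riesz_kernel \<alpha> x y)"
      using sup by eventually_elim (simp add: SUP_mult_right_ennreal[symmetric])
  qed
  also have "\<dots> = (SUP m. \<integral>\<^sup>+y. f m y * riesz_kernel \<alpha> x y \<partial>\<sigma>)"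
    using mono by (intro nn_integral_monotone_convergence_SUP incseq_SucI le_funI mult_right_mono) auto
  finally show ?thesis
    by (simp add: potential_density sigma_finite_borelD(1)[OF \<sigma>])
qed

context riesz
begin

lemma kernel_pos: "0 < k x y"
  using c_pos by (auto simp: kernel_eq)

lemma potential_pos:
  assumes "sigma_finite_borel \<mu>" "emeasure \<mu> UNIV \<noteq> 0"
  shows "0 < G \<mu> x"
proof (rule ccontr)
  note [measurable_cong] = sigma_finite_borelD(1)[OF assms(1)]
  assume "\<not> ?thesis"
  then have "AE y in \<mu>. k x y = 0"
    by (simp add: potential_def nn_integral_0_iff_AE)
  then have "AE y in \<mu>. False"
    by eventually_elim (use kernel_pos in \<open>auto simp: less_le\<close>)
  then show False
    using AE_False_imp_null assms by blast
qed

lemma weak_maximum_principle_density: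
  assumes \<mu>: "sigma_finite_borel \<mu>" and S: "S \<in> sets borel"
    and m: "\<And>y. y \<in> S \<Longrightarrow> G (density \<mu> (indicator S)) y \<le> m"
  shows "G (density \<mu> (indicator S)) x \<le> ennreal (2 powr (N - \<alpha>)) * m"
proof -
  have "G (density \<mu> (indicator S)) y = (\<integral>\<^sup>+z\<in>S. k y z \<partial>\<mu>)" for y
    using S by (subst potential_density) (auto simp: sigma_finite_borelD(1)[OF \<mu>] mult.commute)
  then show ?thesis
    using weak_maximum_principle[OF \<mu> S, of m x] m by simp
qed

lemma potential_le_density_indicator:
  assumes "sigma_finite_borel \<mu>" "S \<in> sets borel"
  shows "G (density \<mu> (indicator S)) x \<le> G \<mu> x"
  using potential_mono_density[OF assms(1), of "indicator S" "\<lambda>_. 1" \<alpha> x] assms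
  by (auto simp: density_1 split: split_indicator)

lemma weak_maximum_principle_level:
  assumes \<mu>: "sigma_finite_borel \<mu>"
  shows "G (density \<mu> (indicator {y. G \<mu> y \<le> s})) x \<le> ennreal (2 powr (N - \<alpha>)) * s"
proof (rule weak_maximum_principle_density[OF \<mu>])
  show "{y. G \<mu> y \<le> s} \<in> sets borel"
    using measurable_potential[OF \<mu>] by measurable
  then show "G (density \<mu> (indicator {y. G \<mu> y \<le> s})) y \<le> s" if "y \<in> {y. G \<mu> y \<le> s}" for y
    using order_trans[OF potential_le_density_indicator[OF \<mu>]] that by blast
qed

text \<open>Where \<open>G \<mu>\<close> exceeds \<open>s\<close>, at least half of it comes from the part of \<open>\<mu>\<close> on which \<open>w\<close> is
  large; symmetry of the kernel then converts the mass of \<open>\<nu>\<close> into mass of \<open>\<mu>\<close>.\<close>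

lemma level_set_transfer:
  assumes \<mu>: "sigma_finite_borel \<mu>" and \<nu>: "sigma_finite_borel \<nu>"
    and w [measurable]: "w \<in> borel_measurable borel" and L [measurable]: "L \<in> sets borel"
    and C: "0 < C" and s: "0 < s"
    and hw: "\<And>x. G (density \<mu> (indicator {y. w y \<le> ennreal (s / (2 * C))})) x \<le> ennreal (C * (s / (2 * C)))"
    and L: "\<And>x. x \<in> L \<Longrightarrow> ennreal s < G \<mu> x"
    and hL: "\<And>x. G (density \<nu> (indicator L)) x \<le> B"
  shows "ennreal (s / 2) * emeasure \<nu> L \<le> B * emeasure \<mu> {y. ennreal (s / (2 * C)) < w y}"
proof -
  note [measurable_cong] = sigma_finite_borelD(1)[OF \<mu>] sigma_finite_borelD(1)[OF \<nu>]
  \<comment> \<open>At the threshold \<open>s / (2 * C)\<close> the hypothesis on \<open>w\<close>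
    bounds the contribution of \<open>A\<close> by exactly \<open>s / 2\<close>.\<close>
  define A where "A = {y. w y \<le> ennreal (s / (2 * C))}"
  define A' where "A' = {y. ennreal (s / (2 * C)) < w y}"
  have [measurable]: "A \<in> sets borel" "A' \<in> sets borel"
    unfolding A_def A'_def by measurable
  have split: "G \<mu> x = G (density \<mu> (indicator A)) x + G (density \<mu> (indicator A')) x" for x
  proof -
    have "G \<mu> x = (\<integral>\<^sup>+y. indicator A y * k x y + indicator A' y * k x y \<partial>\<mu>)"
      unfolding potential_def
      by (intro nn_integral_cong) (auto simp: A_def A'_def split: split_indicator)
    also have "\<dots> = G (density \<mu> (indicator A)) x + G (density \<mu> (indicator A')) x"
      by (subst nn_integral_add) (auto simp: potential_density sigma_finite_borelD(1)[OF \<mu>])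
    finally show ?thesis .
  qed
  have half: "ennreal (s / 2) \<le> G (density \<mu> (indicator A')) x" if "x \<in> L" for x
  proof (rule ccontr)
    assume "\<not> ?thesis"
    then have "G (density \<mu> (indicator A')) x \<le> ennreal (s / 2)" by simp
    moreover have "G (density \<mu> (indicator A)) x \<le> ennreal (s / 2)"
      using hw[of x] C by (simp add: A_def)
    ultimately have "G \<mu> x \<le> ennreal (s / 2) + ennreal (s / 2)"
      unfolding split by (intro add_mono)
    also have "\<dots> = ennreal s"
      using s by (simp add: ennreal_plus[symmetric] del: ennreal_plus)
    finally show False
      using L[OF that] by simp
  qed
  have "ennreal (s / 2) * emeasure \<nu> L = (\<integral>\<^sup>+x. ennreal (s / 2) * indicator L x \<partial>\<nu>)"
    by (subst nn_integral_cmult_indicator) (auto simp: sigma_finite_borelD(1)[OF \<nu>])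
  also have "\<dots> \<le> (\<integral>\<^sup>+x. indicator L x * G (density \<mu> (indicator A')) x \<partial>\<nu>)"
    using half by (intro nn_integral_mono) (auto split: split_indicator)
  also have "\<dots> = (\<integral>\<^sup>+y. indicator A' y * G (density \<nu> (indicator L)) y \<partial>\<mu>)"
    by (rule potential_symmetric[OF \<mu> \<nu>]) auto
  also have "\<dots> \<le> (\<integral>\<^sup>+y. B * indicator A' y \<partial>\<mu>)"
    using hL by (intro nn_integral_mono) (auto split: split_indicator)
  also have "\<dots> = B * emeasure \<mu> A'"
    by (subst nn_integral_cmult_indicator) (auto simp: sigma_finite_borelD(1)[OF \<mu>])
  finally show ?thesis
    unfolding A'_def .
qed

text \<open>The level set inequality is integrated against
  \<open>\<gamma> * s powr (\<gamma> - 1)\<close>. One factor \<open>2 * C\<close> comes from the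
  inequality, the remaining \<open>(2 * C) powr \<gamma>\<close> from rescaling the level of
  \<open>w\<close>.\<close>

lemma potential_comparison:
  assumes \<mu>: "sigma_finite_borel \<mu>" and \<nu>: "sigma_finite_borel \<nu>"
    and [measurable]: "w \<in> borel_measurable borel" "w' \<in> borel_measurable borel"
    and C: "0 < C" and \<gamma>: "0 < \<gamma>"
    and hw: "\<And>s x. 0 < s \<Longrightarrow> G (density \<mu> (indicator {y. w y \<le> ennreal s})) x \<le> ennreal (C * s)"
    and hw': "\<And>s x. 0 < s \<Longrightarrow> G (density \<nu> (indicator {y. w' y \<le> ennreal s})) x \<le> ennreal (C * s)"
  shows "(\<integral>\<^sup>+x. G \<mu> x epowr \<gamma> \<partial>\<nu>) \<le>
    (\<integral>\<^sup>+x. w' x epowr \<gamma> \<partial>\<nu>) + ennreal ((2 * C) powr (\<gamma> + 1)) * (\<integral>\<^sup>+y. w y epowr \<gamma> \<partial>\<mu>)"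
proof -
  note [measurable_cong] = sigma_finite_borelD(1)[OF \<mu>] sigma_finite_borelD(1)[OF \<nu>]
  note [measurable] = measurable_potential[OF \<mu>]
  interpret M: sigma_finite_measure \<mu> using \<mu> by (rule sigma_finite_borelD)
  interpret V: sigma_finite_measure \<nu> using \<nu> by (rule sigma_finite_borelD)
  have lvl: "emeasure \<nu> {x\<in>space \<nu>. ennreal s < G \<mu> x} \<le> emeasure \<nu> {x\<in>space \<nu>. ennreal s < w' x}
      + ennreal (2 * C) * emeasure \<mu> {y\<in>space \<mu>. ennreal s < ennreal (2 * C) * w y}" if "0 < s" for s
  proof -
    \<comment> \<open>Points with \<open>w' > s\<close> are split off and make up the first term; on
      the rest \<open>\<nu>\<close> has potential at most \<open>C * s\<close>, as the transfer
      requires.\<close>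
    define L where "L = {x. ennreal s < G \<mu> x \<and> w' x \<le> ennreal s}"
    have [measurable]: "L \<in> sets borel" unfolding L_def by measurable
    have "G (density \<nu> (indicator L)) x \<le> ennreal (C * s)" for x
    proof -
      have "G (density \<nu> (indicator L)) x \<le> G (density \<nu> (indicator {y. w' y \<le> ennreal s})) x"
        by (intro potential_mono_density[OF \<nu>]) (auto simp: L_def split: split_indicator)
      then show ?thesis using hw'[OF that] by (rule order_trans)
    qed
    then have "ennreal (s / 2) * emeasure \<nu> L \<le> ennreal (C * s) * emeasure \<mu> {y. ennreal (s / (2 * C)) < w y}"
      using that C by (intro level_set_transfer[OF \<mu> \<nu>] hw) (auto simp: L_def)
    then have "ennreal (2 / s) * (ennreal (s / 2) * emeasure \<nu> L)
        \<le> ennreal (2 / s) * (ennreal (C * s) * emeasure \<mu> {y. ennreal (s / (2 * C)) < w y})"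
      by (rule mult_left_mono) auto
    then have "emeasure \<nu> L \<le> ennreal (2 * C) * emeasure \<mu> {y. ennreal (s / (2 * C)) < w y}"
      using that C by (simp add: mult.assoc[symmetric] ennreal_mult[symmetric])
    moreover have "{y. ennreal (s / (2 * C)) < w y} = {y\<in>space \<mu>. ennreal s < ennreal (2 * C) * w y}"
    proof -
      have "ennreal (s / (2 * C)) < w y \<longleftrightarrow> ennreal s < ennreal (2 * C) * w y" for y
        using that C by (cases "w y")
          (auto simp: ennreal_mult[symmetric] ennreal_less_iff field_simps ennreal_mult_top simp del: ennreal_mult'')
      then show ?thesis by (simp add: sigma_finite_borelD[OF \<mu>])
    qed
    moreover have "emeasure \<nu> {x\<in>space \<nu>. ennreal s < G \<mu> x} \<le> emeasure \<nu> ({x\<in>space \<nu>. ennreal s < w' x} \<union> L)"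
      by (intro emeasure_mono) (auto simp: L_def sigma_finite_borelD[OF \<nu>])
    moreover have "\<dots> \<le> emeasure \<nu> {x\<in>space \<nu>. ennreal s < w' x} + emeasure \<nu> L"
      by (intro emeasure_subadditive) auto
    ultimately show ?thesis
      by (auto intro: order_trans add_left_mono)
  qed
  have "(\<integral>\<^sup>+x. G \<mu> x epowr \<gamma> \<partial>\<nu>)
    = (\<integral>\<^sup>+s\<in>{0<..}. ennreal (\<gamma> * s powr (\<gamma> - 1)) * emeasure \<nu> {x\<in>space \<nu>. ennreal s < G \<mu> x} \<partial>lborel)"
    by (intro V.nn_integral_epowr_layer_cake \<gamma>) measurable
  also have "\<dots> \<le> (\<integral>\<^sup>+s. ennreal (\<gamma> * s powr (\<gamma> - 1)) * emeasure \<nu> {x\<in>space \<nu>. ennreal s < w' x} * indicator {0<..} s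
      + ennreal (2 * C) * (ennreal (\<gamma> * s powr (\<gamma> - 1)) * emeasure \<mu> {y\<in>space \<mu>. ennreal s < ennreal (2 * C) * w y} * indicator {0<..} s) \<partial>lborel)"
  proof (intro nn_integral_mono)
    fix s :: real
    show "ennreal (\<gamma> * s powr (\<gamma> - 1)) * emeasure \<nu> {x\<in>space \<nu>. ennreal s < G \<mu> x} * indicator {0<..} s
      \<le> ennreal (\<gamma> * s powr (\<gamma> - 1)) * emeasure \<nu> {x\<in>space \<nu>. ennreal s < w' x} * indicator {0<..} s
      + ennreal (2 * C) * (ennreal (\<gamma> * s powr (\<gamma> - 1)) * emeasure \<mu> {y\<in>space \<mu>. ennreal s < ennreal (2 * C) * w y} * indicator {0<..} s)"
      using mult_left_mono[OF lvl[of s], of "ennreal (\<gamma> * s powr (\<gamma> - 1))"]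
      by (auto split: split_indicator simp: distrib_left mult.left_commute)
  qed
  also have "\<dots> = (\<integral>\<^sup>+x. w' x epowr \<gamma> \<partial>\<nu>) + ennreal (2 * C) * (\<integral>\<^sup>+y. (ennreal (2 * C) * w y) epowr \<gamma> \<partial>\<mu>)"
  proof -
    have [measurable]: "(\<lambda>s. emeasure \<nu> {x\<in>space \<nu>. ennreal s < w' x}) \<in> borel_measurable borel"
      "(\<lambda>s. emeasure \<mu> {y\<in>space \<mu>. ennreal s < ennreal (2 * C) * w y}) \<in> borel_measurable borel"
      by (auto intro!: V.measurable_emeasure_level M.measurable_emeasure_level)
    show ?thesis
      using \<gamma> by (simp add: V.nn_integral_epowr_layer_cake M.nn_integral_epowr_layer_cake
          nn_integral_add nn_integral_cmult)
  qed
  also have "(\<integral>\<^sup>+y. (ennreal (2 * C) * w y) epowr \<gamma> \<partial>\<mu>) = ennreal ((2 * C) powr \<gamma>) * (\<integral>\<^sup>+y. w y epowr \<gamma> \<partial>\<mu>)"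
    using C \<gamma> by (subst nn_integral_cmult[symmetric], measurable) (simp add: epowr_mult epowr_ennreal)
  also have "ennreal (2 * C) * (ennreal ((2 * C) powr \<gamma>) * (\<integral>\<^sup>+y. w y epowr \<gamma> \<partial>\<mu>))
      = ennreal ((2 * C) powr (\<gamma> + 1)) * (\<integral>\<^sup>+y. w y epowr \<gamma> \<partial>\<mu>)"
    using C by (simp add: powr_add mult.assoc[symmetric] ennreal_mult[symmetric] mult.commute)
  finally show ?thesis .
qed

end

section \<open>Pointwise lower bounds\<close>

lemma ennreal_half_le: "0 \<le> A \<Longrightarrow> ennreal A = a + b \<Longrightarrow> b < ennreal (A / 2) \<Longrightarrow> ennreal (A / 2) \<le> a"
  by (cases a; cases b) (auto simp: ennreal_plus[symmetric] ennreal_less_iff simp del: ennreal_plus)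

context riesz
begin

text \<open>The powers of \<open>2\<close> come from keeping only half of the integral, once for the
  inner annulus and \<open>p\<close> times for the lower bound on \<open>G \<nu>\<close> there. The
  factor \<open>3\<close> is the ratio of distances in that lower bound.\<close>

definition iter_const :: "real \<Rightarrow> real" where
  "iter_const p = 2 powr (1 + p) * 3 powr ((N - \<alpha>) * p)"

lemma iter_const_pos: "0 < iter_const p"
  by (simp add: iter_const_def)

text \<open>A median argument: the radius \<open>R\<close> (up to a factor \<open>2\<close>) splits the mass of \<open>k x y d\<nu>(y)\<close>
  outside the \<open>\<epsilon>\<close>-ball into halves, and \<open>G \<nu>\<close> on the inner part dominates the outer half.\<close>

lemma iterated_potential_annulus:
  assumes \<nu>: "sets \<nu> = sets borel" "emeasure \<nu> UNIV < \<infinity>" and p: "0 < p" and \<epsilon>: "0 < \<epsilon>"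
  shows "(\<integral>\<^sup>+y\<in>{y. \<epsilon> \<le> dist x y}. k x y \<partial>\<nu>) epowr (1 + p)
    \<le> ennreal (iter_const p) * G (density \<nu> (\<lambda>y. G \<nu> y epowr p)) x"
proof -
  have sf: "sigma_finite_borel \<nu>" using \<nu> by (rule sigma_finite_borel_finite)
  note [measurable_cong] = \<nu>(1) and [measurable] = measurable_potential[OF sf]
  define \<Lambda> where "\<Lambda> r = (\<integral>\<^sup>+y\<in>{y. r \<le> dist x y}. k x y \<partial>\<nu>)" for r
  have \<Lambda>_le: "\<Lambda> r \<le> ennreal (c * r powr (\<alpha> - N)) * emeasure \<nu> UNIV" if "0 < r" for r
  proof -
    have "\<Lambda> r \<le> (\<integral>\<^sup>+y. ennreal (c * r powr (\<alpha> - N)) \<partial>\<nu>)"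
      unfolding \<Lambda>_def using that kernel_upper[of r x]
      by (intro nn_integral_mono) (auto split: split_indicator)
    then show ?thesis by (simp add: sigma_finite_borelD[OF sf])
  qed
  then have fin: "\<Lambda> \<epsilon> < \<infinity>"
    using \<epsilon> \<nu>(2) by (intro le_less_trans[OF \<Lambda>_le]) (auto simp: ennreal_mult_less_top)
  obtain A where A: "0 \<le> A" "\<Lambda> \<epsilon> = ennreal A"
    using fin by (cases "\<Lambda> \<epsilon>") auto
  show ?thesis
  proof (cases "A = 0")
    case True
    then show ?thesis using A by (simp add: \<Lambda>_def)
  next
    case False
    then have "0 < A" using A by simp
    have ex: "\<exists>j. \<Lambda> (\<epsilon> * 2 ^ j) < ennreal (A / 2)"
    proof -
      obtain b where b: "0 \<le> b" "emeasure \<nu> UNIV = ennreal b"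
        using \<nu>(2) by (cases "emeasure \<nu> UNIV") auto
      have "(\<lambda>j. c * (\<epsilon> * 2 ^ j) powr (\<alpha> - N) * b) \<longlonglongrightarrow> c * 0 * b"
      proof (intro tendsto_intros tendsto_neg_powr)
        show "filterlim (\<lambda>j. \<epsilon> * 2 ^ j) at_top sequentially"
        proof (intro filterlim_tendsto_pos_mult_at_top[OF tendsto_const \<epsilon>])
          have "real j \<le> 2 ^ j" for j by (metis less_exp less_imp_le of_nat_le_iff of_nat_numeral of_nat_power)
          then show "filterlim (\<lambda>j. 2 ^ j :: real) at_top sequentially"
            by (intro filterlim_at_top_mono[OF filterlim_real_sequentially]) auto
        qed
      qed (use \<alpha>_less in auto)
      then have "eventually (\<lambda>j. c * (\<epsilon> * 2 ^ j) powr (\<alpha> - N) * b < A / 2) sequentially"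
        using \<open>0 < A\<close> by (intro order_tendstoD) auto
      then obtain j where "c * (\<epsilon> * 2 ^ j) powr (\<alpha> - N) * b < A / 2"
        by (auto simp: eventually_sequentially)
      then have "\<Lambda> (\<epsilon> * 2 ^ j) < ennreal (A / 2)"
        using \<Lambda>_le[of "\<epsilon> * 2 ^ j"] \<epsilon> b c_pos \<open>0 < A\<close>
        by (intro le_less_trans[OF \<Lambda>_le]) (auto simp: ennreal_mult[symmetric] ennreal_less_iff)
      then show ?thesis ..
    qed
    \<comment> \<open>The first dyadic radius outside of which less than half of \<open>A\<close>
      remains. Hence outside the preceding radius \<open>R\<close> at least half lies, and so does
      at least half inside \<open>2 * R\<close>.\<close>
    define j where "j = (LEAST j. \<Lambda> (\<epsilon> * 2 ^ j) < ennreal (A / 2))"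
    have j: "\<Lambda> (\<epsilon> * 2 ^ j) < ennreal (A / 2)"
      unfolding j_def by (rule LeastI_ex[OF ex])
    have "j \<noteq> 0"
    proof
      assume "j = 0"
      then show False using j A \<open>0 < A\<close> by (simp add: ennreal_less_iff)
    qed
    then obtain i where i: "j = Suc i" by (cases j) auto
    define R where "R = \<epsilon> * 2 ^ i"
    have R: "0 < R" "\<epsilon> \<le> R"
      using \<epsilon> by (auto simp: R_def)
    have out: "ennreal (A / 2) \<le> \<Lambda> R"
      using not_less_Least[of i "\<lambda>j. \<Lambda> (\<epsilon> * 2 ^ j) < ennreal (A / 2)"] i
      by (auto simp: j_def[symmetric] R_def not_less)
    define I where "I = {y. \<epsilon> \<le> dist x y \<and> dist x y < 2 * R}"
    have [measurable]: "I \<in> sets borel"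
      unfolding I_def by measurable
    have "ennreal A = (\<integral>\<^sup>+y\<in>I. k x y \<partial>\<nu>) + \<Lambda> (2 * R)"
    proof -
      have "\<Lambda> \<epsilon> = (\<integral>\<^sup>+y. k x y * indicator I y + k x y * indicator {y. 2 * R \<le> dist x y} y \<partial>\<nu>)"
        unfolding \<Lambda>_def using R
        by (intro nn_integral_cong) (auto simp: I_def split: split_indicator)
      then show ?thesis
        unfolding A(2)[symmetric] by (simp add: \<Lambda>_def nn_integral_add)
    qed
    moreover have "\<Lambda> (2 * R) < ennreal (A / 2)"
      using j i by (simp add: R_def mult.left_commute)
    ultimately have inn: "ennreal (A / 2) \<le> (\<integral>\<^sup>+y\<in>I. k x y \<partial>\<nu>)"
      using A(1) by (intro ennreal_half_le[of A _ "\<Lambda> (2 * R)"]) auto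
    \<comment> \<open>For \<open>y\<close> in the annulus and \<open>z\<close> at distance at least
      \<open>R\<close> from \<open>x\<close>, the distance from \<open>y\<close> to \<open>z\<close>
      is at most \<open>2 * R + dist x z\<close>, hence at most \<open>3 * dist x z\<close>.\<close>
    have low: "ennreal (3 powr (\<alpha> - N) * (A / 2)) \<le> G \<nu> y" if "y \<in> I" for y
    proof -
      have "k x z * indicator {z. R \<le> dist x z} z \<le> ennreal (3 powr (N - \<alpha>)) * k y z" for z
      proof (cases "R \<le> dist x z")
        case True
        have "dist y z \<le> 3 * dist x z"
          using dist_triangle[of y z x] that True by (auto simp: I_def dist_commute)
        then show ?thesis
          using kernel_le_kernel[of y z 3 x] by (auto split: split_indicator)
      qed auto
      then have "\<Lambda> R \<le> (\<integral>\<^sup>+z. ennreal (3 powr (N - \<alpha>)) * k y z \<partial>\<nu>)"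
        unfolding \<Lambda>_def by (intro nn_integral_mono) auto
      also have "\<dots> = ennreal (3 powr (N - \<alpha>)) * G \<nu> y"
        by (subst nn_integral_cmult) (auto simp: potential_def)
      finally have "ennreal (A / 2) \<le> ennreal (3 powr (N - \<alpha>)) * G \<nu> y"
        using out by (rule order_trans[rotated])
      then have "ennreal (3 powr (\<alpha> - N)) * ennreal (A / 2)
          \<le> ennreal (3 powr (\<alpha> - N)) * (ennreal (3 powr (N - \<alpha>)) * G \<nu> y)"
        by (rule mult_left_mono) auto
      then show ?thesis
        using A by (simp add: ennreal_mult[symmetric] mult.assoc[symmetric] powr_add[symmetric])
    qed
    define t where "t = 3 powr (\<alpha> - N) * (A / 2)"
    have t: "0 < t" using \<open>0 < A\<close> by (simp add: t_def)
    have "ennreal (t powr p) * ennreal (A / 2) \<le> ennreal (t powr p) * (\<integral>\<^sup>+y\<in>I. k x y \<partial>\<nu>)"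
      by (intro mult_left_mono inn) auto
    also have "\<dots> = (\<integral>\<^sup>+y. ennreal (t powr p) * (k x y * indicator I y) \<partial>\<nu>)"
      by (subst nn_integral_cmult) auto
    also have "\<dots> \<le> (\<integral>\<^sup>+y. G \<nu> y epowr p * k x y \<partial>\<nu>)"
    proof (intro nn_integral_mono)
      fix y
      show "ennreal (t powr p) * (k x y * indicator I y) \<le> G \<nu> y epowr p * k x y"
      proof (cases "y \<in> I")
        case True
        have "ennreal (t powr p) \<le> G \<nu> y epowr p"
          using epowr_mono[OF _ low[OF True], folded t_def, of p] p t by (simp add: epowr_ennreal)
        then show ?thesis using True by (simp add: mult_right_mono)
      qed auto
    qed
    also have "\<dots> = G (density \<nu> (\<lambda>y. G \<nu> y epowr p)) x"
      by (rule potential_density[symmetric]) (auto simp: \<nu>)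
    finally have "ennreal (t powr p * (A / 2)) \<le> G (density \<nu> (\<lambda>y. G \<nu> y epowr p)) x"
      by (simp only: ennreal_mult' powr_ge_zero)
    then have "ennreal (iter_const p) * ennreal (t powr p * (A / 2))
        \<le> ennreal (iter_const p) * G (density \<nu> (\<lambda>y. G \<nu> y epowr p)) x"
      by (rule mult_left_mono) auto
    moreover have "iter_const p * (t powr p * (A / 2)) = A powr (1 + p)"
    proof -
      define a b where "a = (3::real) powr ((N - \<alpha>) * p)" and "b = (3::real) powr ((\<alpha> - N) * p)"
      have "t powr p = b * (A powr p / 2 powr p)"
        using \<open>0 < A\<close> by (simp add: t_def b_def powr_mult powr_divide powr_powr)
      moreover have "iter_const p = 2 * 2 powr p * a"
        by (simp add: iter_const_def a_def powr_add)
      ultimately have "iter_const p * (t powr p * (A / 2)) = (a * b) * (A * A powr p)"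
        by (simp add: field_simps)
      also have "a * b = 1"
        by (simp add: a_def b_def powr_add[symmetric] algebra_simps)
      finally show ?thesis
        using \<open>0 < A\<close> by (simp add: powr_add)
    qed
    ultimately show ?thesis
      using A iter_const_pos[of p] t by (simp add: \<Lambda>_def[symmetric] epowr_ennreal ennreal_mult[symmetric])
  qed
qed

text \<open>Without an atom at \<open>x\<close> the annuli exhaust \<open>\<nu>\<close> as the inner
  radius tends to zero, and the estimate passes to the supremum. An atom at \<open>x\<close> makes
  both sides infinite.\<close>

lemma iterated_potential:
  assumes \<nu>: "sets \<nu> = sets borel" "emeasure \<nu> UNIV < \<infinity>" and p: "0 < p"
  shows "G \<nu> x epowr (1 + p) \<le> ennreal (iter_const p) * G (density \<nu> (\<lambda>y. G \<nu> y epowr p)) x"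
proof -
  have sf: "sigma_finite_borel \<nu>" using \<nu> by (rule sigma_finite_borel_finite)
  note [measurable_cong] = \<nu>(1) and [measurable] = measurable_potential[OF sf]
  have dens: "G (density \<nu> (\<lambda>y. G \<nu> y epowr p)) x = (\<integral>\<^sup>+y. G \<nu> y epowr p * k x y \<partial>\<nu>)"
    by (rule potential_density) (auto simp: \<nu>)
  show ?thesis
  proof (cases "emeasure \<nu> {x} = 0")
    case False
    have "\<infinity> * emeasure \<nu> {x} = (\<integral>\<^sup>+y. \<infinity> * indicator {x} y \<partial>\<nu>)"
      by (subst nn_integral_cmult_indicator) (auto simp: \<nu>)
    also have "\<dots> \<le> G \<nu> x"
      unfolding potential_def by (intro nn_integral_mono) (auto simp: kernel_eq split: split_indicator)
    finally have inf: "G \<nu> x = \<infinity>"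
      using False by (simp add: ennreal_top_mult top_unique)
    have "\<infinity> * emeasure \<nu> {x} = (\<integral>\<^sup>+y. \<infinity> * indicator {x} y \<partial>\<nu>)"
      by (subst nn_integral_cmult_indicator) (auto simp: \<nu>)
    also have "\<dots> \<le> (\<integral>\<^sup>+y. G \<nu> y epowr p * k x y \<partial>\<nu>)"
      using inf by (intro nn_integral_mono) (auto simp: kernel_eq split: split_indicator)
    finally have "(\<integral>\<^sup>+y. G \<nu> y epowr p * k x y \<partial>\<nu>) = \<infinity>"
      using False by (simp add: ennreal_top_mult top_unique)
    then show ?thesis
      using iter_const_pos[of p] by (simp add: dens ennreal_mult_top)
  next
    case True
    define f where "f j y = k x y * indicator {y. 1 / real (Suc j) \<le> dist x y} y" for j y
    have [measurable]: "f j \<in> borel_measurable borel" for j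
      unfolding f_def by measurable
    have "G \<nu> x = (\<integral>\<^sup>+y. (SUP j. f j y) \<partial>\<nu>)"
      unfolding potential_def
    proof (intro nn_integral_cong_AE)
      have "AE y in \<nu>. y \<noteq> x"
        using True \<nu> by (intro AE_I[of _ _ "{x}"]) auto
      then show "AE y in \<nu>. k x y = (SUP j. f j y)"
      proof eventually_elim
        case (elim y)
        then obtain j where j: "1 / real (Suc j) \<le> dist x y"
          using reals_Archimedean[of "dist x y"] by (auto simp: inverse_eq_divide intro: less_imp_le)
        show ?case
        proof (rule antisym)
          show "k x y \<le> (SUP j. f j y)"
            using j by (intro SUP_upper2[of j]) (auto simp: f_def)
          show "(SUP j. f j y) \<le> k x y"
            by (intro SUP_least) (auto simp: f_def split: split_indicator)
        qed
      qed
    qed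
    also have "\<dots> = (SUP j. \<integral>\<^sup>+y. f j y \<partial>\<nu>)"
    proof (intro nn_integral_monotone_convergence_SUP incseq_SucI le_funI)
      fix j y
      have "1 / real (Suc (Suc j)) \<le> 1 / real (Suc j)"
        by (auto intro: divide_left_mono)
      then show "f j y \<le> f (Suc j) y"
        unfolding f_def by (intro mult_left_mono) (auto split: split_indicator)
    qed auto
    finally have "G \<nu> x epowr (1 + p) = (SUP j. (\<integral>\<^sup>+y. f j y \<partial>\<nu>) epowr (1 + p))"
      using p by (simp add: epowr_SUP)
    also have "\<dots> \<le> ennreal (iter_const p) * G (density \<nu> (\<lambda>y. G \<nu> y epowr p)) x"
      unfolding f_def by (intro SUP_least iterated_potential_annulus \<nu> p) auto
    finally show ?thesis .
  qed
qed

text \<open>The fixed point of \<open>t \<mapsto> t\<^bsup>q\<^esup> / iter_const (q / (1 - q))\<close>.\<close>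

definition lower_const :: "real \<Rightarrow> real" where
  "lower_const q = (1 / iter_const (q / (1 - q))) powr (1 / (1 - q))"

lemma lower_const_pos: "0 < lower_const q"
  using iter_const_pos[of "q / (1 - q)"] by (simp add: lower_const_def)

lemma lower_const_fixed:
  assumes "0 < q" "q < 1"
  shows "lower_const q powr q / iter_const (q / (1 - q)) = lower_const q"
proof -
  define a where "a = 1 / iter_const (q / (1 - q))"
  have a: "0 < a" using iter_const_pos[of "q / (1 - q)"] by (simp add: a_def)
  have e: "1 / (1 - q) * q + 1 = 1 / (1 - q)" using assms by (simp add: field_simps)
  have "lower_const q powr q / iter_const (q / (1 - q)) = a powr (1 / (1 - q) * q) * a powr 1"
    unfolding lower_const_def a_def[symmetric] powr_powr using a by (simp add: a_def)
  also have "\<dots> = a powr (1 / (1 - q))"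
    unfolding powr_add[symmetric] e ..
  finally show ?thesis by (simp add: lower_const_def a_def)
qed

text \<open>The exponents close up for \<open>p = q / (1 - q)\<close>: then
  \<open>1 + p = 1 / (1 - q)\<close>, while the power \<open>q\<close> of
  \<open>G \<nu> epowr (1 / (1 - q))\<close> is \<open>G \<nu> epowr p\<close>. The multiple
  \<open>t\<close> is left free so that the step can be iterated.\<close>

lemma subsolution_step:
  assumes \<nu>: "sets \<nu> = sets borel" "emeasure \<nu> UNIV < \<infinity>" and q: "0 < q" "q < 1" and t: "0 < t"
  shows "ennreal (t powr q / iter_const (q / (1 - q))) * G \<nu> x epowr (1 / (1 - q))
    \<le> G (density \<nu> (\<lambda>y. (ennreal t * G \<nu> y epowr (1 / (1 - q))) epowr q)) x"
proof -
  have sf: "sigma_finite_borel \<nu>" using \<nu> by (rule sigma_finite_borel_finite)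
  note [measurable_cong] = \<nu>(1) and [measurable] = measurable_potential[OF sf]
  define p where "p = q / (1 - q)"
  have p: "0 < p" "1 + p = 1 / (1 - q)" "1 / (1 - q) * q = p"
    using q by (auto simp: p_def field_simps)
  have "G (density \<nu> (\<lambda>y. (ennreal t * G \<nu> y epowr (1 / (1 - q))) epowr q)) x
      = (\<integral>\<^sup>+y. ennreal (t powr q) * (G \<nu> y epowr p * k x y) \<partial>\<nu>)"
    using q t p by (subst potential_density) (auto simp: \<nu> epowr_mult epowr_ennreal epowr_epowr mult.assoc)
  also have "\<dots> = ennreal (t powr q) * G (density \<nu> (\<lambda>y. G \<nu> y epowr p)) x"
    by (subst nn_integral_cmult) (auto simp: potential_density \<nu>)
  finally have eq: "G (density \<nu> (\<lambda>y. (ennreal t * G \<nu> y epowr (1 / (1 - q))) epowr q)) x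
      = ennreal (t powr q) * G (density \<nu> (\<lambda>y. G \<nu> y epowr p)) x" .
  have "ennreal (t powr q / iter_const p) * G \<nu> x epowr (1 + p)
      \<le> ennreal (t powr q / iter_const p) * (ennreal (iter_const p) * G (density \<nu> (\<lambda>y. G \<nu> y epowr p)) x)"
    by (intro mult_left_mono iterated_potential \<nu> p) auto
  also have "\<dots> = ennreal (t powr q) * G (density \<nu> (\<lambda>y. G \<nu> y epowr p)) x"
    using iter_const_pos[of p] by (simp add: mult.assoc[symmetric] ennreal_mult[symmetric])
  finally show ?thesis
    unfolding eq unfolding p(2)[symmetric] p_def .
qed

lemma subsolution:
  assumes \<nu>: "sets \<nu> = sets borel" "emeasure \<nu> UNIV < \<infinity>" and q: "0 < q" "q < 1"
  shows "ennreal (lower_const q) * G \<nu> x epowr (1 / (1 - q))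
    \<le> G (density \<nu> (\<lambda>y. (ennreal (lower_const q) * G \<nu> y epowr (1 / (1 - q))) epowr q)) x"
  using subsolution_step[OF \<nu> q lower_const_pos, of q x] by (simp add: lower_const_fixed q)

text \<open>On a bounded set where \<open>v\<close> is bounded, \<open>v\<close> also has a positive
  lower bound, which in turn bounds the potential of \<open>\<sigma>\<close> restricted to
  \<open>S\<close>. So some positive multiple of the desired function lies below \<open>v\<close> on
  \<open>S\<close>, and \<open>subsolution_step\<close> drives the multiple to its fixed
  point.\<close>

lemma supersolution_lower_bound_restricted:
  assumes \<sigma>: "sigma_finite_borel \<sigma>" and q: "0 < q" "q < 1"
    and v [measurable]: "v \<in> borel_measurable borel" and pos: "\<And>x. 0 < v x"
    and super: "\<And>x. G (density \<sigma> (\<lambda>y. v y epowr q)) x \<le> v x"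
    and S [measurable]: "S \<in> sets borel" and fin: "emeasure \<sigma> S < \<infinity>"
    and S_sub: "S \<subseteq> cball 0 R" and R: "0 < R" and vB: "\<And>x. x \<in> S \<Longrightarrow> v x \<le> ennreal B"
  shows "ennreal (lower_const q) * G (density \<sigma> (indicator S)) x epowr (1 / (1 - q)) \<le> v x"
proof (cases "emeasure \<sigma> S = 0")
  case True
  note [measurable_cong] = sigma_finite_borelD(1)[OF \<sigma>]
  have "AE y in \<sigma>. y \<notin> S"
    using True by (intro AE_I[of _ _ S]) (auto simp: sigma_finite_borelD(1)[OF \<sigma>])
  then have "AE y in \<sigma>. indicator S y * k x y = 0"
    by eventually_elim auto
  then have "G (density \<sigma> (indicator S)) x = 0"
    by (subst potential_density) (auto simp: sigma_finite_borelD(1)[OF \<sigma>] nn_integral_0_iff_AE)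
  then show ?thesis by simp
next
  case False
  note [measurable_cong] = sigma_finite_borelD(1)[OF \<sigma>]
  define \<tau> where "\<tau> = density \<sigma> (indicator S)"
  have \<tau>: "sets \<tau> = sets borel" "emeasure \<tau> UNIV < \<infinity>"
    using fin by (auto simp: \<tau>_def emeasure_density sigma_finite_borelD[OF \<sigma>])
  have \<tau>_sf: "sigma_finite_borel \<tau>" using \<tau> by (rule sigma_finite_borel_finite)
  note [measurable] = measurable_potential[OF \<tau>_sf]
  have mono: "G (density \<tau> h) x \<le> v x"
    if [measurable]: "h \<in> borel_measurable borel" and "\<And>y. y \<in> S \<Longrightarrow> h y \<le> v y epowr q" for h x
  proof -
    have "density \<tau> h = density \<sigma> (\<lambda>y. indicator S y * h y)"
      unfolding \<tau>_def by (rule density_density_eq) (auto simp: sigma_finite_borelD[OF \<sigma>])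
    then have "G (density \<tau> h) x \<le> G (density \<sigma> (\<lambda>y. v y epowr q)) x"
      using that by (simp, intro potential_mono_density[OF \<sigma>]) (auto split: split_indicator)
    then show ?thesis using super by (rule order_trans)
  qed
  define J where "J = (\<integral>\<^sup>+y. v y epowr q \<partial>\<tau>)"
  have "J \<noteq> 0"
  proof
    assume "J = 0"
    then have "AE y in \<tau>. v y epowr q = 0"
      using \<tau> by (simp add: J_def nn_integral_0_iff_AE measurable_cong_sets[OF \<tau>(1) refl])
    then have "AE y in \<tau>. False"
      by eventually_elim (use epowr_pos[OF pos] in \<open>auto simp: less_le\<close>)
    then have "emeasure \<tau> UNIV = 0"
      by (rule AE_False_imp_null[OF \<tau>_sf])
    then show False
      using False by (auto simp: \<tau>_def emeasure_density sigma_finite_borelD[OF \<sigma>])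
  qed
  \<comment> \<open>Points of \<open>S\<close> are at most \<open>2 * R\<close> apart, so the kernel
    is bounded below on pairs from \<open>S\<close>. Comparison with \<open>vB\<close> at one point
    of \<open>S\<close> also shows that \<open>J\<close> is finite.\<close>
  have vlow: "ennreal (c * (2 * R) powr (\<alpha> - N)) * J \<le> v x" if "x \<in> S" for x
  proof -
    have "ennreal (c * (2 * R) powr (\<alpha> - N)) * J
        = (\<integral>\<^sup>+y. ennreal (c * (2 * R) powr (\<alpha> - N)) * (indicator S y * v y epowr q) \<partial>\<sigma>)"
      unfolding J_def \<tau>_def
      by (subst nn_integral_density) (auto simp: nn_integral_cmult)
    also have "\<dots> \<le> (\<integral>\<^sup>+y. v y epowr q * k x y \<partial>\<sigma>)"
    proof (intro nn_integral_mono)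
      fix y
      show "ennreal (c * (2 * R) powr (\<alpha> - N)) * (indicator S y * v y epowr q) \<le> v y epowr q * k x y"
      proof (cases "y \<in> S")
        case True
        have "dist x y \<le> 2 * R"
          using dist_triangle2[of x y 0] subsetD[OF S_sub that] subsetD[OF S_sub True] by (simp add: dist_commute)
        then have "ennreal (c * (2 * R) powr (\<alpha> - N)) \<le> k x y"
          using R by (intro kernel_lower) auto
        then show ?thesis
          using True mult_right_mono[of _ "k x y" "v y epowr q"] by (simp add: mult.commute[of _ "k x y"])
      qed auto
    qed
    also have "\<dots> = G (density \<sigma> (\<lambda>y. v y epowr q)) x"
      by (rule potential_density[symmetric]) (auto simp: sigma_finite_borelD[OF \<sigma>])
    finally show ?thesis using super order_trans by blast
  qed
  obtain x0 where x0: "x0 \<in> S" using False by (metis emeasure_empty equals0I)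
  have "ennreal (c * (2 * R) powr (\<alpha> - N)) * J \<noteq> \<infinity>"
    using vlow[OF x0] vB[OF x0] by (auto simp: top_unique)
  moreover have "ennreal (c * (2 * R) powr (\<alpha> - N)) * J \<noteq> 0"
    using \<open>J \<noteq> 0\<close> c_pos R by simp
  ultimately obtain \<delta> where \<delta>: "0 < \<delta>" "ennreal \<delta> = ennreal (c * (2 * R) powr (\<alpha> - N)) * J"
    by (metis ennreal_cases ennreal_eq_0_iff infinity_ennreal_def not_le)
  have v\<delta>: "ennreal \<delta> \<le> v x" if "x \<in> S" for x
    using vlow[OF that] \<delta> by simp
  \<comment> \<open>From \<open>v \<ge> \<delta>\<close> on \<open>S\<close> follows
    \<open>\<delta> powr q * G \<tau> \<le> v \<le> B\<close> there; the maximum with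
    \<open>1\<close> keeps \<open>E\<close> positive.\<close>
  define E where "E = max 1 (B / \<delta> powr q)"
  have E: "0 < E" by (simp add: E_def)
  have GB: "G \<tau> x \<le> ennreal E" if "x \<in> S" for x
  proof -
    have "ennreal (\<delta> powr q) * G \<tau> x = G (density \<tau> (\<lambda>y. ennreal (\<delta> powr q))) x"
      by (subst potential_density[OF \<tau>(1) borel_measurable_const])
        (simp add: nn_integral_cmult potential_def measurable_cong_sets[OF \<tau>(1) refl])
    also have "\<dots> \<le> v x"
    proof (rule mono)
      show "ennreal (\<delta> powr q) \<le> v y epowr q" if "y \<in> S" for y
        using epowr_mono[OF _ v\<delta>[OF that], of q] q \<delta>(1) by (simp add: epowr_ennreal)
    qed simp
    also have "\<dots> \<le> ennreal B" by (rule vB[OF that])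
    finally have "ennreal (1 / \<delta> powr q) * (ennreal (\<delta> powr q) * G \<tau> x) \<le> ennreal (1 / \<delta> powr q) * ennreal B"
      by (rule mult_left_mono) auto
    also have "ennreal (1 / \<delta> powr q) * ennreal B \<le> ennreal E"
      by (auto simp: E_def ennreal_mult'[symmetric] intro!: ennreal_leI)
    finally show ?thesis
      using \<delta> by (simp add: mult.assoc[symmetric] ennreal_mult[symmetric])
  qed
  define \<phi> where "\<phi> y = G \<tau> y epowr (1 / (1 - q))" for y
  have [measurable]: "\<phi> \<in> borel_measurable borel" unfolding \<phi>_def by measurable
  \<comment> \<open>Chosen such that \<open>t 0 * E powr (1 / (1 - q)) = \<delta>\<close>. In the
    closed form of \<open>t j\<close> the deviation from the fixed point is the factor
    \<open>r powr (q ^ j)\<close>, which tends to \<open>1\<close>.\<close>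
  define r where "r = \<delta> / E powr (1 / (1 - q)) / lower_const q"
  have r: "0 < r" using \<delta> E lower_const_pos by (simp add: r_def)
  define t where "t j = lower_const q * r powr (q ^ j)" for j :: nat
  have t: "0 < t j" for j using r lower_const_pos by (simp add: t_def)
  \<comment> \<open>The measure \<open>\<tau>\<close> lives on \<open>S\<close>, so a bound on
    \<open>S\<close> gives a bound at every point. This is how the final estimate reaches points
    outside \<open>S\<close>.\<close>
  have step: "ennreal (t (Suc j)) * \<phi> x \<le> v x" if "\<And>y. y \<in> S \<Longrightarrow> ennreal (t j) * \<phi> y \<le> v y" for j x
  proof -
    have "t (Suc j) = t j powr q / iter_const (q / (1 - q))"
    proof -
      have "t j powr q / iter_const (q / (1 - q)) = lower_const q powr q / iter_const (q / (1 - q)) * r powr (q ^ Suc j)"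
        using lower_const_pos[of q] r by (simp add: t_def powr_mult powr_powr mult.commute)
      then show ?thesis
        unfolding lower_const_fixed[OF q] by (simp add: t_def)
    qed
    then have "ennreal (t (Suc j)) * \<phi> x
        \<le> G (density \<tau> (\<lambda>y. (ennreal (t j) * \<phi> y) epowr q)) x"
      using subsolution_step[OF \<tau> q t] by (simp add: \<phi>_def)
    also have "\<dots> \<le> v x"
      using that q by (intro mono epowr_mono) auto
    finally show ?thesis .
  qed
  have base: "ennreal (t 0) * \<phi> y \<le> v y" if "y \<in> S" for y
  proof -
    have "ennreal (t 0) * \<phi> y \<le> ennreal (t 0) * ennreal E epowr (1 / (1 - q))"
      unfolding \<phi>_def using q by (intro mult_left_mono epowr_mono GB that) auto
    also have "\<dots> = ennreal \<delta>"
      using E t[of 0] lower_const_pos[of q] r \<delta>(1)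
      by (simp add: epowr_ennreal ennreal_mult[symmetric] t_def r_def)
    finally show ?thesis using v\<delta>[OF that] by (rule order_trans)
  qed
  have all: "\<forall>y\<in>S. ennreal (t j) * \<phi> y \<le> v y" for j
    by (induction j) (use base step in auto)
  have "(\<lambda>j. t (Suc j)) \<longlonglongrightarrow> lower_const q * r powr 0"
    unfolding t_def using q r by (intro tendsto_intros LIMSEQ_Suc[OF LIMSEQ_power_zero]) auto
  then have "(\<lambda>j. ennreal (t (Suc j)) * \<phi> x) \<longlonglongrightarrow> ennreal (lower_const q) * \<phi> x"
    using r lower_const_pos[of q] by (intro tendsto_mult_ennreal tendsto_const) (auto dest: tendsto_ennrealI)
  then have "ennreal (lower_const q) * \<phi> x \<le> v x"
    by (rule LIMSEQ_le_const2) (use step all in blast)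
  then show ?thesis
    by (simp add: \<phi>_def \<tau>_def)
qed

text \<open>Exhaustion by the bounded sets on which \<open>v\<close> is at most \<open>m\<close>;
  they fill \<open>\<sigma>\<close> because \<open>v\<close> is finite almost everywhere.\<close>

lemma supersolution_lower_bound:
  assumes \<sigma>: "locally_finite_borel \<sigma>" and q: "0 < q" "q < 1"
    and v [measurable]: "v \<in> borel_measurable borel" and pos: "\<And>x. 0 < v x"
    and super: "\<And>x. G (density \<sigma> (\<lambda>y. v y epowr q)) x \<le> v x"
    and fin: "AE y in \<sigma>. v y < \<infinity>"
  shows "ennreal (lower_const q) * G \<sigma> x epowr (1 / (1 - q)) \<le> v x"
proof -
  have sf: "sigma_finite_borel \<sigma>" by (rule locally_finite_borel_sigma_finite[OF \<sigma>])
  define S where "S m = {y. v y \<le> ennreal (real m)} \<inter> cball 0 (real m)" for m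
  have [measurable]: "S m \<in> sets borel" for m unfolding S_def by measurable
  have "G \<sigma> x = G (density \<sigma> (\<lambda>_. 1)) x" by (simp add: density_1)
  also have "\<dots> = (SUP m. G (density \<sigma> (indicator (S m))) x)"
  proof (rule potential_SUP[OF sf])
    show "AE y in \<sigma>. (SUP m. indicator (S m) y) = (1::ennreal)"
      using fin
    proof eventually_elim
      case (elim y)
      obtain b where b: "v y = ennreal b" "0 \<le> b" using elim by (cases "v y") auto
      obtain m where m: "max b (norm y) \<le> real m" using real_arch_simple by blast
      have "indicator (S m) y = (1::ennreal)"
        using m b by (auto simp: S_def intro!: ennreal_leI split: split_indicator)
      then show ?case
        by (intro antisym SUP_least) (auto intro!: SUP_upper2[of m] simp: indicator_le_1 split: split_indicator)
    qed
    show "indicator (S m) y \<le> (indicator (S (Suc m)) y :: ennreal)" for m y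
      by (auto simp: S_def split: split_indicator elim!: order_trans)
  qed auto
  finally have "ennreal (lower_const q) * G \<sigma> x epowr (1 / (1 - q))
      = (SUP m. ennreal (lower_const q) * G (density \<sigma> (indicator (S m))) x epowr (1 / (1 - q)))"
    using q by (simp add: epowr_SUP SUP_mult_left_ennreal)
  also have "\<dots> \<le> v x"
  proof (rule SUP_least)
    fix m
    show "ennreal (lower_const q) * G (density \<sigma> (indicator (S m))) x epowr (1 / (1 - q)) \<le> v x"
    proof (rule supersolution_lower_bound_restricted[OF sf q v pos super, of _ "real m + 1" "real m"])
      have "emeasure \<sigma> (S m) \<le> emeasure \<sigma> (cball 0 (real m))"
        using sf by (intro emeasure_mono) (auto simp: S_def sigma_finite_borelD)
      then show "emeasure \<sigma> (S m) < \<infinity>"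
        using locally_finite_borel_compact[OF \<sigma>, of "cball 0 (real m)"] by (auto intro: le_less_trans)
    qed (auto simp: S_def)
  qed
  finally show ?thesis .
qed

end

section \<open>Lorentz space estimate\<close>

context riesz
begin

definition lebesgue_const :: real where
  "lebesgue_const = (N - \<alpha>) * c * (unit_ball_vol N / \<alpha> + 1 / (N - \<alpha>))"

lemma lebesgue_const_pos: "0 < lebesgue_const"
  using \<alpha>_pos \<alpha>_less c_pos by (simp add: lebesgue_const_def unit_ball_vol_nonneg add_nonneg_pos)

text \<open>In the radial form of the potential the mass of a ball is bounded by its volume up to
  the radius \<open>V powr (1 / N)\<close> and by \<open>V\<close> beyond it. The two summands of
  \<open>lebesgue_const\<close> are the two resulting integrals.\<close>

lemma potential_lebesgue_le:
  fixes L :: "'a set"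
  assumes L [measurable]: "L \<in> sets borel" and V: "emeasure lborel L = ennreal V" "0 \<le> V"
  shows "G (density lborel (indicator L)) x \<le> ennreal (lebesgue_const * V powr (\<alpha> / N))"
proof (cases "V = 0")
  case True
  then have "AE y in lborel. y \<notin> L"
    using V by (intro AE_I[of _ _ L]) auto
  then have "AE y in lborel. indicator L y * k x y = 0"
    by eventually_elim auto
  then have "G (density lborel (indicator L)) x = 0"
    by (subst potential_density) (auto simp: nn_integral_0_iff_AE)
  then show ?thesis by simp
next
  case False
  have N_pos: "0 < N" using \<alpha>_pos \<alpha>_less by linarith
  define R where "R = V powr (1 / N)"
  have R: "0 < R" using False V by (simp add: R_def)
  have bnd: "emeasure (density lborel (indicator L)) (ball x r) * ennreal (1 / r powr (N - \<alpha>) / r) * indicator {0<..} r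
      \<le> ennreal (unit_ball_vol N) * (ennreal (r powr (\<alpha> - 1)) * indicator {0..R} r)
        + ennreal V * (ennreal (r powr (\<alpha> - N - 1)) * indicator {R..} r)" for r :: real
  proof (cases "0 < r")
    case True
    have e: "emeasure (density lborel (indicator L)) (ball x r) = emeasure lborel (L \<inter> ball x r)"
      by (rule emeasure_restricted) auto
    have p1: "1 / r powr (N - \<alpha>) / r = r powr (\<alpha> - N - 1)"
      using True by (simp add: powr_diff)
    show ?thesis
    proof (cases "r \<le> R")
      case le: True
      have "emeasure lborel (L \<inter> ball x r) \<le> emeasure lborel (ball x r)"
        by (intro emeasure_mono) auto
      also have "\<dots> = ennreal (unit_ball_vol N * r powr N)"
        using True by (simp add: emeasure_ball N_def powr_realpow)
      finally have "emeasure lborel (L \<inter> ball x r) * ennreal (r powr (\<alpha> - N - 1))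
          \<le> ennreal (unit_ball_vol N * r powr N) * ennreal (r powr (\<alpha> - N - 1))"
        by (rule mult_right_mono) auto
      also have "\<dots> = ennreal (unit_ball_vol N) * ennreal (r powr (\<alpha> - 1))"
        using N_pos by (simp add: ennreal_mult[symmetric] unit_ball_vol_nonneg mult.assoc powr_add[symmetric])
      finally show ?thesis
        using True le unfolding e p1 by (simp add: add_increasing2)
    next
      case False
      have "emeasure lborel (L \<inter> ball x r) \<le> ennreal V"
        unfolding V(1)[symmetric] by (intro emeasure_mono) auto
      then have "emeasure lborel (L \<inter> ball x r) * ennreal (r powr (\<alpha> - N - 1)) \<le> ennreal V * ennreal (r powr (\<alpha> - N - 1))"
        by (rule mult_right_mono) auto
      then show ?thesis
        using True False unfolding e p1 by auto
    qed
  qed auto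
  have "G (density lborel (indicator L)) x = riesz_potential \<alpha> (density lborel (indicator L)) x"
    by (rule riesz_potential_density[symmetric]) auto
  also have "\<dots> = ennreal ((N - \<alpha>) * c) *
      (\<integral>\<^sup>+r. emeasure (density lborel (indicator L)) (ball x r) * ennreal (1 / r powr (N - \<alpha>) / r) * indicator {0<..} r \<partial>lborel)"
    by (simp add: riesz_potential_def N_def c_def)
  also have "\<dots> \<le> ennreal ((N - \<alpha>) * c) * (\<integral>\<^sup>+r. ennreal (unit_ball_vol N) * (ennreal (r powr (\<alpha> - 1)) * indicator {0..R} r)
        + ennreal V * (ennreal (r powr (\<alpha> - N - 1)) * indicator {R..} r) \<partial>lborel)"
    by (intro mult_left_mono nn_integral_mono bnd) auto
  also have "(\<integral>\<^sup>+r. ennreal (unit_ball_vol N) * (ennreal (r powr (\<alpha> - 1)) * indicator {0..R} r)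
        + ennreal V * (ennreal (r powr (\<alpha> - N - 1)) * indicator {R..} r) \<partial>lborel)
      = ennreal (unit_ball_vol N) * ennreal (R powr \<alpha> / \<alpha>) + ennreal V * ennreal (R powr (\<alpha> - N) / (N - \<alpha>))"
    using R \<alpha>_pos \<alpha>_less
    by (simp add: nn_integral_add nn_integral_cmult nn_integral_powr_from_0 nn_integral_powr_to_inf)
  also have "\<dots> = ennreal (unit_ball_vol N * (R powr \<alpha> / \<alpha>) + V * (R powr (\<alpha> - N) / (N - \<alpha>)))"
    using V \<alpha>_pos \<alpha>_less N_pos
    by (simp add: ennreal_mult[symmetric] ennreal_plus[symmetric] unit_ball_vol_nonneg del: ennreal_plus)
  also have "unit_ball_vol N * (R powr \<alpha> / \<alpha>) + V * (R powr (\<alpha> - N) / (N - \<alpha>))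
      = (unit_ball_vol N / \<alpha> + 1 / (N - \<alpha>)) * V powr (\<alpha> / N)"
  proof -
    have "V * R powr (\<alpha> - N) = V powr (1 + (\<alpha> - N) / N)"
      using False V by (simp add: R_def powr_powr powr_add)
    also have "1 + (\<alpha> - N) / N = \<alpha> / N" using N_pos by (simp add: field_simps)
    finally have "V * R powr (\<alpha> - N) = V powr (\<alpha> / N)" .
    then show ?thesis
      by (simp add: R_def powr_powr algebra_simps)
  qed
  also have "ennreal ((N - \<alpha>) * c) * ennreal ((unit_ball_vol N / \<alpha> + 1 / (N - \<alpha>)) * V powr (\<alpha> / N))
      = ennreal (lebesgue_const * V powr (\<alpha> / N))"
    using \<alpha>_less c_pos \<alpha>_pos N_pos
    by (subst ennreal_mult[symmetric]) (auto simp: lebesgue_const_def unit_ball_vol_nonneg mult.assoc)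
  finally show ?thesis .
qed

text \<open>The transfer lemma with Lebesgue measure as \<open>\<nu>\<close>. Dividing the volume
  \<open>V\<close> by the factor \<open>V powr (\<alpha> / N)\<close> from
  \<open>potential_lebesgue_le\<close> leaves the exponent \<open>(N - \<alpha>) / N\<close>;
  cutting with balls makes \<open>V\<close> finite so that the division is possible.\<close>

lemma lebesgue_level_set_le:
  assumes \<mu>: "sigma_finite_borel \<mu>" and s: "0 < s"
  shows "emeasure lborel {x. ennreal s < G \<mu> x} epowr ((N - \<alpha>) / N)
    \<le> ennreal (2 * lebesgue_const / s) * emeasure \<mu> {y. ennreal (s / (2 * 2 powr (N - \<alpha>))) < G \<mu> y}"
    (is "?lhs epowr ?a \<le> ?rhs")
proof -
  note [measurable_cong] = sigma_finite_borelD(1)[OF \<mu>]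
  note [measurable] = measurable_potential[OF \<mu>]
  have N_pos: "0 < N" using \<alpha>_pos \<alpha>_less by linarith
  define L where "L j = {x. ennreal s < G \<mu> x} \<inter> cball 0 (real j)" for j
  have [measurable]: "L j \<in> sets borel" for j unfolding L_def by measurable
  have le: "emeasure lborel (L j) epowr ?a \<le> ?rhs" for j
  proof -
    have "emeasure lborel (L j) \<le> emeasure lborel (cball (0::'a) (real j))"
      by (intro emeasure_mono) (auto simp: L_def)
    also have "\<dots> < \<infinity>" by (rule emeasure_lborel_cball_finite)
    finally obtain V where V: "emeasure lborel (L j) = ennreal V" "0 \<le> V"
      by (cases "emeasure lborel (L j)") auto
    show ?thesis
    proof (cases "V = 0")
      case True
      then show ?thesis using V by simp
    next
      case False
      have "ennreal (s / 2) * emeasure lborel (L j) \<le> ennreal (lebesgue_const * V powr (\<alpha> / N))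
          * emeasure \<mu> {y. ennreal (s / (2 * 2 powr (N - \<alpha>))) < G \<mu> y}"
      proof (rule level_set_transfer[OF \<mu>])
        show "G (density \<mu> (indicator {y. G \<mu> y \<le> ennreal (s / (2 * 2 powr (N - \<alpha>)))})) x
            \<le> ennreal (2 powr (N - \<alpha>) * (s / (2 * 2 powr (N - \<alpha>))))" for x
          using weak_maximum_principle_level[OF \<mu>, of "ennreal (s / (2 * 2 powr (N - \<alpha>)))" x] s
          by (subst ennreal_mult) auto
        show "G (density lborel (indicator (L j))) x \<le> ennreal (lebesgue_const * V powr (\<alpha> / N))" for x
          using V by (intro potential_lebesgue_le) auto
      qed (use s in \<open>auto simp: L_def\<close>)
      then have "ennreal (2 / s * V powr (- (\<alpha> / N))) * (ennreal (s / 2) * ennreal V)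
        \<le> ennreal (2 / s * V powr (- (\<alpha> / N))) * (ennreal (lebesgue_const * V powr (\<alpha> / N))
          * emeasure \<mu> {y. ennreal (s / (2 * 2 powr (N - \<alpha>))) < G \<mu> y})"
        unfolding V by (rule mult_left_mono) auto
      moreover have "ennreal (2 / s * V powr (- (\<alpha> / N))) * (ennreal (s / 2) * ennreal V) = ennreal (V powr ?a)"
      proof -
        have "V powr ?a = V powr (- (\<alpha> / N) + 1)"
          using N_pos by (simp add: field_simps)
        also have "\<dots> = V powr (- (\<alpha> / N)) * V"
          using False V by (simp only: powr_add) simp
        finally show ?thesis
          using s V by (simp add: ennreal_mult[symmetric])
      qed
      moreover have "ennreal (2 / s * V powr (- (\<alpha> / N))) * (ennreal (lebesgue_const * V powr (\<alpha> / N)) * Z)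
          = ennreal (2 * lebesgue_const / s) * Z" for Z
      proof -
        have "V powr (- (\<alpha> / N)) * V powr (\<alpha> / N) = 1"
          using False by (simp add: powr_add[symmetric])
        then have "2 / s * V powr (- (\<alpha> / N)) * (lebesgue_const * V powr (\<alpha> / N)) = 2 * lebesgue_const / s"
          by (simp add: field_simps)
        then show ?thesis
          using s lebesgue_const_pos by (simp add: mult.assoc[symmetric] ennreal_mult[symmetric] del: times_divide_eq_left times_divide_eq_right)
      qed
      ultimately show ?thesis
        using V by (simp add: epowr_ennreal)
    qed
  qed
  have "?lhs = emeasure lborel (\<Union>j. L j)"
    by (intro arg_cong[where f = "emeasure lborel"]) (auto simp: L_def real_arch_simple)
  also have "\<dots> = (SUP j. emeasure lborel (L j))"
    by (rule SUP_emeasure_incseq[symmetric]) (auto simp: incseq_def L_def)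
  finally have "?lhs epowr ?a = (SUP j. emeasure lborel (L j) epowr ?a)"
    using \<alpha>_less N_pos by (simp add: epowr_SUP)
  also have "\<dots> \<le> ?rhs"
    using le by (rule SUP_least)
  finally show ?thesis .
qed

text \<open>Interchanging integrals bounds the Lorentz norm by the integral of
  \<open>s powr \<gamma> * d s epowr a\<close>, where \<open>d\<close> is the distribution function.
  The weak type bound \<open>lebesgue_level_set_le\<close> gains a factor \<open>1 / s\<close> and
  turns this into the layer cake formula for \<open>G \<mu> epowr \<gamma>\<close> with respect to
  \<open>\<mu>\<close>.\<close>

lemma potential_in_lorentz_space:
  assumes \<mu>: "sigma_finite_borel \<mu>" and \<gamma>: "0 < \<gamma>" and fin: "(\<integral>\<^sup>+x. G \<mu> x epowr \<gamma> \<partial>\<mu>) < \<infinity>"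
  shows "G \<mu> \<in> lorentz_space (N * (\<gamma> + 1) / (N - \<alpha>)) (\<gamma> + 1)"
proof -
  note [measurable_cong] = sigma_finite_borelD(1)[OF \<mu>]
  note [measurable] = measurable_potential[OF \<mu>]
  interpret M: sigma_finite_measure \<mu> using \<mu> by (rule sigma_finite_borelD)
  have N_pos: "0 < N" using \<alpha>_pos \<alpha>_less by linarith
  define a where "a = (N - \<alpha>) / N"
  have a: "0 < a" using N_pos \<alpha>_less by (simp add: a_def)
  define d where "d s = emeasure lborel {x. ennreal s < G \<mu> x}" for s :: real
  have d_meas [measurable]: "d \<in> borel_measurable borel"
    using lborel.measurable_emeasure_level[of "G \<mu>"] unfolding d_def by simp
  define D :: real where "D = 2 * 2 powr (N - \<alpha>)"
  have D: "0 < D" by (simp add: D_def)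
  define u where "u = decreasing_rearrangement (G \<mu>)"
  \<comment> \<open>One half of the inverse relation between the decreasing rearrangement and the
    distribution function.\<close>
  have u_le: "ennreal t < d s" if "ennreal s < u t" for s t
  proof (rule ccontr)
    assume "\<not> ?thesis"
    then have "u t \<le> ennreal s"
      unfolding u_def decreasing_rearrangement_def d_def by (intro Inf_lower) auto
    then show False using that by simp
  qed
  have "(\<integral>\<^sup>+t\<in>{0<..}. (ennreal (t powr (1 / (N * (\<gamma> + 1) / (N - \<alpha>)))) * u t) epowr (\<gamma> + 1) * ennreal (1 / t) \<partial>lborel)
    \<le> (\<integral>\<^sup>+t. (\<integral>\<^sup>+s. (ennreal ((\<gamma> + 1) * s powr \<gamma>) * indicator {0<..} s)
        * (ennreal (t powr (a - 1)) * (if ennreal t < d s then 1 else 0) * indicator {0<..} t) \<partial>lborel) \<partial>lborel)"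
  proof (intro nn_integral_mono)
    fix t :: real
    show "(ennreal (t powr (1 / (N * (\<gamma> + 1) / (N - \<alpha>)))) * u t) epowr (\<gamma> + 1) * ennreal (1 / t) * indicator {0<..} t
      \<le> (\<integral>\<^sup>+s. (ennreal ((\<gamma> + 1) * s powr \<gamma>) * indicator {0<..} s)
        * (ennreal (t powr (a - 1)) * (if ennreal t < d s then 1 else 0) * indicator {0<..} t) \<partial>lborel)"
    proof (cases "0 < t")
      case True
      \<comment> \<open>This is \<open>\<rho> / r\<close> for the two Lorentz exponents; it matches
        the exponent in \<open>lebesgue_level_set_le\<close>, independently of
        \<open>\<gamma>\<close>.\<close>
      have e: "1 / (N * (\<gamma> + 1) / (N - \<alpha>)) * (\<gamma> + 1) = a"
      proof -
        define g where "g = \<gamma> + 1"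
        have "0 < g" using \<gamma> by (simp add: g_def)
        then show ?thesis
          unfolding g_def[symmetric] using N_pos \<alpha>_less by (simp add: a_def field_simps)
      qed
      have "(ennreal (t powr (1 / (N * (\<gamma> + 1) / (N - \<alpha>)))) * u t) epowr (\<gamma> + 1) * ennreal (1 / t)
          = ennreal (t powr a) * u t epowr (\<gamma> + 1) * ennreal (1 / t)"
        using \<gamma> by (simp only: epowr_mult[of "\<gamma> + 1"] epowr_ennreal powr_ge_zero powr_powr e add_pos_pos zero_less_one)
      also have "\<dots> = ennreal (t powr (a - 1)) * u t epowr (\<gamma> + 1)"
      proof -
        have "t powr a * (1 / t) = t powr (a - 1)" using True by (simp add: powr_diff)
        then have "ennreal (t powr a) * ennreal (1 / t) = ennreal (t powr (a - 1))"
          using True by (simp add: ennreal_mult[symmetric])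
        then show ?thesis by (metis mult.assoc mult.commute)
      qed
      also have "u t epowr (\<gamma> + 1) = (\<integral>\<^sup>+s\<in>{0<..}. ennreal ((\<gamma> + 1) * s powr \<gamma>) * indicator {s. ennreal s < u t} s \<partial>lborel)"
        using \<gamma> by (subst epowr_eq_nn_integral) auto
      also have "ennreal (t powr (a - 1)) * \<dots> = (\<integral>\<^sup>+s. ennreal (t powr (a - 1)) *
          (ennreal ((\<gamma> + 1) * s powr \<gamma>) * indicator {s. ennreal s < u t} s * indicator {0<..} s) \<partial>lborel)"
        by (rule nn_integral_cmult[symmetric]) measurable
      also have "\<dots> \<le> (\<integral>\<^sup>+s. (ennreal ((\<gamma> + 1) * s powr \<gamma>) * indicator {0<..} s)
        * (ennreal (t powr (a - 1)) * (if ennreal t < d s then 1 else 0) * indicator {0<..} t) \<partial>lborel)"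
        using True u_le by (intro nn_integral_mono) (auto split: split_indicator simp: mult.commute)
      finally show ?thesis using True by simp
    qed auto
  qed
  also have "\<dots> = (\<integral>\<^sup>+s. (\<integral>\<^sup>+t. (ennreal ((\<gamma> + 1) * s powr \<gamma>) * indicator {0<..} s)
        * (ennreal (t powr (a - 1)) * (if ennreal t < d s then 1 else 0) * indicator {0<..} t) \<partial>lborel) \<partial>lborel)"
    by (rule Tonelli_borel) (simp, simp, measurable)
  also have "\<dots> = (\<integral>\<^sup>+s. (ennreal ((\<gamma> + 1) * s powr \<gamma>) * indicator {0<..} s) * (ennreal (1 / a) * d s epowr a) \<partial>lborel)"
  proof (intro nn_integral_cong)
    fix s :: real
    have "ennreal (1 / a) * d s epowr a = ennreal (1 / a) *
        (\<integral>\<^sup>+t\<in>{0<..}. ennreal (a * t powr (a - 1)) * indicator {t. ennreal t < d s} t \<partial>lborel)"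
      using a by (subst epowr_eq_nn_integral) auto
    also have "\<dots> = (\<integral>\<^sup>+t. ennreal (1 / a) * (ennreal (a * t powr (a - 1)) * indicator {t. ennreal t < d s} t * indicator {0<..} t) \<partial>lborel)"
      by (rule nn_integral_cmult[symmetric]) measurable
    also have "\<dots> = (\<integral>\<^sup>+t. ennreal (t powr (a - 1)) * (if ennreal t < d s then 1 else 0) * indicator {0<..} t \<partial>lborel)"
      using a by (intro nn_integral_cong)
        (auto split: split_indicator simp: ennreal_mult[symmetric] mult.assoc[symmetric])
    finally show "(\<integral>\<^sup>+t. (ennreal ((\<gamma> + 1) * s powr \<gamma>) * indicator {0<..} s)
        * (ennreal (t powr (a - 1)) * (if ennreal t < d s then 1 else 0) * indicator {0<..} t) \<partial>lborel)
      = (ennreal ((\<gamma> + 1) * s powr \<gamma>) * indicator {0<..} s) * (ennreal (1 / a) * d s epowr a)"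
      by (subst nn_integral_cmult) auto
  qed
  also have "\<dots> \<le> (\<integral>\<^sup>+s. ennreal ((\<gamma> + 1) / a * 2 * lebesgue_const / \<gamma>) *
      (ennreal (\<gamma> * s powr (\<gamma> - 1)) * emeasure \<mu> {y\<in>space \<mu>. ennreal s < ennreal D * G \<mu> y} * indicator {0<..} s) \<partial>lborel)"
  proof (intro nn_integral_mono)
    fix s :: real
    show "(ennreal ((\<gamma> + 1) * s powr \<gamma>) * indicator {0<..} s) * (ennreal (1 / a) * d s epowr a)
      \<le> ennreal ((\<gamma> + 1) / a * 2 * lebesgue_const / \<gamma>) *
      (ennreal (\<gamma> * s powr (\<gamma> - 1)) * emeasure \<mu> {y\<in>space \<mu>. ennreal s < ennreal D * G \<mu> y} * indicator {0<..} s)"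
    proof (cases "0 < s")
      case True
      have sets_eq: "{y. ennreal (s / D) < G \<mu> y} = {y\<in>space \<mu>. ennreal s < ennreal D * G \<mu> y}"
      proof -
        have "ennreal (s / D) < G \<mu> y \<longleftrightarrow> ennreal s < ennreal D * G \<mu> y" for y
          using True D by (cases "G \<mu> y")
            (auto simp: ennreal_mult[symmetric] ennreal_less_iff field_simps ennreal_mult_top simp del: ennreal_mult'')
        then show ?thesis by (simp add: sigma_finite_borelD[OF \<mu>])
      qed
      have "ennreal ((\<gamma> + 1) * s powr \<gamma>) * (ennreal (1 / a) * d s epowr a)
        \<le> ennreal ((\<gamma> + 1) * s powr \<gamma>) * (ennreal (1 / a) * (ennreal (2 * lebesgue_const / s) * emeasure \<mu> {y. ennreal (s / D) < G \<mu> y}))"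
        using lebesgue_level_set_le[OF \<mu> True]
        by (intro mult_left_mono) (auto simp: d_def a_def D_def)
      also have "\<dots> = ennreal ((\<gamma> + 1) * s powr \<gamma> * (1 / a) * (2 * lebesgue_const / s)) * emeasure \<mu> {y. ennreal (s / D) < G \<mu> y}"
        using True a \<gamma> lebesgue_const_pos by (simp add: ennreal_mult[symmetric] mult.assoc[symmetric])
      also have "(\<gamma> + 1) * s powr \<gamma> * (1 / a) * (2 * lebesgue_const / s) = (\<gamma> + 1) / a * 2 * lebesgue_const / \<gamma> * (\<gamma> * s powr (\<gamma> - 1))"
        using True a \<gamma> by (simp add: powr_diff field_simps)
      finally show ?thesis
        using True a \<gamma> lebesgue_const_pos unfolding sets_eq by (simp add: ennreal_mult[symmetric] mult.assoc[symmetric])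
    qed auto
  qed
  also have "\<dots> = ennreal ((\<gamma> + 1) / a * 2 * lebesgue_const / \<gamma>) * (\<integral>\<^sup>+y. (ennreal D * G \<mu> y) epowr \<gamma> \<partial>\<mu>)"
  proof -
    have [measurable]: "(\<lambda>s. emeasure \<mu> {y\<in>space \<mu>. ennreal s < ennreal D * G \<mu> y}) \<in> borel_measurable borel"
      by (auto intro!: M.measurable_emeasure_level)
    show ?thesis
      using \<gamma> by (simp add: M.nn_integral_epowr_layer_cake nn_integral_cmult)
  qed
  also have "\<dots> < \<infinity>"
  proof -
    have "(\<integral>\<^sup>+y. (ennreal D * G \<mu> y) epowr \<gamma> \<partial>\<mu>) = ennreal (D powr \<gamma>) * (\<integral>\<^sup>+y. G \<mu> y epowr \<gamma> \<partial>\<mu>)"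
      using D \<gamma> by (subst nn_integral_cmult[symmetric], measurable) (simp add: epowr_mult epowr_ennreal)
    then show ?thesis
      using fin by (simp add: ennreal_mult_less_top)
  qed
  finally show ?thesis
    unfolding lorentz_space_def lorentz_norm_def u_def by (auto intro!: epowr_lt_top[simplified])
qed

end

section \<open>Composition of Riesz potentials\<close>

lemma nn_integral_lborel_translate:
  fixes f :: "'a::euclidean_space \<Rightarrow> ennreal"
  assumes [measurable]: "f \<in> borel_measurable borel"
  shows "(\<integral>\<^sup>+z. f (y + z) \<partial>lborel) = (\<integral>\<^sup>+z. f z \<partial>lborel)"
proof -
  have "(\<integral>\<^sup>+z. f z \<partial>lborel) = (\<integral>\<^sup>+z. f z \<partial>(density (distr lborel borel (\<lambda>x. y + 1 *\<^sub>R x)) (\<lambda>_. 1)))"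
    using lborel_affine[of 1 y] by simp
  also have "\<dots> = (\<integral>\<^sup>+z. f (y + z) \<partial>lborel)"
    by (simp add: density_1 nn_integral_distr)
  finally show ?thesis ..
qed

lemma nn_integral_lborel_scale:
  fixes f :: "'a::euclidean_space \<Rightarrow> ennreal"
  assumes [measurable]: "f \<in> borel_measurable borel" and t: "0 < t"
  shows "(\<integral>\<^sup>+z. f z \<partial>lborel) = ennreal (t ^ DIM('a)) * (\<integral>\<^sup>+z. f (t *\<^sub>R z) \<partial>lborel)"
proof -
  have "(\<integral>\<^sup>+z. f z \<partial>lborel)
      = (\<integral>\<^sup>+z. f z \<partial>(density (distr lborel borel (\<lambda>x. 0 + t *\<^sub>R x)) (\<lambda>_. \<bar>t\<bar> ^ DIM('a))))"
    using lborel_affine[of t "0::'a"] t by simp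
  also have "\<dots> = ennreal (t ^ DIM('a)) * (\<integral>\<^sup>+z. f (t *\<^sub>R z) \<partial>lborel)"
    using t by (simp add: nn_integral_density nn_integral_distr nn_integral_cmult)
  finally show ?thesis .
qed

text \<open>The Gamma integral after the substitution \<open>a * t\<close>. With \<open>a\<close> a
  squared norm it writes a negative power of the norm as a superposition of Gaussians.\<close>

lemma nn_integral_powr_exp:
  assumes p: "0 < p" and a: "0 < a"
  shows "(\<integral>\<^sup>+t\<in>{0<..}. ennreal (t powr (p - 1) * exp (- (t * a))) \<partial>lborel) = ennreal (Gamma p * a powr (- p))"
proof -
  have "ennreal (Gamma p) = (\<integral>\<^sup>+t. ennreal (indicator {0..} t * t powr (p - 1) / exp t) \<partial>lborel)"
    using p by (rule Gamma_conv_nn_integral_real)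
  also have "\<dots> = (\<integral>\<^sup>+t. ennreal (t powr (p - 1) * exp (- t)) * indicator {0<..} t \<partial>lborel)"
    by (intro nn_integral_AE_singleton[of 0]) (auto split: split_indicator simp: exp_minus field_simps)
  also have "\<dots> = ennreal a * (\<integral>\<^sup>+t. ennreal ((a * t) powr (p - 1) * exp (- (a * t))) * indicator {0<..} (a * t) \<partial>lborel)"
    using nn_integral_lborel_scale[of "\<lambda>t::real. ennreal (t powr (p - 1) * exp (- t)) * indicator {0<..} t" a] a
    by simp
  also have "\<dots> = ennreal a * (\<integral>\<^sup>+t. ennreal (a powr (p - 1)) * (ennreal (t powr (p - 1) * exp (- (t * a))) * indicator {0<..} t) \<partial>lborel)"
  proof -
    have "ennreal ((a * t) powr (p - 1) * exp (- (a * t))) * indicator {0<..} (a * t)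
      = ennreal (a powr (p - 1)) * (ennreal (t powr (p - 1) * exp (- (t * a))) * indicator {0<..} t)" for t
      using a by (cases "0 < t")
        (simp_all add: powr_mult ennreal_mult[symmetric] mult_ac zero_less_mult_iff)
    then show ?thesis by simp
  qed
  also have "\<dots> = ennreal a * (ennreal (a powr (p - 1)) * (\<integral>\<^sup>+t\<in>{0<..}. ennreal (t powr (p - 1) * exp (- (t * a))) \<partial>lborel))"
    by (subst nn_integral_cmult) auto
  also have "\<dots> = ennreal (a powr p) * (\<integral>\<^sup>+t\<in>{0<..}. ennreal (t powr (p - 1) * exp (- (t * a))) \<partial>lborel)"
    using a by (simp add: mult.assoc[symmetric] ennreal_mult[symmetric] powr_diff)
  finally have "ennreal (a powr (- p)) * ennreal (Gamma p) =
      ennreal (a powr (- p)) * (ennreal (a powr p) * (\<integral>\<^sup>+t\<in>{0<..}. ennreal (t powr (p - 1) * exp (- (t * a))) \<partial>lborel))"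
    by simp
  then show ?thesis
    using a p by (simp add: mult.assoc[symmetric] ennreal_mult[symmetric] powr_add[symmetric] Gamma_real_pos less_imp_le mult.commute)
qed

text \<open>Convolution of a power of the norm with itself. The value \<open>0\<close> that
  \<open>powr\<close> gives at \<open>z = x\<close> and \<open>z = y\<close> affects only a null
  set.\<close>

definition norm_conv :: "real \<Rightarrow> 'a::euclidean_space \<Rightarrow> 'a \<Rightarrow> ennreal" where
  "norm_conv b x y = (\<integral>\<^sup>+z. ennreal (norm (x - z) powr (- b)) * ennreal (norm (z - y) powr (- b)) \<partial>lborel)"

lemma norm_conv_translate: "norm_conv b x y = norm_conv b (x - y) 0"
  unfolding norm_conv_def
  by (subst nn_integral_lborel_translate[of _ y, symmetric]) (auto simp: algebra_simps)

lemma norm_conv_scale: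
  fixes x :: "'a::euclidean_space"
  assumes t: "0 < t"
  shows "norm_conv b (t *\<^sub>R x) 0 = ennreal (t powr (real DIM('a) - 2 * b)) * norm_conv b x 0"
proof -
  have "norm_conv b (t *\<^sub>R x) 0 = ennreal (t ^ DIM('a)) *
      (\<integral>\<^sup>+z. ennreal (norm (t *\<^sub>R x - t *\<^sub>R z) powr (- b)) * ennreal (norm (t *\<^sub>R z - 0) powr (- b)) \<partial>lborel)"
    unfolding norm_conv_def using t by (subst nn_integral_lborel_scale[of _ t]) auto
  also have "\<dots> = ennreal (t ^ DIM('a)) * (\<integral>\<^sup>+z. ennreal (t powr (- 2 * b)) *
      (ennreal (norm (x - z) powr (- b)) * ennreal (norm (z - 0) powr (- b))) \<partial>lborel)"
  proof -
    have "ennreal (norm (t *\<^sub>R x - t *\<^sub>R z) powr (- b)) * ennreal (norm (t *\<^sub>R z - 0) powr (- b))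
      = ennreal (t powr (- 2 * b)) * (ennreal (norm (x - z) powr (- b)) * ennreal (norm (z - 0) powr (- b)))" for z
    proof -
      have "norm (t *\<^sub>R x - t *\<^sub>R z) = t * norm (x - z)"
        using t by (simp flip: scaleR_diff_right)
      moreover have "t powr (- b) * t powr (- b) = t powr (- 2 * b)"
        by (simp flip: powr_add)
      ultimately show ?thesis
        using t by (simp add: powr_mult ennreal_mult[symmetric] mult_ac)
    qed
    then show ?thesis by simp
  qed
  also have "\<dots> = ennreal (t ^ DIM('a)) * (ennreal (t powr (- 2 * b)) * norm_conv b x 0)"
    unfolding norm_conv_def by (subst nn_integral_cmult) auto
  also have "\<dots> = ennreal (t powr (real DIM('a) - 2 * b)) * norm_conv b x 0"
    using t by (simp add: mult.assoc[symmetric] ennreal_mult[symmetric] powr_realpow[symmetric] powr_add[symmetric])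
  finally show ?thesis .
qed

text \<open>Writing both powers as superpositions of Gaussians and completing the square, the inner
  integral over \<open>z\<close> depends on \<open>x\<close> only through a translation and through \<open>norm x\<close>.\<close>

lemma norm_conv_radial:
  fixes x y :: "'a::euclidean_space"
  assumes b: "0 < b" and xy: "norm x = norm y"
  shows "norm_conv b x 0 = norm_conv b y 0"
proof -
  define p where "p = b / 2"
  have p: "0 < p" using b by (simp add: p_def)
  define g where "g t a = ennreal (t powr (p - 1) * exp (- (t * a))) * indicator {0<..} t" for t a :: real
  have [measurable]: "(\<lambda>w. g (f w) (h w)) \<in> borel_measurable M"
    if [measurable]: "f \<in> borel_measurable M" "h \<in> borel_measurable M" for f h and M :: "'b measure"
    unfolding g_def by measurable
  \<comment> \<open>The Gaussian integral is never evaluated: it suffices that it depends on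
    \<open>t + s\<close> alone and not on \<open>x\<close>.\<close>
  define \<Phi> where "\<Phi> s = (\<integral>\<^sup>+z. ennreal (exp (- (s * (norm (z::'a))\<^sup>2))) \<partial>lborel)" for s
  define E where "E r t s = ennreal (t powr (p - 1)) * indicator {0<..} t * (ennreal (s powr (p - 1)) * indicator {0<..} s)
      * ennreal (exp (- (t * s / (t + s) * r\<^sup>2)))" for r t s :: real
  have g: "(\<integral>\<^sup>+t. g t ((norm w)\<^sup>2) \<partial>lborel) = ennreal (Gamma p) * ennreal (norm w powr (- b))" if "w \<noteq> 0" for w :: 'a
  proof -
    have "((norm w)\<^sup>2) powr (- p) = norm w powr (- b)"
      using that by (simp add: p_def powr_powr flip: powr_numeral)
    then show ?thesis
      unfolding g_def using that p
      by (subst nn_integral_powr_exp) (auto simp: ennreal_mult Gamma_real_pos less_imp_le)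
  qed
  have inner: "(\<integral>\<^sup>+z. g t ((norm (x - z))\<^sup>2) * g s ((norm z)\<^sup>2) \<partial>lborel) = E (norm x) t s * \<Phi> (t + s)"
    for x :: 'a and t s
  proof (cases "0 < t \<and> 0 < s")
    case True
    \<comment> \<open>The minimiser in \<open>z\<close> of the quadratic form
      \<open>t * (norm (x - z))\<^sup>2 + s * (norm z)\<^sup>2\<close>.\<close>
    define a where "a = (t / (t + s)) *\<^sub>R x"
    have sq: "t * (norm (x - z))\<^sup>2 + s * (norm z)\<^sup>2 = (t + s) * (norm (z - a))\<^sup>2 + t * s / (t + s) * (norm x)\<^sup>2" for z
    proof -
      have 1: "(norm (x - z))\<^sup>2 = (norm x)\<^sup>2 - 2 * (x \<bullet> z) + (norm z)\<^sup>2"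
        by (simp add: power2_norm_eq_inner inner_simps inner_commute)
      have 2: "(norm (z - a))\<^sup>2 = (norm z)\<^sup>2 - 2 * (t / (t + s)) * (x \<bullet> z) + (t / (t + s))\<^sup>2 * (norm x)\<^sup>2"
      proof -
        have "(norm (z - l *\<^sub>R x))\<^sup>2 = (norm z)\<^sup>2 - 2 * l * (x \<bullet> z) + l\<^sup>2 * (norm x)\<^sup>2" for l
          unfolding power2_norm_eq_inner by (simp add: inner_simps inner_commute power2_eq_square algebra_simps)
        then show ?thesis unfolding a_def .
      qed
      have ts: "t + s \<noteq> 0" using True by auto
      have "(t + s) * (norm (z - a))\<^sup>2 = (t + s) * (norm z)\<^sup>2 - 2 * t * (x \<bullet> z) + t\<^sup>2 / (t + s) * (norm x)\<^sup>2"
      proof -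
        define l where "l = t / (t + s)"
        have l: "(t + s) * l = t" "t * l = t\<^sup>2 / (t + s)"
          using ts by (simp_all add: l_def power2_eq_square)
        have "(t + s) * (norm (z - a))\<^sup>2
            = (t + s) * (norm z)\<^sup>2 - 2 * ((t + s) * l) * (x \<bullet> z) + (t + s) * l * l * (norm x)\<^sup>2"
          unfolding 2 l_def[symmetric] by (simp add: algebra_simps power2_eq_square)
        then show ?thesis unfolding l .
      qed
      moreover have "t\<^sup>2 / (t + s) * (norm x)\<^sup>2 + t * s / (t + s) * (norm x)\<^sup>2 = t * (norm x)\<^sup>2"
      proof -
        have "t\<^sup>2 / (t + s) + t * s / (t + s) = t * (t + s) / (t + s)"
          by (simp add: add_divide_distrib[symmetric] distrib_left power2_eq_square)
        then have "t\<^sup>2 / (t + s) + t * s / (t + s) = t" using ts by simp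
        then show ?thesis by (metis distrib_right)
      qed
      ultimately show ?thesis unfolding 1 by (simp add: algebra_simps)
    qed
    have "(\<integral>\<^sup>+z. g t ((norm (x - z))\<^sup>2) * g s ((norm z)\<^sup>2) \<partial>lborel)
      = (\<integral>\<^sup>+z. E (norm x) t s * ennreal (exp (- ((t + s) * (norm (z - a))\<^sup>2))) \<partial>lborel)"
    proof (intro nn_integral_cong)
      fix z
      have "exp (- (t * (norm (x - z))\<^sup>2)) * exp (- (s * (norm z)\<^sup>2))
          = exp (- (t * s / (t + s) * (norm x)\<^sup>2)) * exp (- ((t + s) * (norm (z - a))\<^sup>2))"
        using sq[of z] by (simp flip: exp_add)
      then show "g t ((norm (x - z))\<^sup>2) * g s ((norm z)\<^sup>2) = E (norm x) t s * ennreal (exp (- ((t + s) * (norm (z - a))\<^sup>2)))"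
        unfolding g_def E_def using True
        by (simp add: ennreal_mult[symmetric] mult.assoc mult.left_commute)
    qed
    also have "\<dots> = E (norm x) t s * (\<integral>\<^sup>+z. ennreal (exp (- ((t + s) * (norm (z - a))\<^sup>2))) \<partial>lborel)"
      by (rule nn_integral_cmult) measurable
    also have "(\<integral>\<^sup>+z. ennreal (exp (- ((t + s) * (norm (z - a))\<^sup>2))) \<partial>lborel) = \<Phi> (t + s)"
      unfolding \<Phi>_def by (subst nn_integral_lborel_translate[of _ a, symmetric]) auto
    finally show ?thesis .
  qed (auto simp: g_def E_def)
  have "ennreal (Gamma p) * ennreal (Gamma p) * norm_conv b x 0
      = (\<integral>\<^sup>+t. (\<integral>\<^sup>+s. E (norm x) t s * \<Phi> (t + s) \<partial>lborel) \<partial>lborel)" for x :: 'a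
  proof -
    have "ennreal (Gamma p) * ennreal (Gamma p) * norm_conv b x 0 =
        (\<integral>\<^sup>+z. ennreal (Gamma p) * ennreal (Gamma p) * (ennreal (norm (x - z) powr (- b)) * ennreal (norm (z - 0) powr (- b))) \<partial>lborel)"
      unfolding norm_conv_def by (subst nn_integral_cmult) auto
    also have "\<dots> = (\<integral>\<^sup>+z. (\<integral>\<^sup>+t. (\<integral>\<^sup>+s. g t ((norm (x - z))\<^sup>2) * g s ((norm z)\<^sup>2) \<partial>lborel) \<partial>lborel) \<partial>lborel)"
    proof (intro nn_integral_cong_AE)
      have "AE z in lborel. z \<noteq> x" "AE z in lborel. z \<noteq> (0::'a)"
        by (rule AE_lborel_singleton)+
      then show "AE z in lborel. ennreal (Gamma p) * ennreal (Gamma p) * (ennreal (norm (x - z) powr (- b)) * ennreal (norm (z - 0) powr (- b)))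
        = (\<integral>\<^sup>+t. (\<integral>\<^sup>+s. g t ((norm (x - z))\<^sup>2) * g s ((norm z)\<^sup>2) \<partial>lborel) \<partial>lborel)"
      proof eventually_elim
        case (elim z)
        have "(\<integral>\<^sup>+t. (\<integral>\<^sup>+s. g t ((norm (x - z))\<^sup>2) * g s ((norm z)\<^sup>2) \<partial>lborel) \<partial>lborel)
          = (\<integral>\<^sup>+t. g t ((norm (x - z))\<^sup>2) \<partial>lborel) * (\<integral>\<^sup>+s. g s ((norm z)\<^sup>2) \<partial>lborel)"
          by (simp add: nn_integral_cmult nn_integral_multc)
        then show ?case
          using elim by (simp add: g mult_ac)
      qed
    qed
    also have "\<dots> = (\<integral>\<^sup>+t. (\<integral>\<^sup>+z. (\<integral>\<^sup>+s. g t ((norm (x - z))\<^sup>2) * g s ((norm z)\<^sup>2) \<partial>lborel) \<partial>lborel) \<partial>lborel)"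
      by (rule Tonelli_borel) (simp, simp, measurable)
    also have "\<dots> = (\<integral>\<^sup>+t. (\<integral>\<^sup>+s. (\<integral>\<^sup>+z. g t ((norm (x - z))\<^sup>2) * g s ((norm z)\<^sup>2) \<partial>lborel) \<partial>lborel) \<partial>lborel)"
      by (intro nn_integral_cong Tonelli_borel) (simp, simp, measurable)
    finally show ?thesis
      unfolding inner .
  qed
  then have eq: "ennreal (Gamma p * Gamma p) * norm_conv b x 0 = ennreal (Gamma p * Gamma p) * norm_conv b y 0"
    using xy p by (simp add: ennreal_mult Gamma_real_pos less_imp_le)
  have "0 < Gamma p * Gamma p" using p by (simp add: Gamma_real_pos)
  then have inv: "ennreal (1 / (Gamma p * Gamma p)) * (ennreal (Gamma p * Gamma p) * Z) = Z" for Z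
    by (cases "Gamma p = 0") (auto simp: mult.assoc[symmetric] ennreal_mult[symmetric])
  show ?thesis
    using arg_cong[OF eq, of "\<lambda>Z. ennreal (1 / (Gamma p * Gamma p)) * Z"] unfolding inv .
qed

lemma norm_conv_pos: "0 < norm_conv b (x::'a::euclidean_space) y"
proof (rule ccontr)
  assume "\<not> ?thesis"
  then have "AE z in lborel. ennreal (norm (x - z) powr (- b)) * ennreal (norm (z - y) powr (- b)) = 0"
    by (simp add: norm_conv_def nn_integral_0_iff_AE)
  moreover have "AE z in lborel. z \<noteq> x" "AE z in lborel. z \<noteq> y"
    by (rule AE_lborel_singleton)+
  ultimately have "AE z in (lborel :: 'a measure). False"
    by eventually_elim auto
  then show False
    using AE_False_imp_null[OF sigma_finite_borel_lborel, where 'a = 'a] by simp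
qed

text \<open>In place of polar coordinates, the power is written as the integral of
  \<open>b * r powr (- b - 1)\<close> over \<open>r\<close> beyond \<open>norm z\<close>; Tonelli
  then leaves only volumes of balls.\<close>

lemma nn_integral_norm_powr_outside:
  fixes b :: real
  assumes b: "real DIM('a) < b"
  shows "(\<integral>\<^sup>+z. ennreal (norm z powr (- b)) * indicator {z. 2 < norm z} z \<partial>(lborel :: 'a::euclidean_space measure)) < \<infinity>"
proof -
  have b0: "0 < b" using b by (meson less_trans of_nat_0_less_iff DIM_positive)
  have pt: "ennreal (norm z powr (- b)) * indicator {z. 2 < norm z} z
      \<le> (\<integral>\<^sup>+r. ennreal (b * r powr (- b - 1)) * indicator {2..} r * indicator (cball 0 r) z \<partial>lborel)" for z :: 'a
  proof (cases "2 < norm z")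
    case True
    have "ennreal (norm z powr (- b)) = ennreal b * (\<integral>\<^sup>+r. ennreal (r powr (- b - 1)) * indicator {norm z..} r \<partial>lborel)"
      using True b0 by (subst nn_integral_powr_to_inf) (auto simp: ennreal_mult[symmetric])
    also have "\<dots> = (\<integral>\<^sup>+r. ennreal b * (ennreal (r powr (- b - 1)) * indicator {norm z..} r) \<partial>lborel)"
      by (rule nn_integral_cmult[symmetric]) measurable
    also have "\<dots> \<le> (\<integral>\<^sup>+r. ennreal (b * r powr (- b - 1)) * indicator {2..} r * indicator (cball 0 r) z \<partial>lborel)"
      using True b0 by (intro nn_integral_mono) (auto split: split_indicator simp: ennreal_mult)
    finally show ?thesis using True by simp
  qed auto
  have [measurable]: "(\<lambda>p. indicator (cball (0::'a) (snd p)) (fst p) :: ennreal) \<in> borel_measurable (borel \<Otimes>\<^sub>M (borel :: real measure))"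
  proof -
    have "(\<lambda>p. indicator (cball (0::'a) (snd p)) (fst p) :: ennreal) = (\<lambda>p. if norm (fst p) \<le> snd p then 1 else 0)"
      by (auto split: split_indicator)
    then show ?thesis by simp
  qed
  have "(\<integral>\<^sup>+z. ennreal (norm z powr (- b)) * indicator {z. 2 < norm z} z \<partial>(lborel :: 'a measure))
    \<le> (\<integral>\<^sup>+z. (\<integral>\<^sup>+r. ennreal (b * r powr (- b - 1)) * indicator {2..} r * indicator (cball 0 r) z \<partial>lborel) \<partial>(lborel :: 'a measure))"
    by (intro nn_integral_mono pt)
  also have "\<dots> = (\<integral>\<^sup>+r. (\<integral>\<^sup>+z. ennreal (b * r powr (- b - 1)) * indicator {2..} r * indicator (cball 0 r) z \<partial>(lborel :: 'a measure)) \<partial>lborel)"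
    by (rule Tonelli_borel) (simp, simp, measurable)
  also have "\<dots> = (\<integral>\<^sup>+r. ennreal (b * unit_ball_vol (real DIM('a))) * (ennreal (r powr (real DIM('a) - b - 1)) * indicator {2..} r) \<partial>lborel)"
  proof (intro nn_integral_cong)
    fix r :: real
    show "(\<integral>\<^sup>+z. ennreal (b * r powr (- b - 1)) * indicator {2..} r * indicator (cball 0 r) z \<partial>(lborel :: 'a measure))
      = ennreal (b * unit_ball_vol (real DIM('a))) * (ennreal (r powr (real DIM('a) - b - 1)) * indicator {2..} r)"
    proof (cases "2 \<le> r")
      case True
      have "r powr (real DIM('a) - b - 1) = r powr (- b - 1) * r ^ DIM('a)"
        using True by (simp add: powr_realpow[symmetric] powr_add[symmetric] algebra_simps)
      then show ?thesis
        using True b0 by (subst nn_integral_cmult_indicator) (auto simp: emeasure_cball ennreal_mult[symmetric] mult_ac)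
    qed auto
  qed
  also have "\<dots> = ennreal (b * unit_ball_vol (real DIM('a))) * ennreal (2 powr (real DIM('a) - b) / (b - real DIM('a)))"
    using b by (subst nn_integral_cmult) (auto simp: nn_integral_powr_to_inf)
  also have "\<dots> < \<infinity>"
    by (simp add: ennreal_mult_less_top)
  finally show ?thesis .
qed

context riesz
begin

lemma kernel_conv_eq_norm_conv:
  "(\<integral>\<^sup>+z. k x z * k z y \<partial>lborel) = ennreal (c\<^sup>2) * norm_conv (N - \<alpha>) x y"
proof -
  have "(\<integral>\<^sup>+z. k x z * k z y \<partial>lborel)
      = (\<integral>\<^sup>+z. ennreal (c\<^sup>2) * (ennreal (norm (x - z) powr (- (N - \<alpha>))) * ennreal (norm (z - y) powr (- (N - \<alpha>)))) \<partial>lborel)"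
  proof (intro nn_integral_cong_AE)
    have "AE z in lborel. z \<noteq> x" "AE z in lborel. z \<noteq> y"
      by (rule AE_lborel_singleton)+
    then show "AE z in lborel. k x z * k z y = ennreal (c\<^sup>2) *
        (ennreal (norm (x - z) powr (- (N - \<alpha>))) * ennreal (norm (z - y) powr (- (N - \<alpha>))))"
      by eventually_elim
        (use c_pos in \<open>auto simp: kernel_eq dist_norm ennreal_mult[symmetric] power2_eq_square mult_ac\<close>)
  qed
  then show ?thesis
    unfolding norm_conv_def by (simp add: nn_integral_cmult)
qed

text \<open>A point \<open>z\<close> with \<open>norm z \<le> 2\<close> has distance at least
  \<open>1 / 2\<close> from \<open>0\<close> or from \<open>e\<close>, so one factor is bounded and
  the other locally integrable. Farther out the product decays like the power
  \<open>2 * \<alpha> - 2 * N\<close> of the norm, which is integrable as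
  \<open>2 * \<alpha> < N\<close>.\<close>

lemma kernel_conv_finite:
  assumes half: "2 * \<alpha> < N" and e: "norm e = 1"
  shows "(\<integral>\<^sup>+z. k e z * k z 0 \<partial>lborel) < \<infinity>"
proof -
  define B where "B = ennreal (c * (1 / 2) powr (\<alpha> - N))"
  define L where "L = cball (0::'a) 2"
  have [measurable]: "L \<in> sets borel" by (simp add: L_def)
  obtain V where V: "emeasure lborel L = ennreal V" "0 \<le> V"
    unfolding L_def using emeasure_lborel_cball_finite[of "0::'a" 2] by (cases "emeasure lborel (cball (0::'a) 2)") auto
  define A where "A = ennreal (2 powr (N - \<alpha>) * c\<^sup>2)"
  have pt: "k e z * k z 0 \<le> B * (indicator L z * k e z) + B * (indicator L z * k 0 z)
      + A * (ennreal (norm z powr (- (2 * N - 2 * \<alpha>))) * indicator {z. 2 < norm z} z)" for z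
  proof (cases "norm z \<le> 2")
    case True
    have "1 / 2 \<le> dist z 0 \<or> 1 / 2 \<le> dist e z"
      using norm_triangle_sub[of e z] e by (auto simp: dist_norm)
    then have "k e z * k z 0 \<le> B * k e z + B * k 0 z"
    proof
      assume "1 / 2 \<le> dist z 0"
      then have "k z 0 \<le> B" unfolding B_def by (intro kernel_upper) auto
      then have "k e z * k z 0 \<le> B * k e z" by (subst mult.commute) (rule mult_right_mono, auto)
      then show ?thesis by (rule order_trans) auto
    next
      assume "1 / 2 \<le> dist e z"
      then have "k e z \<le> B" unfolding B_def by (intro kernel_upper) auto
      then have "k e z * k z 0 \<le> B * k 0 z"
        unfolding riesz_kernel_commute[of _ z 0] by (rule mult_right_mono) auto
      then show ?thesis by (rule order_trans) auto
    qed
    then show ?thesis using True by (simp add: L_def)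
  next
    case False
    have "dist 0 z \<le> 2 * dist e z"
      using norm_triangle_sub[of z e] e False by (simp add: dist_norm norm_minus_commute)
    then have "k e z * k z 0 \<le> ennreal (2 powr (N - \<alpha>)) * k 0 z * k z 0"
      by (intro mult_right_mono kernel_le_kernel) auto
    also have "\<dots> = A * ennreal (norm z powr (- (2 * N - 2 * \<alpha>)))"
    proof -
      have "norm z powr (\<alpha> - N) * norm z powr (\<alpha> - N) = norm z powr (- (2 * N - 2 * \<alpha>))"
        by (simp flip: powr_add)
      then show ?thesis
        using False c_pos by (auto simp: A_def kernel_eq ennreal_mult[symmetric] power2_eq_square mult_ac)
    qed
    finally show ?thesis using False by (simp add: L_def)
  qed
  have Gb: "(\<integral>\<^sup>+z. indicator L z * k x z \<partial>lborel) < \<infinity>" for x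
  proof -
    have "(\<integral>\<^sup>+z. indicator L z * k x z \<partial>lborel) = G (density lborel (indicator L)) x"
      by (rule potential_density[symmetric]) auto
    also have "\<dots> \<le> ennreal (lebesgue_const * V powr (\<alpha> / N))"
      using V by (intro potential_lebesgue_le) (auto simp: L_def)
    finally show ?thesis by (auto intro: le_less_trans)
  qed
  have "(\<integral>\<^sup>+z. k e z * k z 0 \<partial>lborel) \<le> (\<integral>\<^sup>+z. B * (indicator L z * k e z) + B * (indicator L z * k 0 z)
      + A * (ennreal (norm z powr (- (2 * N - 2 * \<alpha>))) * indicator {z. 2 < norm z} z) \<partial>lborel)"
    by (intro nn_integral_mono pt)
  also have "\<dots> = B * (\<integral>\<^sup>+z. indicator L z * k e z \<partial>lborel) + B * (\<integral>\<^sup>+z. indicator L z * k 0 z \<partial>lborel)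
      + A * (\<integral>\<^sup>+z. ennreal (norm z powr (- (2 * N - 2 * \<alpha>))) * indicator {z. 2 < norm z} z \<partial>(lborel :: 'a measure))"
    by (simp add: nn_integral_add nn_integral_cmult)
  also have "\<dots> < \<infinity>"
    using Gb[of e] Gb[of 0] nn_integral_norm_powr_outside[where 'a = 'a, of "2 * N - 2 * \<alpha>"] half
    by (simp add: ennreal_mult_less_top A_def B_def N_def)
  finally show ?thesis .
qed

text \<open>Translation invariance, scaling and radial symmetry reduce the convolution to its value
  at one unit vector. That value determines \<open>C\<close>; its positivity and finiteness are all
  that the later arguments rely on.\<close>

lemma kernel_semigroup:
  assumes half: "2 * \<alpha> < N"
  obtains C where "0 < C" "\<And>x y. (\<integral>\<^sup>+z. k x z * k z y \<partial>lborel) = ennreal C * riesz_kernel (2 * \<alpha>) x y"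
proof -
  define b where "b = N - \<alpha>"
  have b: "0 < b" using \<alpha>_less by (simp add: b_def)
  obtain e :: 'a where e: "e \<in> Basis" using nonempty_Basis by blast
  then have e1: "norm e = 1" by simp
  have "ennreal (c\<^sup>2) * norm_conv b e 0 < \<infinity>"
    using kernel_conv_finite[OF half e1] by (simp add: kernel_conv_eq_norm_conv b_def)
  then have "norm_conv b e 0 < \<infinity>"
    using c_pos by (auto simp: ennreal_mult_less_top)
  then obtain K where K: "0 < K" "norm_conv b e 0 = ennreal K"
    using norm_conv_pos[of b e 0] by (cases "norm_conv b e 0") auto
  interpret D: riesz "2 * \<alpha>" N "riesz_const N (2 * \<alpha>)" ty
    using \<alpha>_pos half N_def by unfold_locales auto
  define C where "C = c\<^sup>2 * K / riesz_const N (2 * \<alpha>)"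
  have C: "0 < C" using K c_pos D.c_pos by (simp add: C_def)
  have "(\<integral>\<^sup>+z. k x z * k z y \<partial>lborel) = ennreal C * riesz_kernel (2 * \<alpha>) x y" for x y
  proof (cases "x = y")
    case True
    \<comment> \<open>Scaling by \<open>2\<close> fixes the origin, so \<open>Z\<close> equals
      itself times a factor below \<open>1\<close>. Only \<open>0\<close> and
      \<open>\<infinity>\<close> satisfy this, and positivity excludes \<open>0\<close>.\<close>
    define Z where "Z = norm_conv b (0::'a) 0"
    have "Z = ennreal (2 powr (N - 2 * b)) * Z"
      using norm_conv_scale[of 2 b "0::'a"] by (simp add: Z_def N_def)
    moreover have "2 powr (N - 2 * b) < 1"
      using half by (simp add: b_def powr_less_one)
    ultimately have "Z = 0 \<or> Z = \<infinity>"
      by (cases Z) (auto simp: ennreal_mult[symmetric])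
    then have "Z = \<infinity>"
      using norm_conv_pos[of b "0::'a" 0] by (auto simp: Z_def)
    then have "norm_conv b x y = \<infinity>"
      using norm_conv_translate[of b x y] True by (simp add: Z_def)
    then show ?thesis
      using True C c_pos by (simp add: kernel_conv_eq_norm_conv b_def[symmetric] D.kernel_eq ennreal_mult_top)
  next
    case False
    define t where "t = norm (x - y)"
    have t: "0 < t" using False by (simp add: t_def)
    have "norm_conv b x y = norm_conv b (t *\<^sub>R ((1 / t) *\<^sub>R (x - y))) 0"
      using t norm_conv_translate[of b x y] by simp
    also have "\<dots> = ennreal (t powr (N - 2 * b)) * norm_conv b ((1 / t) *\<^sub>R (x - y)) 0"
      using t by (subst norm_conv_scale) (auto simp: N_def)
    also have "norm_conv b ((1 / t) *\<^sub>R (x - y)) 0 = norm_conv b e 0"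
      using t e1 by (intro norm_conv_radial b) (auto simp: t_def)
    finally have "norm_conv b x y = ennreal (t powr (2 * \<alpha> - N)) * ennreal K"
      using K by (simp add: b_def)
    then have "(\<integral>\<^sup>+z. k x z * k z y \<partial>lborel) = ennreal (c\<^sup>2 * (t powr (2 * \<alpha> - N) * K))"
      unfolding kernel_conv_eq_norm_conv b_def[symmetric] using K by (simp add: ennreal_mult)
    also have "c\<^sup>2 * (t powr (2 * \<alpha> - N) * K) = C * (riesz_const N (2 * \<alpha>) * t powr (2 * \<alpha> - N))"
      using D.c_pos by (simp add: C_def)
    also have "ennreal \<dots> = ennreal C * riesz_kernel (2 * \<alpha>) x y"
      using False C D.c_pos unfolding D.kernel_eq by (simp add: t_def dist_norm ennreal_mult)
    finally show ?thesis .
  qed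
  with C show ?thesis by (rule that)
qed

end

section \<open>Energy and the homogeneous Sobolev space\<close>

lemma ennreal_absorb_half:
  assumes "E < \<infinity>" "K < \<infinity>" "E \<le> ennreal (1 / 2) * K + ennreal (1 / 2) * E"
  shows "E \<le> K"
proof -
  obtain e k where "0 \<le> e" "E = ennreal e" "0 \<le> k" "K = ennreal k"
    using assms(1,2) by (cases E; cases K) auto
  moreover have "ennreal (1 / 2) * ennreal k + ennreal (1 / 2) * ennreal e = ennreal (k / 2 + e / 2)"
    if "0 \<le> k" "0 \<le> e" for k e
    using that by (subst ennreal_plus) (auto simp: ennreal_mult'[symmetric] simp del: ennreal_half)
  ultimately have "e \<le> k / 2 + e / 2"
    using assms(3) by (simp only: ennreal_le_iff divide_nonneg_pos add_nonneg_nonneg zero_less_numeral)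
  then show ?thesis
    using \<open>E = ennreal e\<close> \<open>K = ennreal k\<close> by (simp add: ennreal_leI)
qed

text \<open>Young's inequality, weighted for a function \<open>F\<close> with square integral
  \<open>C * E\<close>: the last term then integrates to half of \<open>E\<close> and can be
  absorbed.\<close>

lemma ennreal_am_gm:
  assumes "0 < a" "0 < C"
  shows "ennreal a * (ennreal g * F) \<le> ennreal (a\<^sup>2 * C / 2) * (ennreal g * ennreal g) + ennreal (1 / (2 * C)) * (F * F)"
proof (cases F)
  case (real F')
  define g' where "g' = max 0 g"
  have g': "ennreal g = ennreal g'" "0 \<le> g'" by (auto simp: g'_def max_def ennreal_neg)
  have "a * (g' * F') \<le> a\<^sup>2 * C / 2 * (g' * g') + 1 / (2 * C) * (F' * F')"
  proof -
    have "0 \<le> (a * C * g' - F')\<^sup>2 / (2 * C)" using assms by simp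
    also have "\<dots> = a\<^sup>2 * C / 2 * (g' * g') + 1 / (2 * C) * (F' * F') - a * (g' * F')"
      using assms by (simp add: power2_eq_square field_simps)
    finally show ?thesis by simp
  qed
  then have "ennreal (a * (g' * F')) \<le> ennreal (a\<^sup>2 * C / 2 * (g' * g') + 1 / (2 * C) * (F' * F'))"
    by (rule ennreal_leI)
  moreover have "ennreal (a * (g' * F')) = ennreal a * (ennreal g * F)"
    using real g' assms by (simp add: ennreal_mult)
  moreover have "ennreal (a\<^sup>2 * C / 2 * (g' * g') + 1 / (2 * C) * (F' * F'))
      = ennreal (a\<^sup>2 * C / 2) * (ennreal g * ennreal g) + ennreal (1 / (2 * C)) * (F * F)"
    unfolding g'(1) real(2)
    using real(1) g'(2) assms by (subst ennreal_plus) (simp_all add: ennreal_mult[symmetric])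
  ultimately show ?thesis by simp
next
  case top
  then have "ennreal (1 / (2 * C)) * (F * F) = top" using assms by (simp add: ennreal_mult_top)
  then show ?thesis by (simp add: top_unique)
qed

lemma SUP_indicator_mult:
  fixes g :: "nat \<Rightarrow> ennreal"
  assumes mono: "\<And>j. g j \<le> g (Suc j)" and m: "\<And>j. m \<le> j \<Longrightarrow> y \<in> S j"
  shows "(SUP j. indicator (S j) y * g j) = (SUP j. g j)"
proof (rule antisym)
  show "(SUP j. indicator (S j) y * g j) \<le> (SUP j. g j)"
    by (intro SUP_mono) (auto split: split_indicator)
  have "incseq g" using mono by (rule incseq_SucI)
  show "(SUP j. g j) \<le> (SUP j. indicator (S j) y * g j)"
  proof (intro SUP_least)
    fix j
    have "g j \<le> g (max j m)" using \<open>incseq g\<close> by (simp add: incseqD)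
    also have "\<dots> = indicator (S (max j m)) y * g (max j m)" using m by simp
    also have "\<dots> \<le> (SUP j. indicator (S j) y * g j)" by (rule SUP_upper) simp
    finally show "g j \<le> (SUP j. indicator (S j) y * g j)" .
  qed
qed

context riesz
begin

lemma half_riesz: "riesz TYPE('a) (\<alpha> / 2) N (riesz_const N (\<alpha> / 2))"
  using \<alpha>_pos \<alpha>_less N_def by unfold_locales auto

lemma half_semigroup:
  obtains C where "0 < C"
    "\<And>x y :: 'a. (\<integral>\<^sup>+z. riesz_kernel (\<alpha> / 2) x z * riesz_kernel (\<alpha> / 2) z y \<partial>lborel) = ennreal C * k x y"
proof -
  interpret H: riesz "\<alpha> / 2" N "riesz_const N (\<alpha> / 2)" "TYPE('a)" by (rule half_riesz)
  obtain C where "0 < C"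
    "\<And>x y :: 'a. (\<integral>\<^sup>+z. riesz_kernel (\<alpha> / 2) x z * riesz_kernel (\<alpha> / 2) z y \<partial>lborel) = ennreal C * riesz_kernel (2 * (\<alpha> / 2)) x y"
    using H.kernel_semigroup \<alpha>_less by auto
  then show ?thesis using that by simp
qed

context
  fixes C
  assumes C: "0 < C"
    and semigroup: "\<And>x y :: 'a. (\<integral>\<^sup>+z. riesz_kernel (\<alpha> / 2) x z * riesz_kernel (\<alpha> / 2) z y \<partial>lborel) = ennreal C * k x y"
begin

lemma potential_half_half:
  assumes \<mu>: "sigma_finite_borel \<mu>"
  shows "potential (\<alpha> / 2) (density lborel (potential (\<alpha> / 2) \<mu>)) x = ennreal C * G \<mu> x"
proof -
  note [measurable_cong] = sigma_finite_borelD(1)[OF \<mu>]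
  note [measurable] = measurable_potential[OF \<mu>]
  have "potential (\<alpha> / 2) (density lborel (potential (\<alpha> / 2) \<mu>)) x
      = (\<integral>\<^sup>+z. (\<integral>\<^sup>+y. riesz_kernel (\<alpha> / 2) z y * riesz_kernel (\<alpha> / 2) x z \<partial>\<mu>) \<partial>lborel)"
    by (subst potential_density) (auto simp: nn_integral_multc potential_def)
  also have "\<dots> = (\<integral>\<^sup>+y. (\<integral>\<^sup>+z. riesz_kernel (\<alpha> / 2) z y * riesz_kernel (\<alpha> / 2) x z \<partial>lborel) \<partial>\<mu>)"
    by (rule Tonelli_borel[OF _ \<mu>]) (simp, measurable)
  also have "\<dots> = (\<integral>\<^sup>+y. ennreal C * k x y \<partial>\<mu>)"
  proof -
    have "(\<integral>\<^sup>+z. riesz_kernel (\<alpha> / 2) z y * riesz_kernel (\<alpha> / 2) x z \<partial>lborel) = ennreal C * k x y" for y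
      using semigroup[of x y] by (subst mult.commute)
    then show ?thesis by simp
  qed
  finally show ?thesis
    by (simp add: nn_integral_cmult potential_def)
qed

text \<open>For \<open>\<mu> = \<nu>\<close> this identifies the energy of \<open>\<mu>\<close> with
  a squared norm in the space of square integrable functions.\<close>

lemma energy_half:
  assumes \<mu>: "sigma_finite_borel \<mu>" and \<nu>: "sigma_finite_borel \<nu>"
  shows "(\<integral>\<^sup>+x. potential (\<alpha> / 2) \<mu> x * potential (\<alpha> / 2) \<nu> x \<partial>lborel) = ennreal C * (\<integral>\<^sup>+x. G \<mu> x \<partial>\<nu>)"
proof -
  note [measurable] = measurable_potential[OF \<mu>]
  have "(\<integral>\<^sup>+x. potential (\<alpha> / 2) \<mu> x * potential (\<alpha> / 2) \<nu> x \<partial>lborel)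
      = (\<integral>\<^sup>+y. potential (\<alpha> / 2) (density lborel (potential (\<alpha> / 2) \<mu>)) y \<partial>\<nu>)"
    using potential_symmetric[OF \<nu> sigma_finite_borel_lborel, of "\<lambda>_. 1" "potential (\<alpha> / 2) \<mu>" "\<alpha> / 2"]
    by (simp add: density_1)
  also have "\<dots> = ennreal C * (\<integral>\<^sup>+x. G \<mu> x \<partial>\<nu>)"
    using measurable_potential[OF \<mu>] \<nu> by (simp add: potential_half_half[OF \<mu>] nn_integral_cmult)
  finally show ?thesis .
qed

end

text \<open>The representing function is the potential of order \<open>\<alpha> / 2\<close> of
  \<open>\<mu>\<close>, divided by the semigroup constant. By \<open>energy_half\<close> its square
  integral is a multiple of the energy.\<close>

lemma finite_energy_imp_sobolev:
  assumes \<mu>: "sigma_finite_borel \<mu>" and fin: "(\<integral>\<^sup>+x. G \<mu> x \<partial>\<mu>) < \<infinity>"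
  shows "(\<lambda>x. enn2ereal (G \<mu> x)) \<in> homogeneous_sobolev (\<alpha> / 2)"
proof -
  interpret H: riesz "\<alpha> / 2" N "riesz_const N (\<alpha> / 2)" "TYPE('a)" by (rule half_riesz)
  obtain C where C: "0 < C"
    "\<And>x y :: 'a. (\<integral>\<^sup>+z. riesz_kernel (\<alpha> / 2) x z * riesz_kernel (\<alpha> / 2) z y \<partial>lborel) = ennreal C * k x y"
    using half_semigroup by metis
  define g where "g = potential (\<alpha> / 2) \<mu>"
  have [measurable]: "g \<in> borel_measurable borel"
    unfolding g_def by (rule measurable_potential[OF \<mu>])
  have int_g: "(\<integral>\<^sup>+x. g x * g x \<partial>lborel) < \<infinity>"
    using energy_half[OF C \<mu> \<mu>] fin by (simp add: g_def ennreal_mult_less_top)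
  then have "AE x in lborel. g x * g x \<noteq> \<infinity>"
    by (intro nn_integral_PInf_AE) (auto simp: less_top)
  then have g_fin: "AE x in lborel. g x \<noteq> \<infinity>"
    by eventually_elim auto
  \<comment> \<open>The representing function has to be real-valued; \<open>g\<close> is infinite at
    most on a null set, which the potential does not see.\<close>
  define f where "f x = enn2real (g x) / C" for x
  have [measurable]: "f \<in> borel_measurable borel" unfolding f_def by measurable
  have f_eq: "AE x in lborel. ennreal (f x) = ennreal (1 / C) * g x"
    using g_fin
  proof eventually_elim
    case (elim x)
    then obtain r where "0 \<le> r" "g x = ennreal r" by (cases "g x") auto
    then show ?case using C by (simp add: f_def ennreal_mult[symmetric])
  qed
  have "riesz_potential (\<alpha> / 2) (density lborel (\<lambda>y. ennreal (f y))) x = G \<mu> x" for x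
  proof -
    have "riesz_potential (\<alpha> / 2) (density lborel (\<lambda>y. ennreal (f y))) x
        = potential (\<alpha> / 2) (density lborel (\<lambda>y. ennreal (f y))) x"
      by (rule H.riesz_potential_density) auto
    also have "\<dots> = potential (\<alpha> / 2) (density lborel (\<lambda>y. ennreal (1 / C) * g y)) x"
      using f_eq by (intro arg_cong[where f = "\<lambda>M. potential (\<alpha> / 2) M x"] density_cong) auto
    also have "\<dots> = ennreal (1 / C) * potential (\<alpha> / 2) (density lborel g) x"
      by (simp add: potential_density mult.assoc nn_integral_cmult)
    also have "\<dots> = G \<mu> x"
      unfolding g_def potential_half_half[OF C \<mu>] using C
      by (simp add: mult.assoc[symmetric] ennreal_mult[symmetric])
    finally show ?thesis .
  qed
  moreover have "riesz_potential (\<alpha> / 2) (density lborel (\<lambda>y. ennreal (- f y))) x = 0" for x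
  proof -
    have "ennreal (- f y) = 0" for y
      using C by (intro ennreal_neg) (simp add: f_def)
    then show ?thesis
      by (simp add: H.riesz_potential_density potential_density)
  qed
  moreover have "integrable lborel (\<lambda>x. (f x)\<^sup>2)"
  proof (rule integrableI_bounded)
    have "(\<integral>\<^sup>+x. ennreal (norm ((f x)\<^sup>2)) \<partial>lborel) = (\<integral>\<^sup>+x. ennreal ((1 / C)\<^sup>2) * (g x * g x) \<partial>lborel)"
      using g_fin
    proof (intro nn_integral_cong_AE, eventually_elim)
      case (elim x)
      then obtain r where "0 \<le> r" "g x = ennreal r" by (cases "g x") auto
      then show ?case using C by (simp add: f_def ennreal_mult[symmetric] power2_eq_square)
    qed
    also have "\<dots> < \<infinity>"
      using int_g by (subst nn_integral_cmult) (auto simp: ennreal_mult_less_top)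
    finally show "(\<integral>\<^sup>+x. ennreal (norm ((f x)\<^sup>2)) \<partial>lborel) < \<infinity>" .
  qed measurable
  ultimately show ?thesis
    unfolding homogeneous_sobolev_def riesz_potential_fun_def
    by (intro CollectI exI[of _ f]) (auto simp: zero_ennreal.rep_eq)
qed

text \<open>A mollifier. It turns a finite measure carried by a ball into a bounded density, whose
  energy is finite and whose potential stays below a fixed multiple of the original one, uniformly
  in \<open>r\<close>.\<close>

definition ball_kernel :: "real \<Rightarrow> 'a \<Rightarrow> 'a \<Rightarrow> ennreal" where
  "ball_kernel r x y = (if dist x y < r then ennreal (1 / (unit_ball_vol N * r powr N)) else 0)"

lemma measurable_ball_kernel [measurable (raw)]:
  assumes [measurable]: "f \<in> measurable M borel" "g \<in> measurable M borel"
  shows "(\<lambda>x. ball_kernel r (f x) (g x)) \<in> borel_measurable M"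
  unfolding ball_kernel_def by measurable

lemma emeasure_ball_eq: "0 < r \<Longrightarrow> emeasure lborel (ball (y::'a) r) = ennreal (unit_ball_vol N * r powr N)"
  by (simp add: emeasure_ball N_def powr_realpow)

lemma unit_ball_vol_N_pos: "0 < unit_ball_vol N"
  using \<alpha>_pos \<alpha>_less by simp

lemma ball_kernel_eq: "ball_kernel r x y = ennreal (1 / (unit_ball_vol N * r powr N)) * indicator (ball y r) x"
  by (auto simp: ball_kernel_def dist_commute split: split_indicator)

lemma nn_integral_ball_kernel:
  assumes "0 < r"
  shows "(\<integral>\<^sup>+z. ball_kernel r z y \<partial>lborel) = 1"
  unfolding ball_kernel_eq using assms unit_ball_vol_N_pos
  by (subst nn_integral_cmult_indicator) (auto simp: emeasure_ball_eq ennreal_mult[symmetric])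

definition average_const :: real where
  "average_const = 2 powr (N - \<alpha>) + lebesgue_const * unit_ball_vol N powr (\<alpha> / N) / (unit_ball_vol N * (c * 2 powr (\<alpha> - N)))"

text \<open>Far from \<open>y\<close> all distances from \<open>x\<close> to the ball are comparable
  to \<open>dist x y\<close>. Near \<open>y\<close> the average is at most a multiple of
  \<open>r powr (\<alpha> - N)\<close> by \<open>potential_lebesgue_le\<close>, and
  \<open>k x y\<close> is at least of this size. The constant adds the two cases.\<close>

lemma average_kernel_le:
  assumes r: "0 < r"
  shows "(\<integral>\<^sup>+z. k x z * ball_kernel r z y \<partial>lborel) \<le> ennreal average_const * k x y"
proof -
  define V where "V = unit_ball_vol N * r powr N"
  have V: "0 < V" using r unit_ball_vol_N_pos by (simp add: V_def)
  define A where "A = lebesgue_const * unit_ball_vol N powr (\<alpha> / N) / (unit_ball_vol N * (c * 2 powr (\<alpha> - N)))"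
  have A: "0 \<le> A" using lebesgue_const_pos c_pos unit_ball_vol_N_pos by (simp add: A_def)
  have split: "ennreal average_const * k x y = ennreal (2 powr (N - \<alpha>)) * k x y + ennreal A * k x y"
    using A by (simp add: average_const_def A_def[symmetric] distrib_right)
  show ?thesis
  proof (cases "2 * r \<le> dist x y")
    case True
    have "(\<integral>\<^sup>+z. k x z * ball_kernel r z y \<partial>lborel) \<le> (\<integral>\<^sup>+z. ennreal (2 powr (N - \<alpha>)) * k x y * ball_kernel r z y \<partial>lborel)"
    proof (intro nn_integral_mono)
      fix z
      show "k x z * ball_kernel r z y \<le> ennreal (2 powr (N - \<alpha>)) * k x y * ball_kernel r z y"
      proof (cases "dist z y < r")
        case z: True
        have "dist y x \<le> 2 * dist z x"
          using dist_triangle[of x y z] z True by (simp add: dist_commute)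
        then have "k z x \<le> ennreal (2 powr (N - \<alpha>)) * k y x"
          by (intro kernel_le_kernel) auto
        then show ?thesis
          by (intro mult_right_mono) (auto simp: riesz_kernel_commute[of _ _ x])
      qed (auto simp: ball_kernel_def)
    qed
    also have "\<dots> = ennreal (2 powr (N - \<alpha>)) * k x y"
      using r by (subst nn_integral_cmult) (auto simp: nn_integral_ball_kernel)
    finally show ?thesis
      unfolding split by (rule order_trans) auto
  next
    case False
    have "(\<integral>\<^sup>+z. k x z * ball_kernel r z y \<partial>lborel) = (\<integral>\<^sup>+z. ennreal (1 / V) * (indicator (ball y r) z * k x z) \<partial>lborel)"
      by (intro nn_integral_cong) (simp add: ball_kernel_eq V_def mult_ac)
    also have "\<dots> = ennreal (1 / V) * G (density lborel (indicator (ball y r))) x"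
    proof -
      have "(\<lambda>z. indicator (ball y r) z * k x z) \<in> borel_measurable borel"
        by (intro borel_measurable_times_ennreal borel_measurable_indicator measurable_riesz_kernel) auto
      then show ?thesis
        by (simp add: nn_integral_cmult potential_density[OF sets_lborel borel_measurable_indicator])
    qed
    also have "\<dots> \<le> ennreal (1 / V) * ennreal (lebesgue_const * V powr (\<alpha> / N))"
      using r V by (intro mult_left_mono potential_lebesgue_le) (auto simp: emeasure_ball_eq V_def)
    also have "\<dots> = ennreal A * ennreal (c * (2 * r) powr (\<alpha> - N))"
    proof -
      have N_pos: "0 < N" using \<alpha>_pos \<alpha>_less by linarith
      have "V powr (\<alpha> / N) = unit_ball_vol N powr (\<alpha> / N) * r powr \<alpha>"
        using unit_ball_vol_N_pos r N_pos by (simp add: V_def powr_mult powr_powr)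
      moreover have "(2 * r) powr (\<alpha> - N) = 2 powr (\<alpha> - N) * (r powr \<alpha> / r powr N)"
        using r by (simp add: powr_mult powr_diff)
      ultimately have "1 / V * (lebesgue_const * V powr (\<alpha> / N)) = A * (c * (2 * r) powr (\<alpha> - N))"
        using unit_ball_vol_N_pos r c_pos by (simp add: V_def A_def)
      then show ?thesis
        using V A c_pos lebesgue_const_pos by (simp only: ennreal_mult[symmetric] mult_nonneg_nonneg powr_ge_zero less_imp_le divide_nonneg_pos zero_le_one)
    qed
    also have "\<dots> \<le> ennreal A * k x y"
      using False r by (intro mult_left_mono kernel_lower) auto
    finally show ?thesis
      unfolding split by (rule order_trans) auto
  qed
qed

text \<open>Mollification moves each of the two points by less than \<open>r\<close>, so their
  distance grows by less than \<open>2 * r\<close>. As \<open>r\<close> shrinks, the regularised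
  kernel on the left increases to \<open>k\<close> by \<open>kernel_SUP\<close>.\<close>

lemma mollified_energy_lower:
  assumes \<nu>: "sigma_finite_borel \<nu>" and r: "0 < r"
  defines "h \<equiv> \<lambda>x. \<integral>\<^sup>+y. ball_kernel r x y \<partial>\<nu>"
  shows "(\<integral>\<^sup>+y. (\<integral>\<^sup>+y'. ennreal (c * (dist y y' + 2 * r) powr (\<alpha> - N)) \<partial>\<nu>) \<partial>\<nu>)
    \<le> (\<integral>\<^sup>+x. h x * G (density lborel h) x \<partial>lborel)"
proof -
  note [measurable_cong] = sigma_finite_borelD(1)[OF \<nu>]
  interpret V: sigma_finite_measure \<nu> using \<nu> by (rule sigma_finite_borelD)
  have [measurable]: "h \<in> borel_measurable borel" unfolding h_def by measurable
  define F where "F x = (\<integral>\<^sup>+y. ennreal (c * (dist x y + r) powr (\<alpha> - N)) \<partial>\<nu>)" for x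
  have [measurable]: "F \<in> borel_measurable borel" unfolding F_def by measurable
  have avg: "a \<le> (\<integral>\<^sup>+z. f z * ball_kernel r z y \<partial>lborel)"
    if "\<And>z. dist z y < r \<Longrightarrow> a \<le> f z" for a f y
  proof -
    have "a = (\<integral>\<^sup>+z. a * ball_kernel r z y \<partial>lborel)"
      using r by (subst nn_integral_cmult) (auto simp: nn_integral_ball_kernel)
    also have "\<dots> \<le> (\<integral>\<^sup>+z. f z * ball_kernel r z y \<partial>lborel)"
      using that by (intro nn_integral_mono) (auto simp: ball_kernel_def intro!: mult_right_mono)
    finally show ?thesis .
  qed
  have G_ge: "F x \<le> G (density lborel h) x" for x
  proof -
    have "F x \<le> (\<integral>\<^sup>+y. (\<integral>\<^sup>+z. k x z * ball_kernel r z y \<partial>lborel) \<partial>\<nu>)"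
      unfolding F_def
    proof (intro nn_integral_mono avg kernel_lower)
      show "dist x z \<le> dist x y + r" if "dist z y < r" for y z
        using dist_triangle[of x z y] that by (simp add: dist_commute)
      show "0 < dist x y + r" for y using r by (simp add: add_nonneg_pos)
    qed
    also have "\<dots> = (\<integral>\<^sup>+z. (\<integral>\<^sup>+y. k x z * ball_kernel r z y \<partial>\<nu>) \<partial>lborel)"
      by (rule Tonelli_borel[OF \<nu>]) (simp, measurable)
    also have "\<dots> = G (density lborel h) x"
      by (subst potential_density) (auto simp: nn_integral_cmult h_def mult.commute)
    finally show ?thesis .
  qed
  have "(\<integral>\<^sup>+y. (\<integral>\<^sup>+y'. ennreal (c * (dist y y' + 2 * r) powr (\<alpha> - N)) \<partial>\<nu>) \<partial>\<nu>)
      \<le> (\<integral>\<^sup>+y. (\<integral>\<^sup>+x. F x * ball_kernel r x y \<partial>lborel) \<partial>\<nu>)"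
  proof (intro nn_integral_mono avg)
    fix y x :: 'a assume xy: "dist x y < r"
    show "(\<integral>\<^sup>+y'. ennreal (c * (dist y y' + 2 * r) powr (\<alpha> - N)) \<partial>\<nu>) \<le> F x"
      unfolding F_def
    proof (intro nn_integral_mono ennreal_leI mult_left_mono powr_mono2')
      show "dist x y' + r \<le> dist y y' + 2 * r" for y'
        using dist_triangle[of x y' y] xy by simp
    qed (use r c_pos \<alpha>_less in \<open>auto intro: add_nonneg_pos\<close>)
  qed
  also have "\<dots> = (\<integral>\<^sup>+x. (\<integral>\<^sup>+y. F x * ball_kernel r x y \<partial>\<nu>) \<partial>lborel)"
    by (rule Tonelli_borel[OF \<nu>]) (simp, measurable)
  also have "\<dots> = (\<integral>\<^sup>+x. h x * F x \<partial>lborel)"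
    by (simp add: nn_integral_cmult h_def mult.commute)
  also have "\<dots> \<le> (\<integral>\<^sup>+x. h x * G (density lborel h) x \<partial>lborel)"
    by (intro nn_integral_mono mult_left_mono G_ge) auto
  finally show ?thesis .
qed

lemma mollified_potential_le:
  assumes \<nu>: "sigma_finite_borel \<nu>" and r: "0 < r"
  shows "G (density lborel (\<lambda>x. \<integral>\<^sup>+y. ball_kernel r x y \<partial>\<nu>)) x \<le> ennreal average_const * G \<nu> x"
proof -
  note [measurable_cong] = sigma_finite_borelD(1)[OF \<nu>]
  interpret V: sigma_finite_measure \<nu> using \<nu> by (rule sigma_finite_borelD)
  have "G (density lborel (\<lambda>x. \<integral>\<^sup>+y. ball_kernel r x y \<partial>\<nu>)) x = (\<integral>\<^sup>+z. (\<integral>\<^sup>+y. k x z * ball_kernel r z y \<partial>\<nu>) \<partial>lborel)"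
    by (subst potential_density) (auto simp: nn_integral_cmult mult.commute)
  also have "\<dots> = (\<integral>\<^sup>+y. (\<integral>\<^sup>+z. k x z * ball_kernel r z y \<partial>lborel) \<partial>\<nu>)"
    by (rule Tonelli_borel[OF _ \<nu>]) (simp, measurable)
  also have "\<dots> \<le> (\<integral>\<^sup>+y. ennreal average_const * k x y \<partial>\<nu>)"
    by (intro nn_integral_mono average_kernel_le r)
  finally show ?thesis
    by (simp add: nn_integral_cmult potential_def)
qed

text \<open>The mollified density is bounded and vanishes off a ball, so
  \<open>potential_lebesgue_le\<close> bounds its potential. This finiteness permits the absorption
  in \<open>sobolev_imp_finite_energy\<close>.\<close>

lemma mollified_energy_finite:
  assumes \<nu>: "sets \<nu> = sets borel" "emeasure \<nu> UNIV < \<infinity>" and r: "0 < r"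
    and supp: "AE y in \<nu>. y \<in> cball 0 R"
  defines "h \<equiv> \<lambda>x. \<integral>\<^sup>+y. ball_kernel r x y \<partial>\<nu>"
  shows "(\<integral>\<^sup>+x. h x * G (density lborel h) x \<partial>lborel) < \<infinity>"
proof -
  have sf: "sigma_finite_borel \<nu>" using \<nu> by (rule sigma_finite_borel_finite)
  note [measurable_cong] = \<nu>(1)
  interpret V: sigma_finite_measure \<nu> using sf by (rule sigma_finite_borelD)
  have [measurable]: "h \<in> borel_measurable borel" unfolding h_def by measurable
  define L where "L = cball (0::'a) (R + r)"
  have [measurable]: "L \<in> sets borel" by (simp add: L_def)
  define B where "B = ennreal (1 / (unit_ball_vol N * r powr N)) * emeasure \<nu> UNIV"
  have B: "B < \<infinity>" using \<nu>(2) by (simp add: B_def ennreal_mult_less_top)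
  obtain V where V: "emeasure lborel L = ennreal V" "0 \<le> V"
    unfolding L_def using emeasure_lborel_cball_finite[of "0::'a" "R + r"]
    by (cases "emeasure lborel (cball (0::'a) (R + r))") auto
  have h_le: "h x \<le> B * indicator L x" for x
  proof (cases "x \<in> L")
    case True
    have "h x \<le> (\<integral>\<^sup>+y. ennreal (1 / (unit_ball_vol N * r powr N)) \<partial>\<nu>)"
      unfolding h_def by (intro nn_integral_mono) (auto simp: ball_kernel_def)
    then show ?thesis
      using True by (simp add: B_def sigma_finite_borelD[OF sf])
  next
    case False
    have "AE y in \<nu>. ball_kernel r x y = 0"
      using supp
    proof eventually_elim
      case (elim y)
      have "\<not> dist x y < r"
        using False elim dist_triangle2[of 0 x y] by (auto simp: L_def dist_commute)
      then show ?case by (simp add: ball_kernel_def)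
    qed
    then have "h x = (\<integral>\<^sup>+y. 0 \<partial>\<nu>)"
      unfolding h_def by (rule nn_integral_cong_AE)
    then show ?thesis by simp
  qed
  have G_le: "G (density lborel h) x \<le> B * ennreal (lebesgue_const * V powr (\<alpha> / N))" for x
  proof -
    have "G (density lborel h) x \<le> G (density lborel (\<lambda>x. B * indicator L x)) x"
      using h_le by (intro potential_mono_density) auto
    also have "\<dots> = B * G (density lborel (indicator L)) x"
      by (simp add: potential_density mult.assoc nn_integral_cmult)
    also have "\<dots> \<le> B * ennreal (lebesgue_const * V powr (\<alpha> / N))"
      using V by (intro mult_left_mono potential_lebesgue_le) auto
    finally show ?thesis .
  qed
  have "(\<integral>\<^sup>+x. h x * G (density lborel h) x \<partial>lborel)
      \<le> (\<integral>\<^sup>+x. B * indicator L x * (B * ennreal (lebesgue_const * V powr (\<alpha> / N))) \<partial>lborel)"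
    by (intro nn_integral_mono mult_mono h_le G_le) auto
  also have "\<dots> = B * (B * ennreal (lebesgue_const * V powr (\<alpha> / N))) * emeasure lborel L"
    by (subst nn_integral_cmult_indicator[symmetric]) (auto simp: mult_ac)
  also have "\<dots> < \<infinity>"
    using B V by (simp add: ennreal_mult_less_top)
  finally show ?thesis .
qed

lemma kernel_SUP:
  "(SUP j. ennreal (c * (dist x y + 2 * (1 / real (Suc j))) powr (\<alpha> - N))) = k x y"
proof (cases "x = y")
  case True
  have "\<exists>j. of_nat m \<le> ennreal (c * (2 * (1 / real (Suc j))) powr (\<alpha> - N))" for m
  proof -
    define b where "b = (real m / c) powr (1 / (N - \<alpha>))"
    obtain j where "2 * b \<le> real j" using real_arch_simple by blast
    then have "b powr (N - \<alpha>) \<le> (real (Suc j) / 2) powr (N - \<alpha>)"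
      using \<alpha>_less by (intro powr_mono2) (auto simp: b_def)
    moreover have "b powr (N - \<alpha>) = real m / c"
      using c_pos \<alpha>_less by (simp add: b_def powr_powr)
    moreover have "(2 * (1 / real (Suc j))) powr (\<alpha> - N) = (real (Suc j) / 2) powr (N - \<alpha>)"
      using powr_minus[of "2 * (1 / real (Suc j))" "N - \<alpha>"] by (simp add: powr_divide)
    ultimately have "real m / c \<le> (2 * (1 / real (Suc j))) powr (\<alpha> - N)"
      by simp
    then have "real m \<le> c * (2 * (1 / real (Suc j))) powr (\<alpha> - N)"
      using c_pos by (simp add: pos_divide_le_eq mult.commute)
    then show ?thesis
      by (intro exI[of _ j]) (simp add: ennreal_of_nat_eq_real_of_nat ennreal_leI)
  qed
  then show ?thesis
    using True by (simp add: kernel_eq ennreal_SUP_eq_top)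
next
  case False
  have "(\<lambda>j. (dist x y + 2 * (1 / real (Suc j))) powr (\<alpha> - N)) \<longlonglongrightarrow> (dist x y + 2 * 0) powr (\<alpha> - N)"
    using False by (intro tendsto_intros LIMSEQ_Suc[OF lim_1_over_n]) auto
  then have "(\<lambda>j. ennreal (c * (dist x y + 2 * (1 / real (Suc j))) powr (\<alpha> - N))) \<longlonglongrightarrow> ennreal (c * (dist x y + 2 * 0) powr (\<alpha> - N))"
    by (intro tendsto_ennrealI tendsto_mult tendsto_const)
  moreover have "incseq (\<lambda>j. ennreal (c * (dist x y + 2 * (1 / real (Suc j))) powr (\<alpha> - N)))"
    using c_pos \<alpha>_less False
    by (intro incseq_SucI ennreal_leI mult_left_mono powr_mono2' add_left_mono divide_left_mono) (auto intro!: add_pos_pos)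
  ultimately show ?thesis
    using False LIMSEQ_unique[OF LIMSEQ_SUP] by (simp add: kernel_eq)
qed

text \<open>Testing the potential against mollifications of truncations of \<open>\<mu>\<close>, whose energies are
  finite a priori, bounds these energies by the \<open>L\<^sup>2\<close>-norm of the representing function.\<close>

lemma sobolev_imp_finite_energy:
  assumes \<mu>: "sets \<mu> = sets borel" and loc: "\<And>m::nat. emeasure \<mu> (cball 0 (real m)) < \<infinity>"
    and sob: "(\<lambda>x. enn2ereal (G \<mu> x)) \<in> homogeneous_sobolev (\<alpha> / 2)"
  shows "(\<integral>\<^sup>+x. G \<mu> x \<partial>\<mu>) < \<infinity>"
proof -
  interpret H: riesz "\<alpha> / 2" N "riesz_const N (\<alpha> / 2)" "TYPE('a)" by (rule half_riesz)
  have sf: "sigma_finite_borel \<mu>" using \<mu> loc by (rule sigma_finite_borelI)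
  note [measurable_cong] = \<mu> and [measurable] = measurable_potential[OF sf]
  interpret M: sigma_finite_measure \<mu> using sf by (rule sigma_finite_borelD)
  obtain C where C: "0 < C"
    "\<And>x y :: 'a. (\<integral>\<^sup>+z. riesz_kernel (\<alpha> / 2) x z * riesz_kernel (\<alpha> / 2) z y \<partial>lborel) = ennreal C * k x y"
    using half_semigroup by metis
  obtain f where f [measurable]: "f \<in> borel_measurable lborel" and f2: "integrable lborel (\<lambda>x. (f x)\<^sup>2)"
    and f_eq: "AE x in lborel. enn2ereal (G \<mu> x) = riesz_potential_fun (\<alpha> / 2) f x"
    using sob unfolding homogeneous_sobolev_def by blast
  have [measurable]: "f \<in> borel_measurable borel" using f by simp
  define P where "P = potential (\<alpha> / 2) (density lborel (\<lambda>y. ennreal (f y)))"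
  \<comment> \<open>Subtracting the potential of the negative part can only lower the value, even
    for \<open>\<infinity> - \<infinity>\<close>, so the positive part of \<open>f\<close> alone
    gives an upper bound.\<close>
  have GP: "AE x in lborel. G \<mu> x \<le> P x"
    using f_eq
  proof eventually_elim
    case (elim x)
    have "A - B \<le> A" if "0 \<le> B" for A B :: ereal
      using that by (cases A; cases B) auto
    then have "enn2ereal (G \<mu> x) \<le> enn2ereal (riesz_potential (\<alpha> / 2) (density lborel (\<lambda>y. ennreal (f y))) x)"
      unfolding elim riesz_potential_fun_def by simp
    then show ?case
      by (simp add: P_def H.riesz_potential_density less_eq_ennreal.rep_eq)
  qed
  define A0 where "A0 = (\<integral>\<^sup>+x. ennreal (f x) * ennreal (f x) \<partial>lborel)"
  have A0: "A0 < \<infinity>"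
  proof -
    have "A0 \<le> (\<integral>\<^sup>+x. ennreal ((f x)\<^sup>2) \<partial>lborel)"
      unfolding A0_def
    proof (intro nn_integral_mono)
      show "ennreal (f x) * ennreal (f x) \<le> ennreal ((f x)\<^sup>2)" for x
        by (cases "0 \<le> f x") (auto simp: power2_eq_square ennreal_mult ennreal_neg)
    qed
    also have "\<dots> < \<infinity>"
      using f2 by (simp add: integrable_iff_bounded)
    finally show ?thesis .
  qed
  have avg_pos: "0 < average_const"
    using lebesgue_const_pos c_pos unit_ball_vol_N_pos by (simp add: average_const_def add_pos_nonneg)
  \<comment> \<open>Twice the first term of Young's inequality below. Symmetry moves the potential
    of order \<open>\<alpha> / 2\<close> from \<open>f\<close> to \<open>h\<close>, and then the
    energy is at most half of \<open>K\<close> plus half of itself.\<close>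
  define K where "K = ennreal (average_const\<^sup>2 * C) * A0"
  have K: "K < \<infinity>" using A0 by (simp add: K_def ennreal_mult_less_top)
  \<comment> \<open>One index drives both limits: the balls \<open>B j\<close> grow while the
    mollification radius \<open>r j\<close> shrinks, so the regularised energies increase to the
    full one.\<close>
  define r where "r j = 1 / real (Suc j)" for j
  define B where "B j = cball (0::'a) (real j)" for j
  have [measurable]: "B j \<in> sets borel" for j by (simp add: B_def)
  define \<kappa> where "\<kappa> j x y = ennreal (c * (dist x y + 2 * r j) powr (\<alpha> - N))" for j and x y :: 'a
  have [measurable]: "(\<lambda>w. \<kappa> j (f w) (g w)) \<in> borel_measurable M"
    if [measurable]: "f \<in> borel_measurable M" "g \<in> borel_measurable M" for j f g and M :: "'b measure"
    unfolding \<kappa>_def by measurable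
  have bound: "(\<integral>\<^sup>+y. indicator (B j) y * (\<integral>\<^sup>+y'. indicator (B j) y' * \<kappa> j y y' \<partial>\<mu>) \<partial>\<mu>) \<le> K" for j
  proof -
    have rj: "0 < r j" by (simp add: r_def)
    define \<nu> where "\<nu> = density \<mu> (indicator (B j))"
    have \<nu>: "sets \<nu> = sets borel" "emeasure \<nu> UNIV < \<infinity>"
      using loc[of j] \<mu> emeasure_restricted[of "B j" \<mu> UNIV] by (auto simp: \<nu>_def B_def)
    have \<nu>sf: "sigma_finite_borel \<nu>" using \<nu> by (rule sigma_finite_borel_finite)
    interpret V: sigma_finite_measure \<nu> using \<nu>sf by (rule sigma_finite_borelD)
    note [measurable_cong] = \<nu>(1)
    define h where "h x = (\<integral>\<^sup>+y. ball_kernel (r j) x y \<partial>\<nu>)" for x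
    have [measurable]: "h \<in> borel_measurable borel" unfolding h_def by measurable
    define E where "E = (\<integral>\<^sup>+x. h x * G (density lborel h) x \<partial>lborel)"
    have "AE y in \<nu>. y \<in> cball 0 (real j)"
      unfolding \<nu>_def using \<mu>
      by (subst AE_density, intro borel_measurable_indicator) (auto simp: B_def split: split_indicator)
    then have E_fin: "E < \<infinity>"
      unfolding E_def h_def using \<nu> rj by (intro mollified_energy_finite) auto
    have h_sf: "sigma_finite_borel (density lborel h)"
    proof (rule sigma_finite_borel_finite)
      have "emeasure (density lborel h) UNIV = (\<integral>\<^sup>+x. (\<integral>\<^sup>+y. ball_kernel (r j) x y \<partial>\<nu>) \<partial>lborel)"
        by (simp add: emeasure_density h_def)
      also have "\<dots> = (\<integral>\<^sup>+y. (\<integral>\<^sup>+x. ball_kernel (r j) x y \<partial>lborel) \<partial>\<nu>)"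
        by (rule Tonelli_borel[OF _ \<nu>sf]) (simp, measurable)
      also have "\<dots> = emeasure \<nu> UNIV"
        using rj by (simp add: nn_integral_ball_kernel sigma_finite_borelD[OF \<nu>sf])
      finally show "emeasure (density lborel h) UNIV < \<infinity>" using \<nu> by simp
    qed simp
    define F where "F = potential (\<alpha> / 2) (density lborel h)"
    have [measurable]: "F \<in> borel_measurable borel"
      unfolding F_def by (rule measurable_potential[OF h_sf])
    have FF: "(\<integral>\<^sup>+x. F x * F x \<partial>lborel) = ennreal C * E"
      unfolding F_def energy_half[OF C h_sf h_sf] E_def
      using measurable_potential[OF h_sf, of \<alpha>] by (subst nn_integral_density) auto
    have "E \<le> (\<integral>\<^sup>+x. ennreal average_const * (h x * P x) \<partial>lborel)"
      unfolding E_def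
    proof (intro nn_integral_mono_AE)
      show "AE x in lborel. h x * G (density lborel h) x \<le> ennreal average_const * (h x * P x)"
        using GP
      proof eventually_elim
        case (elim x)
        have "G (density lborel h) x \<le> ennreal average_const * G \<nu> x"
          unfolding h_def by (rule mollified_potential_le[OF \<nu>sf rj])
        also have "\<dots> \<le> ennreal average_const * P x"
          using elim potential_le_density_indicator[OF sf, of "B j" x]
          by (intro mult_left_mono) (auto simp: \<nu>_def intro: order_trans)
        finally show ?case
          by (metis mult.left_commute mult_left_mono zero_le)
      qed
    qed
    also have "\<dots> = ennreal average_const * (\<integral>\<^sup>+x. h x * P x \<partial>lborel)"
      unfolding P_def by (rule nn_integral_cmult) measurable
    also have "(\<integral>\<^sup>+x. h x * P x \<partial>lborel) = (\<integral>\<^sup>+x. ennreal (f x) * F x \<partial>lborel)"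
      unfolding P_def F_def by (rule potential_symmetric) auto
    also have "ennreal average_const * \<dots> = (\<integral>\<^sup>+x. ennreal average_const * (ennreal (f x) * F x) \<partial>lborel)"
      by (rule nn_integral_cmult[symmetric]) measurable
    also have "\<dots> \<le> (\<integral>\<^sup>+x. ennreal (average_const\<^sup>2 * C / 2) * (ennreal (f x) * ennreal (f x))
        + ennreal (1 / (2 * C)) * (F x * F x) \<partial>lborel)"
      by (intro nn_integral_mono ennreal_am_gm avg_pos C)
    also have "\<dots> = ennreal (average_const\<^sup>2 * C / 2) * A0 + ennreal (1 / (2 * C)) * (ennreal C * E)"
      by (simp add: nn_integral_add nn_integral_cmult A0_def FF)
    also have "\<dots> = ennreal (1 / 2) * K + ennreal (1 / 2) * E"
    proof -
      have "ennreal (average_const\<^sup>2 * C / 2) = ennreal (1 / 2) * ennreal (average_const\<^sup>2 * C)"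
        using C by (subst ennreal_mult[symmetric]) auto
      moreover have "ennreal (1 / (2 * C)) * ennreal C = ennreal (1 / 2)"
        using C by (subst ennreal_mult[symmetric]) auto
      ultimately show ?thesis by (simp only: K_def mult.assoc[symmetric])
    qed
    finally have "E \<le> ennreal (1 / 2) * K + ennreal (1 / 2) * E" .
    then have "E \<le> K"
      by (rule ennreal_absorb_half[OF E_fin K])
    moreover have "(\<integral>\<^sup>+y. (\<integral>\<^sup>+y'. \<kappa> j y y' \<partial>\<nu>) \<partial>\<nu>) \<le> E"
      unfolding E_def h_def \<kappa>_def by (rule mollified_energy_lower[OF \<nu>sf rj])
    moreover have "(\<integral>\<^sup>+y. (\<integral>\<^sup>+y'. \<kappa> j y y' \<partial>\<nu>) \<partial>\<nu>)
        = (\<integral>\<^sup>+y. indicator (B j) y * (\<integral>\<^sup>+y'. indicator (B j) y' * \<kappa> j y y' \<partial>\<mu>) \<partial>\<mu>)"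
      unfolding \<nu>_def by (simp add: nn_integral_density)
    ultimately show ?thesis by simp
  qed
  have B_mono: "indicator (B j) y \<le> (indicator (B (Suc j)) y :: ennreal)" for j y
    by (auto simp: B_def split: split_indicator)
  have \<kappa>_mono: "\<kappa> j x y \<le> \<kappa> (Suc j) x y" for j x y
    unfolding \<kappa>_def r_def using c_pos \<alpha>_less
    by (intro ennreal_leI mult_left_mono powr_mono2' add_left_mono divide_left_mono) (auto intro!: add_nonneg_pos)
  have sup_mult: "(SUP j. indicator (B j) y * g j) = (SUP j. g j)"
    if "\<And>j. g j \<le> g (Suc j)" for y and g :: "nat \<Rightarrow> ennreal"
  proof -
    obtain m where "norm y \<le> real m" using real_arch_simple by blast
    then show ?thesis using that by (intro SUP_indicator_mult[where m = m]) (auto simp: B_def)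
  qed
  have inner: "(SUP j. \<integral>\<^sup>+y'. indicator (B j) y' * \<kappa> j y y' \<partial>\<mu>) = G \<mu> y" for y
  proof -
    have "(SUP j. \<integral>\<^sup>+y'. indicator (B j) y' * \<kappa> j y y' \<partial>\<mu>) = (\<integral>\<^sup>+y'. (SUP j. indicator (B j) y' * \<kappa> j y y') \<partial>\<mu>)"
      by (intro nn_integral_monotone_convergence_SUP[symmetric] incseq_SucI le_funI mult_mono B_mono \<kappa>_mono) auto
    also have "\<dots> = (\<integral>\<^sup>+y'. k y y' \<partial>\<mu>)"
    proof (intro nn_integral_cong)
      show "(SUP j. indicator (B j) y' * \<kappa> j y y') = k y y'" for y'
        using sup_mult[of "\<lambda>j. \<kappa> j y y'" y'] \<kappa>_mono kernel_SUP[of y y'] by (simp add: \<kappa>_def r_def)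
    qed
    finally show ?thesis by (simp add: potential_def)
  qed
  have inner_mono: "(\<integral>\<^sup>+y'. indicator (B j) y' * \<kappa> j y y' \<partial>\<mu>) \<le> (\<integral>\<^sup>+y'. indicator (B (Suc j)) y' * \<kappa> (Suc j) y y' \<partial>\<mu>)" for j y
    by (intro nn_integral_mono mult_mono B_mono \<kappa>_mono) auto
  have "(\<integral>\<^sup>+y. G \<mu> y \<partial>\<mu>) = (\<integral>\<^sup>+y. (SUP j. indicator (B j) y * (\<integral>\<^sup>+y'. indicator (B j) y' * \<kappa> j y y' \<partial>\<mu>)) \<partial>\<mu>)"
    using sup_mult inner inner_mono by simp
  also have "\<dots> = (SUP j. \<integral>\<^sup>+y. indicator (B j) y * (\<integral>\<^sup>+y'. indicator (B j) y' * \<kappa> j y y' \<partial>\<mu>) \<partial>\<mu>)"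
    by (intro nn_integral_monotone_convergence_SUP incseq_SucI le_funI mult_mono B_mono inner_mono) auto
  also have "\<dots> \<le> K"
    by (intro SUP_least bound)
  finally show ?thesis using K by (rule le_less_trans)
qed

end

section \<open>The a priori bound\<close>

lemma ennreal_mult_le_cancel: "0 < a \<Longrightarrow> 0 \<le> s \<Longrightarrow> ennreal a * x \<le> ennreal s \<Longrightarrow> x \<le> ennreal (s / a)"
  by (cases x) (auto simp: ennreal_mult[symmetric] ennreal_mult_top top_unique field_simps intro!: ennreal_leI)

context riesz
begin

text \<open>The constant \<open>B\<close> of the overview, determined by
  \<open>B powr (1 - q) * \<delta> powr q = 1\<close>.\<close>

definition weight_const :: "real \<Rightarrow> real \<Rightarrow> real" where
  "weight_const \<delta> q = \<delta> powr (- q / (1 - q))"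

definition potential_weight :: "real \<Rightarrow> real \<Rightarrow> 'a measure \<Rightarrow> ('a \<Rightarrow> ennreal) \<Rightarrow> 'a \<Rightarrow> ennreal" where
  "potential_weight \<delta> q \<sigma> w y =
     max (ennreal \<delta> * w y) (ennreal (weight_const \<delta> q) * G \<sigma> y epowr (1 / (1 - q)))"

lemma weight_const_pos: "0 < \<delta> \<Longrightarrow> 0 < weight_const \<delta> q"
  by (simp add: weight_const_def)

lemma measurable_potential_weight [measurable]:
  assumes "sigma_finite_borel \<sigma>" and [measurable]: "w \<in> borel_measurable borel"
  shows "potential_weight \<delta> q \<sigma> w \<in> borel_measurable borel"
proof -
  note [measurable] = measurable_potential[OF assms(1)]
  show ?thesis unfolding potential_weight_def[abs_def] by measurable
qed

text \<open>Where the weight is at most \<open>s\<close>, the density is at most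
  \<open>(s / \<delta>) powr q\<close> and \<open>G \<sigma>\<close> is at most
  \<open>t = (s / B) powr (1 - q)\<close>. The maximum principle bounds the potential by
  \<open>2 powr (N - \<alpha>)\<close> times the product of the two, and \<open>weight_const\<close>
  is chosen so that this product is \<open>s\<close>.\<close>

lemma potential_weight_level:
  assumes \<sigma>: "sigma_finite_borel \<sigma>" and w [measurable]: "w \<in> borel_measurable borel"
    and q: "0 < q" "q < 1" and \<delta>: "0 < \<delta>" and s: "0 < s"
  shows "G (density (density \<sigma> (\<lambda>y. w y epowr q)) (indicator {y. potential_weight \<delta> q \<sigma> w y \<le> ennreal s})) x
    \<le> ennreal (2 powr (N - \<alpha>) * s)"
proof -
  note [measurable_cong] = sigma_finite_borelD(1)[OF \<sigma>]
  note [measurable] = measurable_potential[OF \<sigma>] measurable_potential_weight[OF \<sigma> w]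
  define B where "B = weight_const \<delta> q"
  have B: "0 < B" using \<delta> by (simp add: B_def weight_const_pos)
  define L where "L = {y. potential_weight \<delta> q \<sigma> w y \<le> ennreal s}"
  have [measurable]: "L \<in> sets borel" unfolding L_def by measurable
  define t where "t = (s / B) powr (1 - q)"
  have le: "w y epowr q * indicator L y \<le> ennreal ((s / \<delta>) powr q) * indicator {y. G \<sigma> y \<le> ennreal t} y" for y
  proof (cases "y \<in> L")
    case True
    then have "w y \<le> ennreal (s / \<delta>)" "G \<sigma> y epowr (1 / (1 - q)) \<le> ennreal (s / B)"
      using \<delta> B s by (auto simp: L_def potential_weight_def B_def[symmetric] intro!: ennreal_mult_le_cancel)
    then have "w y epowr q \<le> ennreal (s / \<delta>) epowr q"
      "(G \<sigma> y epowr (1 / (1 - q))) epowr (1 - q) \<le> ennreal (s / B) epowr (1 - q)"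
      using q by (auto intro!: epowr_mono)
    then show ?thesis
      using True q s \<delta> B by (simp add: epowr_epowr epowr_ennreal t_def)
  qed auto
  have "density (density \<sigma> (\<lambda>y. w y epowr q)) (indicator L) = density \<sigma> (\<lambda>y. w y epowr q * indicator L y)"
    by (rule density_density_eq) auto
  then have "G (density (density \<sigma> (\<lambda>y. w y epowr q)) (indicator L)) x
      \<le> G (density \<sigma> (\<lambda>y. ennreal ((s / \<delta>) powr q) * indicator {y. G \<sigma> y \<le> ennreal t} y)) x"
    using le by (simp, intro potential_mono_density[OF \<sigma>]) auto
  also have "\<dots> = ennreal ((s / \<delta>) powr q) * G (density \<sigma> (indicator {y. G \<sigma> y \<le> ennreal t})) x"
    by (simp add: potential_density sigma_finite_borelD(1)[OF \<sigma>] mult.assoc nn_integral_cmult)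
  also have "\<dots> \<le> ennreal ((s / \<delta>) powr q) * (ennreal (2 powr (N - \<alpha>)) * ennreal t)"
    by (intro mult_left_mono weak_maximum_principle_level \<sigma>) auto
  also have "\<dots> = ennreal (2 powr (N - \<alpha>) * s)"
  proof -
    have "B powr (1 - q) = \<delta> powr (- q)"
      using q \<delta> by (simp add: B_def weight_const_def powr_powr)
    then have "(s / \<delta>) powr q * t = s powr q * s powr (1 - q) / (\<delta> powr q * \<delta> powr (- q))"
      using s \<delta> B by (simp add: t_def powr_divide)
    also have "\<delta> powr q * \<delta> powr (- q) = 1" using \<delta> by (simp flip: powr_add)
    also have "s powr q * s powr (1 - q) = s" using s by (simp flip: powr_add)
    finally have "(s / \<delta>) powr q * t = s" by simp
    then have "(s / \<delta>) powr q * (2 powr (N - \<alpha>) * t) = 2 powr (N - \<alpha>) * s"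
      by (simp add: mult.left_commute)
    moreover have "ennreal ((s / \<delta>) powr q) * (ennreal (2 powr (N - \<alpha>)) * ennreal t)
        = ennreal ((s / \<delta>) powr q * (2 powr (N - \<alpha>) * t))"
      by (simp add: ennreal_mult' t_def)
    ultimately show ?thesis
      by (simp only:)
  qed
  finally show ?thesis unfolding L_def .
qed

definition absorb_const :: "real \<Rightarrow> real \<Rightarrow> real \<Rightarrow> real" where
  "absorb_const \<delta> \<gamma> q = (weight_const \<delta> q / \<delta>) powr q * weight_const \<delta> q powr \<gamma>"

text \<open>If the first entry of the maximum is the larger one, the integrand is
  \<open>w epowr (\<gamma> + q)\<close> with the small factor \<open>\<delta> powr \<gamma>\<close>.
  Otherwise \<open>w\<close> is at most \<open>B / \<delta>\<close> times
  \<open>G \<sigma> epowr (1 / (1 - q))\<close>, and \<open>absorb_const\<close> collects the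
  factors.\<close>

lemma potential_weight_integral:
  assumes \<sigma>: "sigma_finite_borel \<sigma>" and w [measurable]: "w \<in> borel_measurable borel"
    and q: "0 < q" "q < 1" and \<delta>: "0 < \<delta>" and \<gamma>: "0 < \<gamma>"
  shows "(\<integral>\<^sup>+y. potential_weight \<delta> q \<sigma> w y epowr \<gamma> \<partial>(density \<sigma> (\<lambda>y. w y epowr q)))
    \<le> ennreal (\<delta> powr \<gamma>) * (\<integral>\<^sup>+y. w y epowr (\<gamma> + q) \<partial>\<sigma>)
      + ennreal (absorb_const \<delta> \<gamma> q) * (\<integral>\<^sup>+y. G \<sigma> y epowr ((\<gamma> + q) / (1 - q)) \<partial>\<sigma>)"
proof -
  note [measurable_cong] = sigma_finite_borelD(1)[OF \<sigma>]
  note [measurable] = measurable_potential[OF \<sigma>] measurable_potential_weight[OF \<sigma> w]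
  define B where "B = weight_const \<delta> q"
  have B: "0 < B" using \<delta> by (simp add: B_def weight_const_pos)
  have pt: "w y epowr q * potential_weight \<delta> q \<sigma> w y epowr \<gamma>
      \<le> ennreal (\<delta> powr \<gamma>) * w y epowr (\<gamma> + q) + ennreal (absorb_const \<delta> \<gamma> q) * G \<sigma> y epowr ((\<gamma> + q) / (1 - q))" for y
  proof -
    define g where "g = G \<sigma> y epowr (1 / (1 - q))"
    have gg: "g epowr (\<gamma> + q) = G \<sigma> y epowr ((\<gamma> + q) / (1 - q))"
      by (simp add: g_def epowr_epowr)
    have W: "potential_weight \<delta> q \<sigma> w y = max (ennreal \<delta> * w y) (ennreal B * g)"
      by (simp add: potential_weight_def g_def B_def)
    show ?thesis
    proof (cases "ennreal B * g \<le> ennreal \<delta> * w y")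
      case True
      then have "w y epowr q * potential_weight \<delta> q \<sigma> w y epowr \<gamma> = ennreal (\<delta> powr \<gamma>) * w y epowr (\<gamma> + q)"
        unfolding W using \<delta> \<gamma> by (simp add: max_absorb1 epowr_mult epowr_ennreal epowr_add mult_ac)
      then show ?thesis by simp
    next
      case False
      then have F: "ennreal \<delta> * w y \<le> ennreal B * g" by simp
      then have "ennreal (1 / \<delta>) * (ennreal \<delta> * w y) \<le> ennreal (1 / \<delta>) * (ennreal B * g)"
        by (rule mult_left_mono) auto
      then have "w y \<le> ennreal (B / \<delta>) * g"
        using \<delta> B by (simp add: mult.assoc[symmetric] ennreal_mult[symmetric])
      then have "w y epowr q \<le> (ennreal (B / \<delta>) * g) epowr q"
        using q by (intro epowr_mono) auto
      then have "w y epowr q * (ennreal B * g) epowr \<gamma> \<le> (ennreal (B / \<delta>) * g) epowr q * (ennreal B * g) epowr \<gamma>"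
        by (rule mult_right_mono) auto
      also have "\<dots> = ennreal (absorb_const \<delta> \<gamma> q) * g epowr (\<gamma> + q)"
        using \<delta> B \<gamma> q by (simp add: epowr_mult epowr_ennreal epowr_add absorb_const_def B_def[symmetric] ennreal_mult mult_ac)
      finally have "w y epowr q * potential_weight \<delta> q \<sigma> w y epowr \<gamma>
          \<le> ennreal (absorb_const \<delta> \<gamma> q) * G \<sigma> y epowr ((\<gamma> + q) / (1 - q))"
        unfolding W gg using F by (simp add: max_absorb2)
      then show ?thesis by (rule order_trans) auto
    qed
  qed
  have "(\<integral>\<^sup>+y. potential_weight \<delta> q \<sigma> w y epowr \<gamma> \<partial>(density \<sigma> (\<lambda>y. w y epowr q)))
      = (\<integral>\<^sup>+y. w y epowr q * potential_weight \<delta> q \<sigma> w y epowr \<gamma> \<partial>\<sigma>)"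
    by (rule nn_integral_density) measurable
  also have "\<dots> \<le> (\<integral>\<^sup>+y. ennreal (\<delta> powr \<gamma>) * w y epowr (\<gamma> + q)
      + ennreal (absorb_const \<delta> \<gamma> q) * G \<sigma> y epowr ((\<gamma> + q) / (1 - q)) \<partial>\<sigma>)"
    by (intro nn_integral_mono pt)
  also have "\<dots> = ennreal (\<delta> powr \<gamma>) * (\<integral>\<^sup>+y. w y epowr (\<gamma> + q) \<partial>\<sigma>)
      + ennreal (absorb_const \<delta> \<gamma> q) * (\<integral>\<^sup>+y. G \<sigma> y epowr ((\<gamma> + q) / (1 - q)) \<partial>\<sigma>)"
    by (subst nn_integral_add, measurable, subst (1 2) nn_integral_cmult, measurable)
  finally show ?thesis .
qed

text \<open>The first factor comes from the power of a sum of \<open>M + 1\<close> potentials, the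
  second from summing over all pairs of measures, and the last from
  \<open>potential_comparison\<close> with \<open>C = 2 powr (N - \<alpha>)\<close>.\<close>

definition pair_const :: "real \<Rightarrow> nat \<Rightarrow> real" where
  "pair_const \<gamma> M = real (M + 1) powr \<gamma> * real (M + 1) * (1 + (2 * 2 powr (N - \<alpha>)) powr (\<gamma> + 1))"

text \<open>For this \<open>\<delta>\<close> the product
  \<open>pair_const \<gamma> M * \<delta> powr \<gamma>\<close> is \<open>1 / 2\<close>, so that
  half of the unknown integral can be absorbed.\<close>

definition small_const :: "real \<Rightarrow> nat \<Rightarrow> real" where
  "small_const \<gamma> M = (1 / (2 * pair_const \<gamma> M)) powr (1 / \<gamma>)"

lemma pair_const_pos: "0 < pair_const \<gamma> M"
  unfolding pair_const_def by (intro mult_pos_pos add_pos_nonneg) auto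

text \<open>Integrating a power of the equation produces mixed terms, with the potential of one
  measure integrated against another. The comparison lemma treats every ordered pair separately, and
  its right-hand side involves each measure only with its own weight.\<close>

lemma a_priori_bound:
  fixes \<sigma> :: "nat \<Rightarrow> 'a measure"
  assumes \<gamma>: "0 < \<gamma>" and q: "\<And>i. i \<in> {1..M} \<Longrightarrow> 0 < q i \<and> q i < 1"
    and \<sigma>: "\<And>i. i \<in> {1..M} \<Longrightarrow> sigma_finite_borel (\<sigma> i)" and \<omega>: "sigma_finite_borel \<omega>"
    and w [measurable]: "w \<in> borel_measurable borel"
    and \<sigma>w: "\<And>i. i \<in> {1..M} \<Longrightarrow> sigma_finite_borel (density (\<sigma> i) (\<lambda>y. w y epowr q i))"
    and sub: "\<And>x. w x \<le> (\<Sum>i = 1..M. G (density (\<sigma> i) (\<lambda>y. w y epowr q i)) x) + G \<omega> x"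
    and fin: "\<And>i. i \<in> {1..M} \<Longrightarrow> (\<integral>\<^sup>+y. w y epowr (\<gamma> + q i) \<partial>\<sigma> i) < \<infinity>"
  shows "(\<Sum>i = 1..M. \<integral>\<^sup>+y. w y epowr (\<gamma> + q i) \<partial>\<sigma> i) + (\<integral>\<^sup>+y. w y epowr \<gamma> \<partial>\<omega>)
    \<le> ennreal (2 * pair_const \<gamma> M) *
      ((\<Sum>i = 1..M. ennreal (absorb_const (small_const \<gamma> M) \<gamma> (q i)) *
          (\<integral>\<^sup>+y. G (\<sigma> i) y epowr ((\<gamma> + q i) / (1 - q i)) \<partial>\<sigma> i))
        + (\<integral>\<^sup>+y. G \<omega> y epowr \<gamma> \<partial>\<omega>))"
proof -
  let ?X = "\<Sum>i = 1..M. \<integral>\<^sup>+y. w y epowr (\<gamma> + q i) \<partial>\<sigma> i" and ?Y = "\<integral>\<^sup>+y. w y epowr \<gamma> \<partial>\<omega>"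
  let ?R = "(\<Sum>i = 1..M. ennreal (absorb_const (small_const \<gamma> M) \<gamma> (q i)) *
      (\<integral>\<^sup>+y. G (\<sigma> i) y epowr ((\<gamma> + q i) / (1 - q i)) \<partial>\<sigma> i)) + (\<integral>\<^sup>+y. G \<omega> y epowr \<gamma> \<partial>\<omega>)"
  define \<delta> where "\<delta> = small_const \<gamma> M"
  have \<delta>: "0 < \<delta>" using pair_const_pos[of \<gamma> M] by (simp add: \<delta>_def small_const_def)
  have \<delta>\<gamma>: "\<delta> powr \<gamma> = 1 / (2 * pair_const \<gamma> M)"
    using \<gamma> pair_const_pos[of \<gamma> M] by (simp add: \<delta>_def small_const_def powr_powr)
  \<comment> \<open>Index \<open>0\<close> carries \<open>\<omega>\<close>, whose admissible weight
    is its own potential, so that all \<open>M + 1\<close> measures are treated at once.\<close>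
  define \<nu> where "\<nu> i = (if i = 0 then \<omega> else density (\<sigma> i) (\<lambda>y. w y epowr q i))" for i
  define W where "W i = (if i = 0 then G \<omega> else potential_weight \<delta> (q i) (\<sigma> i) w)" for i
  define Z where "Z i = (\<integral>\<^sup>+y. W i y epowr \<gamma> \<partial>\<nu> i)" for i
  define C0 :: real where "C0 = 2 powr (N - \<alpha>)"
  define C1 where "C1 = (2 * C0) powr (\<gamma> + 1)"
  have \<nu>: "sigma_finite_borel (\<nu> i)" if "i \<in> {0..M}" for i
    using that \<omega> \<sigma>w by (auto simp: \<nu>_def)
  have Wm: "W i \<in> borel_measurable borel" if "i \<in> {0..M}" for i
    using that \<sigma> w measurable_potential[OF \<omega>] measurable_potential_weight by (auto simp: W_def)
  have level: "G (density (\<nu> i) (indicator {y. W i y \<le> ennreal s})) x \<le> ennreal (C0 * s)"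
    if "i \<in> {0..M}" "0 < s" for i s x
  proof (cases "i = 0")
    case True
    then show ?thesis
      using weak_maximum_principle_level[OF \<omega>, of "ennreal s" x] that
      by (simp add: \<nu>_def W_def C0_def ennreal_mult)
  next
    case False
    then show ?thesis
      using potential_weight_level[OF \<sigma> w _ _ \<delta> that(2), of i "q i" x] q[of i] that
      by (simp add: \<nu>_def W_def C0_def)
  qed
  have pair: "(\<integral>\<^sup>+x. G (\<nu> i) x epowr \<gamma> \<partial>\<nu> j) \<le> Z j + ennreal C1 * Z i" if "i \<in> {0..M}" "j \<in> {0..M}" for i j
    unfolding Z_def C1_def using that \<gamma>
    by (intro potential_comparison \<nu> Wm level) (auto simp: C0_def)
  have sub': "w x \<le> (\<Sum>i\<in>{0..M}. G (\<nu> i) x)" for x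
  proof -
    have "(\<Sum>i\<in>{0..M}. G (\<nu> i) x) = G (\<nu> 0) x + (\<Sum>i\<in>{1..M}. G (\<nu> i) x)"
      by (subst sum.atLeast_Suc_atMost) auto
    also have "\<dots> = (\<Sum>i = 1..M. G (density (\<sigma> i) (\<lambda>y. w y epowr q i)) x) + G \<omega> x"
      by (auto simp: \<nu>_def add.commute intro!: sum.cong)
    finally show ?thesis using sub[of x] by simp
  qed
  have each: "(\<integral>\<^sup>+x. w x epowr \<gamma> \<partial>\<nu> j) \<le> ennreal (real (M + 1) powr \<gamma>) * (\<Sum>i\<in>{0..M}. Z j + ennreal C1 * Z i)"
    if j: "j \<in> {0..M}" for j
  proof -
    note [measurable_cong] = sigma_finite_borelD(1)[OF \<nu>[OF j]]
    have "(\<integral>\<^sup>+x. w x epowr \<gamma> \<partial>\<nu> j) \<le> (\<integral>\<^sup>+x. ennreal (real (M + 1) powr \<gamma>) * (\<Sum>i\<in>{0..M}. G (\<nu> i) x epowr \<gamma>) \<partial>\<nu> j)"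
    proof (intro nn_integral_mono)
      fix x
      have "w x epowr \<gamma> \<le> (\<Sum>i\<in>{0..M}. G (\<nu> i) x) epowr \<gamma>"
        using \<gamma> sub' by (intro epowr_mono) auto
      also have "\<dots> \<le> ennreal (real (M + 1) powr \<gamma>) * (\<Sum>i\<in>{0..M}. G (\<nu> i) x epowr \<gamma>)"
        using epowr_sum_le[of "{0..M}" \<gamma> "\<lambda>i. G (\<nu> i) x"] \<gamma> by simp
      finally show "w x epowr \<gamma> \<le> ennreal (real (M + 1) powr \<gamma>) * (\<Sum>i\<in>{0..M}. G (\<nu> i) x epowr \<gamma>)" .
    qed
    also have "\<dots> = ennreal (real (M + 1) powr \<gamma>) * (\<Sum>i\<in>{0..M}. \<integral>\<^sup>+x. G (\<nu> i) x epowr \<gamma> \<partial>\<nu> j)"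
    proof -
      have m: "(\<lambda>x. G (\<nu> i) x epowr \<gamma>) \<in> borel_measurable (\<nu> j)" if "i \<in> {0..M}" for i
        using measurable_potential[OF \<nu>[OF that]] \<nu>[OF j] by (simp add: measurable_epowr)
      show ?thesis
        using m by (subst nn_integral_cmult)
          (auto intro!: borel_measurable_sum arg_cong2[where f = "(*)"] nn_integral_sum)
    qed
    also have "\<dots> \<le> ennreal (real (M + 1) powr \<gamma>) * (\<Sum>i\<in>{0..M}. Z j + ennreal C1 * Z i)"
      using pair j by (intro mult_left_mono sum_mono) auto
    finally show ?thesis .
  qed
  have lhs: "(\<Sum>j\<in>{0..M}. \<integral>\<^sup>+x. w x epowr \<gamma> \<partial>\<nu> j) = ?X + ?Y"
  proof -
    have "(\<integral>\<^sup>+x. w x epowr \<gamma> \<partial>\<nu> j) = (\<integral>\<^sup>+y. w y epowr (\<gamma> + q j) \<partial>\<sigma> j)" if "j \<in> {1..M}" for j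
    proof -
      note [measurable_cong] = sigma_finite_borelD(1)[OF \<sigma>[OF that]]
      have "(\<integral>\<^sup>+x. w x epowr \<gamma> \<partial>density (\<sigma> j) (\<lambda>y. w y epowr q j)) = (\<integral>\<^sup>+x. w x epowr q j * w x epowr \<gamma> \<partial>\<sigma> j)"
        by (rule nn_integral_density) measurable
      then show ?thesis using that by (simp add: \<nu>_def epowr_add mult.commute)
    qed
    then have "(\<Sum>j\<in>{1..M}. \<integral>\<^sup>+x. w x epowr \<gamma> \<partial>\<nu> j) = ?X"
      by (rule sum.cong[OF refl])
    moreover have "(\<Sum>j\<in>{0..M}. \<integral>\<^sup>+x. w x epowr \<gamma> \<partial>\<nu> j)
        = (\<integral>\<^sup>+x. w x epowr \<gamma> \<partial>\<nu> 0) + (\<Sum>j\<in>{1..M}. \<integral>\<^sup>+x. w x epowr \<gamma> \<partial>\<nu> j)"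
      by (subst sum.atLeast_Suc_atMost) auto
    moreover have "\<nu> 0 = \<omega>" by (simp add: \<nu>_def)
    ultimately show ?thesis
      by (simp only: add.commute)
  qed
  have Zsum: "(\<Sum>i\<in>{0..M}. Z i) \<le> ennreal (\<delta> powr \<gamma>) * ?X + ?R"
  proof -
    have "Z i \<le> ennreal (\<delta> powr \<gamma>) * (\<integral>\<^sup>+y. w y epowr (\<gamma> + q i) \<partial>\<sigma> i)
        + ennreal (absorb_const \<delta> \<gamma> (q i)) * (\<integral>\<^sup>+y. G (\<sigma> i) y epowr ((\<gamma> + q i) / (1 - q i)) \<partial>\<sigma> i)"
      if "i \<in> {1..M}" for i
      using potential_weight_integral[OF \<sigma> w _ _ \<delta> \<gamma>, of i "q i"] q[of i] that by (simp add: Z_def W_def \<nu>_def)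
    then have "(\<Sum>i\<in>{1..M}. Z i) \<le> (\<Sum>i\<in>{1..M}. ennreal (\<delta> powr \<gamma>) * (\<integral>\<^sup>+y. w y epowr (\<gamma> + q i) \<partial>\<sigma> i)
      + ennreal (absorb_const \<delta> \<gamma> (q i)) * (\<integral>\<^sup>+y. G (\<sigma> i) y epowr ((\<gamma> + q i) / (1 - q i)) \<partial>\<sigma> i))"
      by (rule sum_mono)
    moreover have "(\<Sum>i\<in>{0..M}. Z i) = (\<Sum>i\<in>{1..M}. Z i) + (\<integral>\<^sup>+y. G \<omega> y epowr \<gamma> \<partial>\<omega>)"
      by (subst sum.atLeast_Suc_atMost) (simp_all add: Z_def W_def \<nu>_def add.commute)
    ultimately show ?thesis
      unfolding \<delta>_def[symmetric]
      by (simp only: sum.distrib sum_distrib_left[symmetric] add.assoc[symmetric] add_right_mono)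
  qed
  have "?X + ?Y \<le> (\<Sum>j\<in>{0..M}. ennreal (real (M + 1) powr \<gamma>) * (\<Sum>i\<in>{0..M}. Z j + ennreal C1 * Z i))"
    unfolding lhs[symmetric] by (intro sum_mono each)
  also have "\<dots> = ennreal (pair_const \<gamma> M) * (\<Sum>i\<in>{0..M}. Z i)"
  proof -
    define S where "S = (\<Sum>i\<in>{0..M}. Z i)"
    have "(\<Sum>i\<in>{0..M}. Z j + ennreal C1 * Z i) = ennreal (real (M + 1)) * Z j + ennreal C1 * S" for j
      by (simp add: sum.distrib sum_distrib_left S_def ennreal_of_nat_eq_real_of_nat del: of_nat_Suc of_nat_add)
    then have "(\<Sum>j\<in>{0..M}. ennreal (real (M + 1) powr \<gamma>) * (\<Sum>i\<in>{0..M}. Z j + ennreal C1 * Z i))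
      = ennreal (real (M + 1) powr \<gamma>) * (ennreal (real (M + 1)) * S + ennreal (real (M + 1)) * (ennreal C1 * S))"
      by (simp add: sum.distrib sum_distrib_left[symmetric] S_def[symmetric] ennreal_of_nat_eq_real_of_nat del: of_nat_Suc of_nat_add)
    also have "\<dots> = ennreal (real (M + 1) powr \<gamma> * real (M + 1) * (1 + C1)) * S"
    proof -
      have "ennreal (real (M + 1)) * S + ennreal (real (M + 1)) * (ennreal C1 * S) = ennreal (real (M + 1)) * (ennreal (1 + C1) * S)"
        by (simp add: C1_def distrib_left distrib_right del: of_nat_Suc of_nat_add)
      then show ?thesis
        by (simp add: ennreal_mult mult.assoc C1_def del: of_nat_Suc of_nat_add ennreal_plus)
    qed
    finally show ?thesis
      unfolding S_def pair_const_def C1_def C0_def .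
  qed
  also have "\<dots> \<le> ennreal (pair_const \<gamma> M) * (ennreal (\<delta> powr \<gamma>) * ?X + ?R)"
    by (intro mult_left_mono Zsum) auto
  also have "\<dots> = ennreal (1 / 2) * ?X + ennreal (pair_const \<gamma> M) * ?R"
  proof -
    have "ennreal (pair_const \<gamma> M) * ennreal (\<delta> powr \<gamma>) = ennreal (1 / 2)"
      unfolding \<delta>\<gamma> using pair_const_pos[of \<gamma> M] by (subst ennreal_mult[symmetric]) auto
    then show ?thesis by (simp only: distrib_left mult.assoc[symmetric])
  qed
  \<comment> \<open>Half of \<open>?X\<close> is now moved to the left, which is legitimate because
    \<open>fin\<close> makes it finite.\<close>
  finally have main: "?X + ?Y \<le> ennreal (1 / 2) * ?X + ennreal (pair_const \<gamma> M) * ?R" .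
  have Xfin: "?X < \<infinity>" using fin by (simp add: ennreal_sum_less_top)
  have two: "ennreal (2 * pair_const \<gamma> M) * ?R = ennreal 2 * (ennreal (pair_const \<gamma> M) * ?R)"
    using pair_const_pos[of \<gamma> M] by (simp add: ennreal_mult mult.assoc)
  have "?X + ?Y \<le> ennreal 2 * (ennreal (pair_const \<gamma> M) * ?R)"
  proof -
    have "a + b \<le> ennreal 2 * d" if af: "a < \<infinity>" and abd: "a + b \<le> ennreal (1 / 2) * a + d" for a b d :: ennreal
    proof (cases d)
      case (real d')
      then have "b < \<infinity>"
        using af abd by (auto simp: less_top[symmetric] top_unique ennreal_mult_eq_top_iff)
      then obtain a' b' where ab: "0 \<le> a'" "0 \<le> b'" "a = ennreal a'" "b = ennreal b'"
        using af by (cases a; cases b) auto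
      have "ennreal (a' + b') \<le> ennreal (1 / 2 * a' + d')"
      proof -
        have "ennreal (1 / 2 * a' + d') = ennreal (1 / 2) * ennreal a' + ennreal d'"
          using ab real by (subst ennreal_plus) (auto simp: ennreal_mult'[symmetric] simp del: ennreal_half)
        then show ?thesis using abd ab real by simp
      qed
      then have "a' + b' \<le> 1 / 2 * a' + d'" using ab real by (subst (asm) ennreal_le_iff) auto
      then have "a' + b' \<le> 2 * d'" using ab by linarith
      then have "ennreal (a' + b') \<le> ennreal (2 * d')" by (rule ennreal_leI)
      then show ?thesis using ab real by (simp add: ennreal_mult')
    qed (auto simp: ennreal_mult_top)
    from this[OF Xfin main] show ?thesis .
  qed
  then show ?thesis unfolding two .
qed

end

section \<open>Construction of the minimal solution\<close>

lemma in_Lp_loc_AE_finite: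
  assumes \<mu>: "locally_finite_borel \<mu>" and f: "in_Lp_loc p \<mu> f"
  shows "AE x in \<mu>. f x < \<infinity>"
proof -
  have sets: "sets \<mu> = sets borel" using \<mu> by (simp add: locally_finite_borel_def)
  note [measurable_cong] = sets
  have [measurable]: "f \<in> borel_measurable \<mu>" using f by (simp add: in_Lp_loc_def)
  have "AE x in \<mu>. \<forall>m::nat. f x epowr p * indicator (cball 0 (real m)) x \<noteq> \<infinity>"
    unfolding AE_all_countable
  proof
    fix m :: nat
    have "(\<integral>\<^sup>+x. f x epowr p * indicator (cball 0 (real m)) x \<partial>\<mu>) \<noteq> \<infinity>"
      using f by (auto simp: in_Lp_loc_def less_top)
    then show "AE x in \<mu>. f x epowr p * indicator (cball 0 (real m)) x \<noteq> \<infinity>"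
      by (intro nn_integral_PInf_AE borel_measurable_times_ennreal borel_measurable_indicator) (auto simp: sets)
  qed
  then show ?thesis
  proof eventually_elim
    case (elim x)
    obtain m where "norm x \<le> real m" using real_arch_simple by blast
    then show ?case using elim[rule_format, of m] by (cases "f x") auto
  qed
qed

locale sublinear_problem = riesz \<alpha> N c ty
  for \<alpha> N c :: real and ty :: "'a::euclidean_space itself" +
  fixes M :: nat and q :: "nat \<Rightarrow> real" and \<sigma> :: "nat \<Rightarrow> 'a measure" and \<omega> :: "'a measure"
  assumes q: "i \<in> {1..M} \<Longrightarrow> 0 < q i \<and> q i < 1"
    and \<sigma>_lf: "i \<in> {1..M} \<Longrightarrow> locally_finite_borel (\<sigma> i)"
    and \<omega>_lf: "locally_finite_borel \<omega>"
    and nonzero: "\<not> ((\<forall>i\<in>{1..M}. \<sigma> i = null_measure borel) \<and> \<omega> = null_measure borel)"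
begin

lemma \<sigma>_sf: "i \<in> {1..M} \<Longrightarrow> sigma_finite_borel (\<sigma> i)"
  using \<sigma>_lf by (rule locally_finite_borel_sigma_finite)

lemma \<omega>_sf: "sigma_finite_borel \<omega>"
  using \<omega>_lf by (rule locally_finite_borel_sigma_finite)

lemma potential_operator_eq:
  assumes [measurable]: "u \<in> borel_measurable borel"
  shows "potential_operator \<alpha> M q \<sigma> \<omega> u x = (\<Sum>i = 1..M. G (density (\<sigma> i) (\<lambda>y. u y epowr q i)) x) + G \<omega> x"
  unfolding potential_operator_def riesz_potential_eq[OF \<omega>_sf]
  by (intro arg_cong2[where f = "(+)"] sum.cong refl riesz_potential_density \<sigma>_sf) auto

lemma nonzero_measure: "(\<exists>i\<in>{1..M}. emeasure (\<sigma> i) UNIV \<noteq> 0) \<or> emeasure \<omega> UNIV \<noteq> 0"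
proof -
  have "\<mu> = null_measure borel" if "sigma_finite_borel \<mu>" "emeasure \<mu> UNIV = 0" for \<mu> :: "'a measure"
  proof (rule measure_eqI)
    fix A assume "A \<in> sets \<mu>"
    then have "emeasure \<mu> A \<le> emeasure \<mu> UNIV"
      by (intro emeasure_mono) (auto simp: sigma_finite_borelD[OF that(1)])
    then show "emeasure \<mu> A = emeasure (null_measure borel) A" using that by simp
  qed (simp add: sigma_finite_borelD[OF that(1)])
  then show ?thesis using nonzero \<sigma>_sf \<omega>_sf by blast
qed

section \<open>Positivity and lower bounds of supersolutions\<close>

lemma supersolution_ge:
  assumes "is_supersolution \<alpha> M q \<sigma> \<omega> v"
  shows "v \<in> borel_measurable borel" "G \<omega> x \<le> v x"
    "i \<in> {1..M} \<Longrightarrow> G (density (\<sigma> i) (\<lambda>y. v y epowr q i)) x \<le> v x"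
    "(\<Sum>i = 1..M. G (density (\<sigma> i) (\<lambda>y. v y epowr q i)) x) + G \<omega> x \<le> v x"
proof -
  show v: "v \<in> borel_measurable borel" using assms by (simp add: is_supersolution_def)
  show *: "(\<Sum>i = 1..M. G (density (\<sigma> i) (\<lambda>y. v y epowr q i)) x) + G \<omega> x \<le> v x"
    using assms potential_operator_eq[OF v] by (simp add: is_supersolution_def)
  show "G \<omega> x \<le> v x"
    using * by (rule order_trans[rotated]) auto
  show "G (density (\<sigma> i) (\<lambda>y. v y epowr q i)) x \<le> v x" if "i \<in> {1..M}"
  proof -
    have "G (density (\<sigma> i) (\<lambda>y. v y epowr q i)) x \<le> (\<Sum>i = 1..M. G (density (\<sigma> i) (\<lambda>y. v y epowr q i)) x)"
      using that by (intro member_le_sum) auto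
    also have "\<dots> \<le> (\<Sum>i = 1..M. G (density (\<sigma> i) (\<lambda>y. v y epowr q i)) x) + G \<omega> x" by simp
    finally show ?thesis using * by (rule order_trans)
  qed
qed

text \<open>The kernel is positive everywhere, so one nonzero measure on the right-hand side
  suffices. If \<open>\<omega>\<close> vanishes, nontriviality provides an index \<open>i\<close>
  for which \<open>v\<close> is not \<open>\<sigma> i\<close>-almost everywhere zero.\<close>

lemma supersolution_pos:
  assumes v: "is_supersolution \<alpha> M q \<sigma> \<omega> v" and nt: "nontrivial M \<sigma> \<omega> v"
  shows "0 < v x"
proof (cases "emeasure \<omega> UNIV = 0")
  case False
  then show ?thesis
    using less_le_trans[OF potential_pos[OF \<omega>_sf False, of x] supersolution_ge(2)[OF v, of x]] by simp
next
  case True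
  have [measurable]: "v \<in> borel_measurable borel" by (rule supersolution_ge(1)[OF v])
  have "AE x in \<omega>. v x = 0"
    using True by (intro AE_I[of _ _ UNIV]) (auto simp: sigma_finite_borelD[OF \<omega>_sf])
  then obtain i where i: "i \<in> {1..M}" "\<not> (AE x in \<sigma> i. v x = 0)"
    using nt by (auto simp: nontrivial_def)
  note [measurable_cong] = sigma_finite_borelD(1)[OF \<sigma>_sf[OF i(1)]]
  have "G (density (\<sigma> i) (\<lambda>y. v y epowr q i)) x \<noteq> 0"
  proof
    assume "G (density (\<sigma> i) (\<lambda>y. v y epowr q i)) x = 0"
    then have "(\<integral>\<^sup>+y. v y epowr q i * k x y \<partial>\<sigma> i) = 0"
      by (simp add: potential_density sigma_finite_borelD(1)[OF \<sigma>_sf[OF i(1)]])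
    then have "AE y in \<sigma> i. v y epowr q i * k x y = 0"
      by (subst (asm) nn_integral_0_iff_AE) auto
    then have "AE y in \<sigma> i. v y = 0"
    proof eventually_elim
      case (elim y)
      then have "v y epowr q i = 0" using kernel_pos[of x y] by (auto simp: less_le)
      then show ?case using epowr_pos[of "v y" "q i"] by (auto simp: zero_less_iff_neq_zero)
    qed
    then show False using i(2) by simp
  qed
  then show ?thesis
    using supersolution_ge(3)[OF v i(1), of x] by (auto simp: zero_less_iff_neq_zero)
qed

lemma supersolution_ge_power:
  assumes v: "is_supersolution \<alpha> M q \<sigma> \<omega> v" and nt: "nontrivial M \<sigma> \<omega> v" and i: "i \<in> {1..M}"
  shows "ennreal (lower_const (q i)) * G (\<sigma> i) x epowr (1 / (1 - q i)) \<le> v x"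
proof (rule supersolution_lower_bound[OF \<sigma>_lf[OF i]])
  show "AE y in \<sigma> i. v y < \<infinity>"
    using v i by (intro in_Lp_loc_AE_finite \<sigma>_lf[OF i]) (auto simp: is_supersolution_def)
qed (use q[OF i] supersolution_ge[OF v] supersolution_pos[OF v nt] i in auto)

text \<open>The ball makes the mass finite and the level set makes the potential bounded on the
  whole space. Points where \<open>G \<mu>\<close> is infinite belong to no truncation, so the
  limits below require \<open>G \<mu>\<close> to be finite almost everywhere.\<close>

definition trunc_set :: "'a measure \<Rightarrow> nat \<Rightarrow> 'a set" where
  "trunc_set \<mu> m = {y. G \<mu> y \<le> ennreal (real m)} \<inter> cball 0 (real m)"

definition trunc :: "'a measure \<Rightarrow> nat \<Rightarrow> 'a measure" where
  "trunc \<mu> m = density \<mu> (indicator (trunc_set \<mu> m))"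

lemma trunc_set_borel [measurable]: "sigma_finite_borel \<mu> \<Longrightarrow> trunc_set \<mu> m \<in> sets borel"
  using measurable_potential[of \<mu> \<alpha>] unfolding trunc_set_def by measurable

lemma trunc_set_mono: "m \<le> m' \<Longrightarrow> trunc_set \<mu> m \<subseteq> trunc_set \<mu> m'"
  by (auto simp: trunc_set_def intro: order_trans ennreal_leI)

lemma trunc_finite:
  assumes \<mu>: "locally_finite_borel \<mu>"
  shows "sets (trunc \<mu> m) = sets borel" "emeasure (trunc \<mu> m) UNIV < \<infinity>" "sigma_finite_borel (trunc \<mu> m)"
proof -
  have sf: "sigma_finite_borel \<mu>" using \<mu> by (rule locally_finite_borel_sigma_finite)
  show *: "sets (trunc \<mu> m) = sets borel" by (simp add: trunc_def sigma_finite_borelD[OF sf])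
  have "emeasure (trunc \<mu> m) UNIV = emeasure \<mu> (trunc_set \<mu> m)"
    using trunc_set_borel[OF sf] emeasure_restricted[of "trunc_set \<mu> m" \<mu> UNIV]
    by (simp add: trunc_def sigma_finite_borelD[OF sf])
  also have "\<dots> \<le> emeasure \<mu> (cball 0 (real m))"
    by (intro emeasure_mono) (auto simp: trunc_set_def sigma_finite_borelD[OF sf])
  also have "\<dots> < \<infinity>" using \<mu> by (intro locally_finite_borel_compact) auto
  finally show "emeasure (trunc \<mu> m) UNIV < \<infinity>" .
  with * show "sigma_finite_borel (trunc \<mu> m)" by (rule sigma_finite_borel_finite)
qed

lemma density_trunc:
  assumes "sigma_finite_borel \<mu>" and [measurable]: "f \<in> borel_measurable borel"
  shows "density (trunc \<mu> m) f = density \<mu> (\<lambda>y. indicator (trunc_set \<mu> m) y * f y)"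
  unfolding trunc_def using trunc_set_borel[OF assms(1)] assms
  by (intro density_density_eq borel_measurable_indicator) (auto simp: sigma_finite_borelD)

lemma nn_integral_trunc:
  assumes "sigma_finite_borel \<mu>" "f \<in> borel_measurable borel"
  shows "(\<integral>\<^sup>+y. f y \<partial>trunc \<mu> m) = (\<integral>\<^sup>+y. indicator (trunc_set \<mu> m) y * f y \<partial>\<mu>)"
  unfolding trunc_def using assms trunc_set_borel[OF assms(1), of m]
  by (intro nn_integral_density borel_measurable_indicator) (auto simp: sigma_finite_borelD)

lemma potential_trunc_bounded:
  assumes \<mu>: "sigma_finite_borel \<mu>"
  shows "G (trunc \<mu> m) x \<le> ennreal (2 powr (N - \<alpha>) * real m)"
proof -
  note [measurable] = measurable_potential[OF \<mu>] trunc_set_borel[OF \<mu>]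
  have "G (trunc \<mu> m) x \<le> G (density \<mu> (indicator {y. G \<mu> y \<le> ennreal (real m)})) x"
    unfolding trunc_def using trunc_set_borel[OF \<mu>, of m]
    by (intro potential_mono_density[OF \<mu>] borel_measurable_indicator AE_I2)
      (auto simp: trunc_set_def split: split_indicator)
  also have "\<dots> \<le> ennreal (2 powr (N - \<alpha>)) * ennreal (real m)"
    by (rule weak_maximum_principle_level[OF \<mu>])
  finally show ?thesis by (simp add: ennreal_mult)
qed

lemma potential_trunc_mono:
  assumes \<mu>: "sigma_finite_borel \<mu>" and [measurable]: "f \<in> borel_measurable borel" and "m \<le> m'"
  shows "G (density (trunc \<mu> m) f) x \<le> G (density (trunc \<mu> m') f) x"
proof -
  note [measurable] = trunc_set_borel[OF \<mu>]
  show ?thesis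
    unfolding density_trunc[OF \<mu> assms(2)] using trunc_set_mono[OF assms(3)]
    by (intro potential_mono_density[OF \<mu>]) (auto split: split_indicator)
qed

lemma potential_trunc_le:
  assumes \<mu>: "sigma_finite_borel \<mu>" and [measurable]: "f \<in> borel_measurable borel"
  shows "G (density (trunc \<mu> m) f) x \<le> G (density \<mu> f) x"
proof -
  note [measurable] = trunc_set_borel[OF \<mu>]
  show ?thesis
    unfolding density_trunc[OF \<mu> assms(2)]
    by (intro potential_mono_density[OF \<mu>]) (auto split: split_indicator)
qed

section \<open>The truncated operator and the starting function\<close>

definition T :: "nat \<Rightarrow> ('a \<Rightarrow> ennreal) \<Rightarrow> 'a \<Rightarrow> ennreal" where
  "T m f x = (\<Sum>i = 1..M. G (density (trunc (\<sigma> i) m) (\<lambda>y. f y epowr q i)) x) + G (trunc \<omega> m) x"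

definition \<phi> :: "nat \<Rightarrow> 'a \<Rightarrow> ennreal" where
  "\<phi> m x = (\<Sum>i = 1..M. ennreal (lower_const (q i)) * G (trunc (\<sigma> i) m) x epowr (1 / (1 - q i)))"

lemma T_measurable [measurable]: "f \<in> borel_measurable borel \<Longrightarrow> T m f \<in> borel_measurable borel"
  unfolding T_def[abs_def]
  by (intro borel_measurable_add borel_measurable_sum measurable_potential_density measurable_potential
      trunc_finite \<sigma>_lf \<omega>_lf measurable_epowr)

lemma T_mono:
  assumes [measurable]: "f \<in> borel_measurable borel" "g \<in> borel_measurable borel" and "\<And>x. f x \<le> g x"
  shows "T m f x \<le> T m g x"
  unfolding T_def
proof (intro add_right_mono sum_mono potential_mono_density trunc_finite \<sigma>_lf AE_I2 epowr_mono assms)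
  show "0 \<le> q i" if "i \<in> {1..M}" for i using q[OF that] by simp
qed auto

lemma T_mono_trunc:
  assumes [measurable]: "f \<in> borel_measurable borel" and "m \<le> m'"
  shows "T m f x \<le> T m' f x"
  using potential_trunc_mono[OF \<omega>_sf, of "\<lambda>_. 1" m m' x] assms(2) unfolding T_def
  by (intro add_mono sum_mono potential_trunc_mono \<sigma>_sf) (auto simp: density_1)

text \<open>All truncated potentials are bounded, so boundedness passes from one iterate to the
  next. This provides the finiteness demanded by \<open>a_priori_bound\<close>.\<close>

lemma T_bounded:
  assumes [measurable]: "f \<in> borel_measurable borel" and b: "\<And>x. f x \<le> ennreal b" "0 \<le> b"
  shows "\<exists>b'\<ge>0. \<forall>x. T m f x \<le> ennreal b'"
proof -
  define B where "B = 2 powr (N - \<alpha>) * real m"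
  have B: "0 \<le> B" by (simp add: B_def)
  have "G (density (trunc (\<sigma> i) m) (\<lambda>y. f y epowr q i)) x \<le> ennreal (b powr q i * B)" if i: "i \<in> {1..M}" for i x
  proof -
    have "G (density (trunc (\<sigma> i) m) (\<lambda>y. f y epowr q i)) x \<le> G (density (trunc (\<sigma> i) m) (\<lambda>y. ennreal (b powr q i))) x"
    proof (intro potential_mono_density trunc_finite \<sigma>_lf[OF i] AE_I2)
      show "f y epowr q i \<le> ennreal (b powr q i)" for y
        using epowr_mono[OF _ b(1), of "q i" y] q[OF i] b(2) by (simp add: epowr_ennreal)
    qed auto
    also have "\<dots> = ennreal (b powr q i) * G (trunc (\<sigma> i) m) x"
    proof -
      note [measurable_cong] = trunc_finite(1)[OF \<sigma>_lf[OF i], of m]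
      show ?thesis
        by (subst potential_density[OF trunc_finite(1)[OF \<sigma>_lf[OF i]] borel_measurable_const])
          (simp add: nn_integral_cmult potential_def)
    qed
    also have "\<dots> \<le> ennreal (b powr q i) * ennreal B"
      unfolding B_def by (intro mult_left_mono potential_trunc_bounded \<sigma>_sf i) auto
    finally show ?thesis using B by (simp add: ennreal_mult)
  qed
  then have "T m f x \<le> (\<Sum>i = 1..M. ennreal (b powr q i * B)) + ennreal B" for x
    unfolding T_def using potential_trunc_bounded[OF \<omega>_sf, of m x]
    by (intro add_mono sum_mono) (auto simp: B_def)
  then have "T m f x \<le> ennreal ((\<Sum>i = 1..M. b powr q i * B) + B)" for x
    using B by (simp add: sum_ennreal sum_nonneg)
  then show ?thesis
    using B by (intro exI[of _ "(\<Sum>i = 1..M. b powr q i * B) + B"]) (auto intro!: add_nonneg_nonneg sum_nonneg)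
qed

lemma \<phi>_measurable [measurable]: "\<phi> m \<in> borel_measurable borel"
  unfolding \<phi>_def[abs_def]
  by (intro borel_measurable_sum borel_measurable_times_ennreal borel_measurable_const measurable_epowr
      measurable_potential trunc_finite \<sigma>_lf)

lemma \<phi>_bounded: "\<exists>b\<ge>0. \<forall>x. \<phi> m x \<le> ennreal b"
proof -
  define B where "B = 2 powr (N - \<alpha>) * real m"
  have B: "0 \<le> B" by (simp add: B_def)
  have "ennreal (lower_const (q i)) * G (trunc (\<sigma> i) m) x epowr (1 / (1 - q i)) \<le> ennreal (lower_const (q i) * B powr (1 / (1 - q i)))"
    if i: "i \<in> {1..M}" for i x
    using mult_left_mono[OF epowr_mono[OF _ potential_trunc_bounded[OF \<sigma>_sf[OF i], of m x]], of "1 / (1 - q i)" "ennreal (lower_const (q i))"]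
      q[OF i] lower_const_pos[of "q i"] by (simp add: epowr_ennreal B_def[symmetric] B ennreal_mult)
  then have "\<phi> m x \<le> (\<Sum>i = 1..M. ennreal (lower_const (q i) * B powr (1 / (1 - q i))))" for x
    unfolding \<phi>_def by (intro sum_mono)
  then have "\<phi> m x \<le> ennreal (\<Sum>i = 1..M. lower_const (q i) * B powr (1 / (1 - q i)))" for x
    using lower_const_pos by (simp add: sum_ennreal less_imp_le)
  then show ?thesis
    using lower_const_pos by (intro exI[of _ "\<Sum>i = 1..M. lower_const (q i) * B powr (1 / (1 - q i))"]) (auto intro!: sum_nonneg simp: less_imp_le)
qed

lemma \<phi>_mono: "m \<le> m' \<Longrightarrow> \<phi> m x \<le> \<phi> m' x"
  unfolding \<phi>_def
proof (intro sum_mono mult_left_mono epowr_mono)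
  fix i assume "m \<le> m'" and i: "i \<in> {1..M}"
  then show "G (trunc (\<sigma> i) m) x \<le> G (trunc (\<sigma> i) m') x"
    using potential_trunc_mono[OF \<sigma>_sf[OF i], of "\<lambda>_. 1" m m' x] by (simp add: density_1)
  show "0 \<le> 1 / (1 - q i)" using q[OF i] by simp
qed auto

lemma \<phi>_le_T: "\<phi> m x \<le> T m (\<phi> m) x"
proof -
  have "ennreal (lower_const (q i)) * G (trunc (\<sigma> i) m) x epowr (1 / (1 - q i))
      \<le> G (density (trunc (\<sigma> i) m) (\<lambda>y. \<phi> m y epowr q i)) x" if i: "i \<in> {1..M}" for i
  proof -
    note [measurable] = measurable_potential[OF trunc_finite(3)[OF \<sigma>_lf[OF i], of m]]
    have "ennreal (lower_const (q i)) * G (trunc (\<sigma> i) m) x epowr (1 / (1 - q i))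
      \<le> G (density (trunc (\<sigma> i) m) (\<lambda>y. (ennreal (lower_const (q i)) * G (trunc (\<sigma> i) m) y epowr (1 / (1 - q i))) epowr q i)) x"
      using q[OF i] by (intro subsolution trunc_finite \<sigma>_lf i) auto
    also have "\<dots> \<le> G (density (trunc (\<sigma> i) m) (\<lambda>y. \<phi> m y epowr q i)) x"
    proof (intro potential_mono_density trunc_finite \<sigma>_lf i AE_I2 epowr_mono)
      show "ennreal (lower_const (q i)) * G (trunc (\<sigma> i) m) y epowr (1 / (1 - q i)) \<le> \<phi> m y" for y
        unfolding \<phi>_def using i by (intro member_le_sum) auto
    qed (use q[OF i] in auto)
    finally show ?thesis .
  qed
  then have "\<phi> m x \<le> (\<Sum>i = 1..M. G (density (trunc (\<sigma> i) m) (\<lambda>y. \<phi> m y epowr q i)) x)"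
    unfolding \<phi>_def[of m x] by (intro sum_mono)
  also have "\<dots> \<le> T m (\<phi> m) x" by (simp add: T_def)
  finally show ?thesis .
qed

section \<open>Monotone iteration\<close>

definition iter :: "nat \<Rightarrow> nat \<Rightarrow> 'a \<Rightarrow> ennreal" where
  "iter m j = (T m ^^ j) (\<phi> m)"

lemma iter_simps: "iter m 0 = \<phi> m" "iter m (Suc j) = T m (iter m j)"
  by (simp_all add: iter_def)

lemma iter_measurable [measurable]: "iter m j \<in> borel_measurable borel"
  by (induction j) (auto simp: iter_simps)

lemma iter_bounded: "\<exists>b\<ge>0. \<forall>x. iter m j x \<le> ennreal b"
proof (induction j)
  case 0
  then show ?case using \<phi>_bounded by (simp add: iter_simps)
next
  case (Suc j)
  then show ?case using T_bounded[OF iter_measurable] unfolding iter_simps by blast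
qed

lemma iter_le_Suc: "iter m j x \<le> iter m (Suc j) x"
proof (induction j arbitrary: x)
  case 0
  then show ?case using \<phi>_le_T by (simp add: iter_simps)
next
  case (Suc j)
  then show ?case by (subst (1 2) iter_simps(2)) (intro T_mono, auto)
qed

lemma iter_le_trunc: "m \<le> m' \<Longrightarrow> iter m j x \<le> iter m' j x"
proof (induction j arbitrary: x)
  case 0
  then show ?case using \<phi>_mono by (simp add: iter_simps)
next
  case (Suc j)
  have "T m (iter m j) x \<le> T m (iter m' j) x"
    using Suc by (intro T_mono) auto
  also have "\<dots> \<le> T m' (iter m' j) x"
    using Suc by (intro T_mono_trunc) auto
  finally show ?case by (simp add: iter_simps)
qed

lemma iter_le_supersolution:
  assumes v: "is_supersolution \<alpha> M q \<sigma> \<omega> v" and nt: "nontrivial M \<sigma> \<omega> v"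
  shows "iter m j x \<le> v x"
proof (induction j arbitrary: x)
  case 0
  have [measurable]: "v \<in> borel_measurable borel" by (rule supersolution_ge(1)[OF v])
  \<comment> \<open>Bounding each summand of \<open>\<phi> m\<close> by \<open>v\<close> would lose
    a factor \<open>M\<close>. Each is instead bounded by its own term of the right-hand side, and
    these terms add up to at most \<open>v\<close>.\<close>
  have "ennreal (lower_const (q i)) * G (trunc (\<sigma> i) m) x epowr (1 / (1 - q i))
      \<le> G (density (\<sigma> i) (\<lambda>y. v y epowr q i)) x" if i: "i \<in> {1..M}" for i x
  proof -
    note [measurable] = measurable_potential[OF trunc_finite(3)[OF \<sigma>_lf[OF i], of m]]
    have "ennreal (lower_const (q i)) * G (trunc (\<sigma> i) m) x epowr (1 / (1 - q i))
      \<le> G (density (trunc (\<sigma> i) m) (\<lambda>y. (ennreal (lower_const (q i)) * G (trunc (\<sigma> i) m) y epowr (1 / (1 - q i))) epowr q i)) x"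
      using q[OF i] by (intro subsolution trunc_finite \<sigma>_lf i) auto
    also have "\<dots> \<le> G (density (trunc (\<sigma> i) m) (\<lambda>y. v y epowr q i)) x"
    proof (intro potential_mono_density trunc_finite \<sigma>_lf i AE_I2 epowr_mono)
      fix y
      have "ennreal (lower_const (q i)) * G (trunc (\<sigma> i) m) y epowr (1 / (1 - q i))
          \<le> ennreal (lower_const (q i)) * G (\<sigma> i) y epowr (1 / (1 - q i))"
        using potential_trunc_le[OF \<sigma>_sf[OF i], of "\<lambda>_. 1" m y] q[OF i]
        by (intro mult_left_mono epowr_mono) (auto simp: density_1)
      also have "\<dots> \<le> v y" by (rule supersolution_ge_power[OF v nt i])
      finally show "ennreal (lower_const (q i)) * G (trunc (\<sigma> i) m) y epowr (1 / (1 - q i)) \<le> v y" .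
    qed (use q[OF i] in auto)
    also have "\<dots> \<le> G (density (\<sigma> i) (\<lambda>y. v y epowr q i)) x"
      by (intro potential_trunc_le \<sigma>_sf i) auto
    finally show ?thesis .
  qed
  then have "\<phi> m x \<le> (\<Sum>i = 1..M. G (density (\<sigma> i) (\<lambda>y. v y epowr q i)) x)"
    unfolding \<phi>_def by (intro sum_mono)
  also have "\<dots> \<le> v x"
    by (rule order_trans[OF _ supersolution_ge(4)[OF v]]) auto
  finally show ?case by (simp add: iter_simps)
next
  case (Suc j)
  have [measurable]: "v \<in> borel_measurable borel" by (rule supersolution_ge(1)[OF v])
  have "T m (iter m j) x \<le> T m v x"
    using Suc by (intro T_mono) auto
  also have "\<dots> \<le> (\<Sum>i = 1..M. G (density (\<sigma> i) (\<lambda>y. v y epowr q i)) x) + G \<omega> x"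
    unfolding T_def using potential_trunc_le[OF \<omega>_sf, of "\<lambda>_. 1" m x]
    by (intro add_mono sum_mono potential_trunc_le \<sigma>_sf) (auto simp: density_1)
  also have "\<dots> \<le> v x" by (rule supersolution_ge(4)[OF v])
  finally show ?case by (simp add: iter_simps)
qed

text \<open>The truncation level and the number of steps grow together. The image under
  \<open>T m\<close> lies between consecutive members of the diagonal sequence, so both have the
  same limit and the equation passes to the limit.\<close>

lemma iter_diag_step: "iter m m x \<le> T m (iter m m) x" "T m (iter m m) x \<le> iter (Suc m) (Suc m) x"
  using iter_le_Suc[of m m x] iter_le_trunc[of m "Suc m" "Suc m" x] by (simp_all add: iter_simps)

lemma iter_diag_mono: "iter m m x \<le> iter (Suc m) (Suc m) x"
  using iter_diag_step order_trans by blast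

section \<open>The limit of the iterates\<close>

definition sol :: "'a \<Rightarrow> ennreal" where
  "sol x = (SUP m. iter m m x)"

lemma sol_measurable [measurable]: "sol \<in> borel_measurable borel"
  unfolding sol_def[abs_def] by measurable

lemma sol_LIMSEQ: "(\<lambda>m. iter m m x) \<longlonglongrightarrow> sol x"
  unfolding sol_def using iter_diag_mono by (intro LIMSEQ_SUP incseq_SucI)

lemma trunc_set_eventually:
  assumes "G \<mu> y < \<infinity>"
  shows "\<exists>m. \<forall>j\<ge>m. y \<in> trunc_set \<mu> j"
proof -
  obtain b where b: "0 \<le> b" "G \<mu> y = ennreal b" using assms by (cases "G \<mu> y") auto
  obtain m where m: "max b (norm y) \<le> real m" using real_arch_simple by blast
  then have "y \<in> trunc_set \<mu> m" using b by (auto simp: trunc_set_def intro: ennreal_leI)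
  then show ?thesis using trunc_set_mono by blast
qed

text \<open>The iterates and the truncated measures increase simultaneously. Moving the truncation
  into an indicator makes this ordinary monotone convergence for the fixed measure
  \<open>\<mu>\<close>.\<close>

lemma nn_integral_trunc_SUP:
  assumes \<mu>: "sigma_finite_borel \<mu>" and fin: "AE y in \<mu>. G \<mu> y < \<infinity>" and p: "0 < p"
    and [measurable]: "h \<in> borel_measurable borel"
  shows "(\<integral>\<^sup>+y. sol y epowr p * h y \<partial>\<mu>) = (SUP m. \<integral>\<^sup>+y. iter m m y epowr p * h y \<partial>trunc \<mu> m)"
    and "incseq (\<lambda>m. \<integral>\<^sup>+y. iter m m y epowr p * h y \<partial>trunc \<mu> m)"
proof -
  note [measurable_cong] = sigma_finite_borelD(1)[OF \<mu>]
  note [measurable] = trunc_set_borel[OF \<mu>]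
  have eq: "(\<integral>\<^sup>+y. iter m m y epowr p * h y \<partial>trunc \<mu> m)
      = (\<integral>\<^sup>+y. indicator (trunc_set \<mu> m) y * (iter m m y epowr p * h y) \<partial>\<mu>)" for m
    by (intro nn_integral_trunc \<mu>) measurable
  have mono: "indicator (trunc_set \<mu> m) y * (iter m m y epowr p * h y)
      \<le> indicator (trunc_set \<mu> (Suc m)) y * (iter (Suc m) (Suc m) y epowr p * h y)" for m y
    using trunc_set_mono[of m "Suc m" \<mu>] p
    by (intro mult_mono epowr_mono iter_diag_mono) (auto split: split_indicator)
  show "incseq (\<lambda>m. \<integral>\<^sup>+y. iter m m y epowr p * h y \<partial>trunc \<mu> m)"
    unfolding eq by (intro incseq_SucI nn_integral_mono mono)
  have "(\<integral>\<^sup>+y. sol y epowr p * h y \<partial>\<mu>)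
      = (\<integral>\<^sup>+y. (SUP m. indicator (trunc_set \<mu> m) y * (iter m m y epowr p * h y)) \<partial>\<mu>)"
  proof (intro nn_integral_cong_AE)
    show "AE y in \<mu>. sol y epowr p * h y = (SUP m. indicator (trunc_set \<mu> m) y * (iter m m y epowr p * h y))"
      using fin
    proof eventually_elim
      case (elim y)
      obtain m where m: "\<And>j. m \<le> j \<Longrightarrow> y \<in> trunc_set \<mu> j" using trunc_set_eventually[OF elim] by blast
      have "(SUP m. indicator (trunc_set \<mu> m) y * (iter m m y epowr p * h y)) = (SUP m. iter m m y epowr p * h y)"
        using m p by (intro SUP_indicator_mult mult_right_mono epowr_mono iter_diag_mono) auto
      then show ?case
        unfolding sol_def using p by (simp add: epowr_SUP SUP_mult_right_ennreal)
    qed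
  qed
  also have "\<dots> = (SUP m. \<integral>\<^sup>+y. indicator (trunc_set \<mu> m) y * (iter m m y epowr p * h y) \<partial>\<mu>)"
    by (intro nn_integral_monotone_convergence_SUP incseq_SucI le_funI mono) measurable
  finally show "(\<integral>\<^sup>+y. sol y epowr p * h y \<partial>\<mu>) = (SUP m. \<integral>\<^sup>+y. iter m m y epowr p * h y \<partial>trunc \<mu> m)"
    unfolding eq .
qed

lemma potential_trunc_LIMSEQ:
  assumes \<mu>: "sigma_finite_borel \<mu>" and fin: "AE y in \<mu>. G \<mu> y < \<infinity>"
  shows "(\<lambda>m. G (trunc \<mu> m) x) \<longlonglongrightarrow> G \<mu> x"
proof -
  note [measurable] = trunc_set_borel[OF \<mu>]
  have "G \<mu> x = G (density \<mu> (\<lambda>_. 1)) x" by (simp add: density_1)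
  also have "\<dots> = (SUP m. G (trunc \<mu> m) x)"
    unfolding trunc_def
  proof (rule potential_SUP[OF \<mu>])
    show "AE y in \<mu>. (SUP m. indicator (trunc_set \<mu> m) y) = (1::ennreal)"
      using fin
    proof eventually_elim
      case (elim y)
      obtain m where m: "\<And>j. m \<le> j \<Longrightarrow> y \<in> trunc_set \<mu> j" using trunc_set_eventually[OF elim] by blast
      show ?case
        using SUP_indicator_mult[of "\<lambda>_. 1" m y "trunc_set \<mu>"] m by simp
    qed
    show "indicator (trunc_set \<mu> m) y \<le> (indicator (trunc_set \<mu> (Suc m)) y :: ennreal)" for m y
      using trunc_set_mono[of m "Suc m" \<mu>] by (auto split: split_indicator)
  qed auto
  finally show ?thesis
    using potential_trunc_mono[OF \<mu>, of "\<lambda>_. 1" _ _ x]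
    by (simp add: density_1) (intro LIMSEQ_SUP incseq_SucI, auto)
qed

lemma sol_fixed_point:
  assumes fin: "\<And>i. i \<in> {1..M} \<Longrightarrow> AE y in \<sigma> i. G (\<sigma> i) y < \<infinity>" "AE y in \<omega>. G \<omega> y < \<infinity>"
  shows "sol x = (\<Sum>i = 1..M. G (density (\<sigma> i) (\<lambda>y. sol y epowr q i)) x) + G \<omega> x"
proof -
  have "(\<lambda>m. G (density (trunc (\<sigma> i) m) (\<lambda>y. iter m m y epowr q i)) x)
      \<longlonglongrightarrow> G (density (\<sigma> i) (\<lambda>y. sol y epowr q i)) x" if i: "i \<in> {1..M}" for i
  proof -
    have "(\<lambda>y. k x y) \<in> borel_measurable borel" by measurable
    from nn_integral_trunc_SUP[OF \<sigma>_sf[OF i] fin(1)[OF i] _ this] q[OF i]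
    show ?thesis
      by (subst potential_density, simp add: sigma_finite_borelD[OF \<sigma>_sf[OF i]], measurable,
          subst potential_density, simp add: trunc_finite[OF \<sigma>_lf[OF i]], measurable)
        (simp add: LIMSEQ_SUP)
  qed
  then have "(\<lambda>m. T m (iter m m) x) \<longlonglongrightarrow> (\<Sum>i = 1..M. G (density (\<sigma> i) (\<lambda>y. sol y epowr q i)) x) + G \<omega> x"
    unfolding T_def by (intro tendsto_add tendsto_sum potential_trunc_LIMSEQ \<omega>_sf fin)
  moreover have "(\<lambda>m. T m (iter m m) x) \<longlonglongrightarrow> sol x"
    using iter_diag_step
    by (intro tendsto_sandwich[OF _ _ sol_LIMSEQ LIMSEQ_Suc[OF sol_LIMSEQ]] always_eventually) auto
  ultimately show ?thesis by (rule LIMSEQ_unique[rotated])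
qed

text \<open>The a priori bound applies to the truncated problem, in which the iterates are bounded
  and the measures finite. Its right-hand side is dominated by \<open>R\<close>, formed with the
  full measures, so the bound survives the supremum over \<open>m\<close>.\<close>

lemma sol_integral_bound:
  assumes \<gamma>: "0 < \<gamma>"
    and A: "\<And>i. i \<in> {1..M} \<Longrightarrow> (\<integral>\<^sup>+y. G (\<sigma> i) y epowr ((\<gamma> + q i) / (1 - q i)) \<partial>\<sigma> i) < \<infinity>"
    and B: "(\<integral>\<^sup>+y. G \<omega> y epowr \<gamma> \<partial>\<omega>) < \<infinity>"
    and fin: "\<And>i. i \<in> {1..M} \<Longrightarrow> AE y in \<sigma> i. G (\<sigma> i) y < \<infinity>" "AE y in \<omega>. G \<omega> y < \<infinity>"
  shows "i \<in> {1..M} \<Longrightarrow> (\<integral>\<^sup>+y. sol y epowr (\<gamma> + q i) \<partial>\<sigma> i) < \<infinity>" "(\<integral>\<^sup>+y. sol y epowr \<gamma> \<partial>\<omega>) < \<infinity>"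
proof -
  define R where "R = ennreal (2 * pair_const \<gamma> M) *
      ((\<Sum>i = 1..M. ennreal (absorb_const (small_const \<gamma> M) \<gamma> (q i)) *
          (\<integral>\<^sup>+y. G (\<sigma> i) y epowr ((\<gamma> + q i) / (1 - q i)) \<partial>\<sigma> i))
        + (\<integral>\<^sup>+y. G \<omega> y epowr \<gamma> \<partial>\<omega>))"
  have R: "R < \<infinity>"
    using A B by (simp add: R_def ennreal_mult_less_top ennreal_sum_less_top)
  have le_trunc: "(\<integral>\<^sup>+y. G (trunc \<mu> m) y epowr p \<partial>trunc \<mu> m) \<le> (\<integral>\<^sup>+y. G \<mu> y epowr p \<partial>\<mu>)"
    if lf: "locally_finite_borel \<mu>" and p: "0 < p" for \<mu> p m
  proof -
    have sf: "sigma_finite_borel \<mu>" using lf by (rule locally_finite_borel_sigma_finite)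
    note [measurable_cong] = sigma_finite_borelD(1)[OF sf]
    note [measurable] = trunc_set_borel[OF sf] measurable_potential[OF trunc_finite(3)[OF lf, of m]]
    have "(\<integral>\<^sup>+y. G (trunc \<mu> m) y epowr p \<partial>trunc \<mu> m)
        = (\<integral>\<^sup>+y. indicator (trunc_set \<mu> m) y * G (trunc \<mu> m) y epowr p \<partial>\<mu>)"
      by (intro nn_integral_trunc sf) measurable
    also have "\<dots> \<le> (\<integral>\<^sup>+y. G \<mu> y epowr p \<partial>\<mu>)"
    proof (intro nn_integral_mono)
      fix y
      have "G (trunc \<mu> m) y epowr p \<le> G \<mu> y epowr p"
        using potential_trunc_le[OF sf, of "\<lambda>_. 1" m y] p by (intro epowr_mono) (auto simp: density_1)
      then show "indicator (trunc_set \<mu> m) y * G (trunc \<mu> m) y epowr p \<le> G \<mu> y epowr p"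
        by (auto split: split_indicator)
    qed
    finally show ?thesis .
  qed
  have bd: "(\<Sum>i = 1..M. \<integral>\<^sup>+y. iter m m y epowr (\<gamma> + q i) \<partial>trunc (\<sigma> i) m) + (\<integral>\<^sup>+y. iter m m y epowr \<gamma> \<partial>trunc \<omega> m) \<le> R" for m
  proof -
    obtain b where b: "0 \<le> b" "\<And>x. iter m m x \<le> ennreal b" using iter_bounded[of m m] by blast
    have fin_int: "(\<integral>\<^sup>+y. iter m m y epowr p \<partial>trunc (\<sigma> i) m) < \<infinity>" if i: "i \<in> {1..M}" and p: "0 < p" for i p
    proof -
      have "(\<integral>\<^sup>+y. iter m m y epowr p \<partial>trunc (\<sigma> i) m) \<le> (\<integral>\<^sup>+y. ennreal b epowr p \<partial>trunc (\<sigma> i) m)"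
        using b p by (intro nn_integral_mono epowr_mono) auto
      also have "\<dots> = ennreal b epowr p * emeasure (trunc (\<sigma> i) m) UNIV"
        by (simp add: sigma_finite_borelD[OF trunc_finite(3)[OF \<sigma>_lf[OF i]]])
      also have "\<dots> < \<infinity>"
        using trunc_finite(2)[OF \<sigma>_lf[OF i], of m] epowr_lt_top[of "ennreal b" p] by (simp add: ennreal_mult_less_top)
      finally show ?thesis .
    qed
    have "(\<Sum>i = 1..M. \<integral>\<^sup>+y. iter m m y epowr (\<gamma> + q i) \<partial>trunc (\<sigma> i) m) + (\<integral>\<^sup>+y. iter m m y epowr \<gamma> \<partial>trunc \<omega> m)
      \<le> ennreal (2 * pair_const \<gamma> M) *
        ((\<Sum>i = 1..M. ennreal (absorb_const (small_const \<gamma> M) \<gamma> (q i)) *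
          (\<integral>\<^sup>+y. G (trunc (\<sigma> i) m) y epowr ((\<gamma> + q i) / (1 - q i)) \<partial>trunc (\<sigma> i) m))
        + (\<integral>\<^sup>+y. G (trunc \<omega> m) y epowr \<gamma> \<partial>trunc \<omega> m))"
    proof (rule a_priori_bound)
      show "iter m m x \<le> (\<Sum>i = 1..M. G (density (trunc (\<sigma> i) m) (\<lambda>y. iter m m y epowr q i)) x) + G (trunc \<omega> m) x" for x
        using iter_diag_step(1)[of m x] by (simp add: T_def)
      show "(\<integral>\<^sup>+y. iter m m y epowr (\<gamma> + q i) \<partial>trunc (\<sigma> i) m) < \<infinity>" if "i \<in> {1..M}" for i
        using fin_int[OF that] q[OF that] \<gamma> by simp
      show "sigma_finite_borel (density (trunc (\<sigma> i) m) (\<lambda>y. iter m m y epowr q i))" if i: "i \<in> {1..M}" for i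
      proof (rule sigma_finite_borel_finite)
        note [measurable_cong] = trunc_finite(1)[OF \<sigma>_lf[OF i], of m]
        show "sets (density (trunc (\<sigma> i) m) (\<lambda>y. iter m m y epowr q i)) = sets borel"
          by (simp add: trunc_finite[OF \<sigma>_lf[OF i]])
        have "emeasure (density (trunc (\<sigma> i) m) (\<lambda>y. iter m m y epowr q i)) UNIV = (\<integral>\<^sup>+y. iter m m y epowr q i \<partial>trunc (\<sigma> i) m)"
          by (subst emeasure_density) (auto simp: trunc_finite[OF \<sigma>_lf[OF i]])
        then show "emeasure (density (trunc (\<sigma> i) m) (\<lambda>y. iter m m y epowr q i)) UNIV < \<infinity>"
          using fin_int[OF i] q[OF i] by simp
      qed
    qed (use \<gamma> q trunc_finite(3) \<sigma>_lf \<omega>_lf in auto)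
    also have "\<dots> \<le> R"
      unfolding R_def
    proof (intro mult_left_mono add_mono sum_mono le_trunc \<omega>_lf \<sigma>_lf \<gamma>)
      show "0 < (\<gamma> + q i) / (1 - q i)" if "i \<in> {1..M}" for i using q[OF that] \<gamma> by simp
    qed auto
    finally show ?thesis .
  qed
  show "(\<integral>\<^sup>+y. sol y epowr (\<gamma> + q i) \<partial>\<sigma> i) < \<infinity>" if i: "i \<in> {1..M}"
  proof -
    have "(\<integral>\<^sup>+y. sol y epowr (\<gamma> + q i) \<partial>\<sigma> i) = (SUP m. \<integral>\<^sup>+y. iter m m y epowr (\<gamma> + q i) \<partial>trunc (\<sigma> i) m)"
      using nn_integral_trunc_SUP(1)[OF \<sigma>_sf[OF i] fin(1)[OF i], of "\<gamma> + q i" "\<lambda>_. 1"] q[OF i] \<gamma> by simp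
    also have "\<dots> \<le> R"
    proof (rule SUP_least)
      fix m
      have "(\<integral>\<^sup>+y. iter m m y epowr (\<gamma> + q i) \<partial>trunc (\<sigma> i) m) \<le> (\<Sum>i = 1..M. \<integral>\<^sup>+y. iter m m y epowr (\<gamma> + q i) \<partial>trunc (\<sigma> i) m)"
        using i by (intro member_le_sum) auto
      also have "\<dots> \<le> R" by (rule order_trans[OF _ bd[of m]]) simp
      finally show "(\<integral>\<^sup>+y. iter m m y epowr (\<gamma> + q i) \<partial>trunc (\<sigma> i) m) \<le> R" .
    qed
    finally show ?thesis using R by (rule le_less_trans)
  qed
  have "(\<integral>\<^sup>+y. sol y epowr \<gamma> \<partial>\<omega>) = (SUP m. \<integral>\<^sup>+y. iter m m y epowr \<gamma> \<partial>trunc \<omega> m)"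
    using nn_integral_trunc_SUP(1)[OF \<omega>_sf fin(2), of \<gamma> "\<lambda>_. 1"] \<gamma> by simp
  also have "\<dots> \<le> R"
  proof (rule SUP_least)
    show "(\<integral>\<^sup>+y. iter m m y epowr \<gamma> \<partial>trunc \<omega> m) \<le> R" for m
      by (rule order_trans[OF _ bd[of m]]) simp
  qed
  finally show "(\<integral>\<^sup>+y. sol y epowr \<gamma> \<partial>\<omega>) < \<infinity>" using R by (rule le_less_trans)
qed

end

section \<open>Finite energy solutions and uniqueness\<close>

definition measure_sum :: "'i set \<Rightarrow> ('i \<Rightarrow> 'a::euclidean_space measure) \<Rightarrow> 'a measure" where
  "measure_sum I \<mu> = measure_of UNIV (sets borel) (\<lambda>A. \<Sum>i\<in>I. emeasure (\<mu> i) A)"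

lemma sets_measure_sum [simp]: "sets (measure_sum I \<mu>) = sets borel"
  unfolding measure_sum_def using sets.sigma_sets_eq[of borel] by (subst sets_measure_of) auto

lemma emeasure_measure_sum:
  assumes "finite I" "\<And>i. i \<in> I \<Longrightarrow> sets (\<mu> i) = sets borel" "A \<in> sets borel"
  shows "emeasure (measure_sum I \<mu>) A = (\<Sum>i\<in>I. emeasure (\<mu> i) A)"
proof (rule emeasure_measure_of[OF measure_sum_def])
  show "countably_additive (sets (measure_sum I \<mu>)) (\<lambda>A. \<Sum>i\<in>I. emeasure (\<mu> i) A)"
    unfolding countably_additive_def
  proof (intro allI impI)
    fix A :: "nat \<Rightarrow> 'b set"
    assume A: "range A \<subseteq> sets (measure_sum I \<mu>)" "disjoint_family A"
    have "(\<Sum>n. \<Sum>i\<in>I. emeasure (\<mu> i) (A n)) = (\<Sum>i\<in>I. \<Sum>n. emeasure (\<mu> i) (A n))"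
      by (rule suminf_sum) auto
    also have "\<dots> = (\<Sum>i\<in>I. emeasure (\<mu> i) (\<Union>n. A n))"
      using A assms(2) by (intro sum.cong suminf_emeasure) auto
    finally show "(\<Sum>n. \<Sum>i\<in>I. emeasure (\<mu> i) (A n)) = (\<Sum>i\<in>I. emeasure (\<mu> i) (\<Union>n. A n))" .
  qed
qed (use assms(3) in \<open>auto simp: positive_def\<close>)

lemma nn_integral_measure_sum:
  assumes I: "finite I" "\<And>i. i \<in> I \<Longrightarrow> sets (\<mu> i) = sets borel" and f: "f \<in> borel_measurable borel"
  shows "(\<integral>\<^sup>+x. f x \<partial>measure_sum I \<mu>) = (\<Sum>i\<in>I. \<integral>\<^sup>+x. f x \<partial>\<mu> i)"
proof -
  have meas: "borel_measurable (measure_sum I \<mu>) = (borel_measurable borel :: (_ \<Rightarrow> ennreal) set)"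
    by (intro measurable_cong_sets) auto
  have meas_i: "borel_measurable (\<mu> i) = (borel_measurable borel :: (_ \<Rightarrow> ennreal) set)" if "i \<in> I" for i
    using I that by (intro measurable_cong_sets) auto
  show ?thesis
    using f
  proof (induction rule: borel_measurable_induct)
    case (cong f g)
    then show ?case by simp
  next
    case (set A)
    then show ?case
      using I by (simp add: emeasure_measure_sum)
  next
    case (mult u c)
    then show ?case
      by (simp add: nn_integral_cmult meas meas_i sum_distrib_left)
  next
    case (add u v)
    then show ?case
      by (simp add: nn_integral_add meas meas_i sum.distrib)
  next
    case (seq U)
    have U: "U j \<in> borel_measurable (measure_sum I \<mu>)" for j using seq by (simp add: meas)
    have "(\<integral>\<^sup>+x. (SUP j. U j x) \<partial>measure_sum I \<mu>) = (SUP j. \<integral>\<^sup>+x. U j x \<partial>measure_sum I \<mu>)"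
      using seq U by (intro nn_integral_monotone_convergence_SUP) auto
    also have "\<dots> = (SUP j. \<Sum>i\<in>I. \<integral>\<^sup>+x. U j x \<partial>\<mu> i)"
      using seq by simp
    also have "\<dots> = (\<Sum>i\<in>I. SUP j. \<integral>\<^sup>+x. U j x \<partial>\<mu> i)"
    proof (rule LIMSEQ_unique)
      have inc: "incseq (\<lambda>j. \<integral>\<^sup>+x. U j x \<partial>\<mu> i)" for i
        using seq(3) by (auto simp: incseq_def le_fun_def intro!: nn_integral_mono)
      then show "(\<lambda>j. \<Sum>i\<in>I. \<integral>\<^sup>+x. U j x \<partial>\<mu> i) \<longlonglongrightarrow> (SUP j. \<Sum>i\<in>I. \<integral>\<^sup>+x. U j x \<partial>\<mu> i)"
        by (intro LIMSEQ_SUP) (auto simp: incseq_def intro!: sum_mono)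
      show "(\<lambda>j. \<Sum>i\<in>I. \<integral>\<^sup>+x. U j x \<partial>\<mu> i) \<longlonglongrightarrow> (\<Sum>i\<in>I. SUP j. \<integral>\<^sup>+x. U j x \<partial>\<mu> i)"
        using inc by (intro tendsto_sum LIMSEQ_SUP)
    qed
    also have "\<dots> = (\<Sum>i\<in>I. \<integral>\<^sup>+x. (SUP j. U j x) \<partial>\<mu> i)"
    proof (intro sum.cong refl nn_integral_monotone_convergence_SUP[symmetric] seq)
      show "U j \<in> borel_measurable (\<mu> i)" if "i \<in> I" for i j using seq(1) meas_i[OF that] by simp
    qed
    finally show ?case by (simp add: image_comp)
  qed
qed

text \<open>Turns integrability of \<open>sol epowr (\<gamma> + q i)\<close> into local
  integrability of \<open>sol epowr q i\<close>, since compact sets have finite measure.\<close>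

lemma epowr_le_one_plus: "0 < p \<Longrightarrow> 0 < \<gamma> \<Longrightarrow> x epowr p \<le> 1 + x epowr (\<gamma> + p)"
proof (cases x)
  case (real r)
  assume p: "0 < p" "0 < \<gamma>"
  have "r powr p \<le> 1 + r powr (\<gamma> + p)"
  proof (cases "r \<le> 1")
    case True
    then have "r powr p \<le> 1" using p real by (simp add: powr_le1)
    then show ?thesis by (simp add: add_increasing2)
  next
    case False
    then have "r powr p \<le> r powr (\<gamma> + p)" using p by (intro powr_mono) auto
    then show ?thesis by simp
  qed
  then show ?thesis
    using real by (simp add: epowr_ennreal ennreal_leI flip: ennreal_1 ennreal_plus)
qed simp

context sublinear_problem
begin

text \<open>The right-hand side of the equation as one measure, with \<open>\<omega>\<close> at
  index \<open>0\<close>. Solutions are then exactly potentials of their own measure, and the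
  results on a single potential apply.\<close>

definition total :: "('a \<Rightarrow> ennreal) \<Rightarrow> 'a measure" where
  "total u = measure_sum {0..M} (\<lambda>i. if i = 0 then \<omega> else density (\<sigma> i) (\<lambda>y. u y epowr q i))"

lemma nn_integral_total:
  assumes [measurable]: "u \<in> borel_measurable borel" "f \<in> borel_measurable borel"
  shows "(\<integral>\<^sup>+x. f x \<partial>total u) = (\<Sum>i = 1..M. \<integral>\<^sup>+x. u x epowr q i * f x \<partial>\<sigma> i) + (\<integral>\<^sup>+x. f x \<partial>\<omega>)"
proof -
  define \<nu> where "\<nu> i = (if i = 0 then \<omega> else density (\<sigma> i) (\<lambda>y. u y epowr q i))" for i
  have "sets (\<nu> i) = sets borel" if "i \<in> {0..M}" for i
    using that sigma_finite_borelD(1)[OF \<sigma>_sf] sigma_finite_borelD(1)[OF \<omega>_sf] by (auto simp: \<nu>_def)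
  then have "(\<integral>\<^sup>+x. f x \<partial>total u) = (\<Sum>i\<in>{0..M}. \<integral>\<^sup>+x. f x \<partial>\<nu> i)"
    unfolding total_def \<nu>_def[symmetric] by (intro nn_integral_measure_sum) auto
  also have "\<dots> = (\<integral>\<^sup>+x. f x \<partial>\<nu> 0) + (\<Sum>i\<in>{1..M}. \<integral>\<^sup>+x. f x \<partial>\<nu> i)"
    by (subst sum.atLeast_Suc_atMost) auto
  also have "(\<Sum>i\<in>{1..M}. \<integral>\<^sup>+x. f x \<partial>\<nu> i) = (\<Sum>i = 1..M. \<integral>\<^sup>+x. u x epowr q i * f x \<partial>\<sigma> i)"
  proof (rule sum.cong[OF refl])
    fix i assume i: "i \<in> {1..M}"
    note [measurable_cong] = sigma_finite_borelD(1)[OF \<sigma>_sf[OF i]]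
    have "(\<integral>\<^sup>+x. f x \<partial>density (\<sigma> i) (\<lambda>y. u y epowr q i)) = (\<integral>\<^sup>+x. u x epowr q i * f x \<partial>\<sigma> i)"
      by (rule nn_integral_density) measurable
    then show "(\<integral>\<^sup>+x. f x \<partial>\<nu> i) = (\<integral>\<^sup>+x. u x epowr q i * f x \<partial>\<sigma> i)"
      using i by (simp add: \<nu>_def)
  qed
  finally show ?thesis by (simp add: \<nu>_def add.commute)
qed

lemma potential_total:
  assumes [measurable]: "u \<in> borel_measurable borel"
  shows "G (total u) x = (\<Sum>i = 1..M. G (density (\<sigma> i) (\<lambda>y. u y epowr q i)) x) + G \<omega> x"
proof -
  have "(\<lambda>y. k x y) \<in> borel_measurable borel"
    by measurable
  from nn_integral_total[OF assms this]
  have "G (total u) x = (\<Sum>i = 1..M. \<integral>\<^sup>+y. u y epowr q i * k x y \<partial>\<sigma> i) + G \<omega> x"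
    by (simp only: potential_def)
  also have "(\<Sum>i = 1..M. \<integral>\<^sup>+y. u y epowr q i * k x y \<partial>\<sigma> i)
      = (\<Sum>i = 1..M. G (density (\<sigma> i) (\<lambda>y. u y epowr q i)) x)"
    by (intro sum.cong refl potential_density[symmetric] sigma_finite_borelD(1) \<sigma>_sf) measurable
  finally show ?thesis .
qed

lemma solution_eq_potential:
  assumes "is_solution \<alpha> M q \<sigma> \<omega> u"
  shows "G (total u) = u"
proof
  fix x
  have u: "u \<in> borel_measurable borel" "u x = potential_operator \<alpha> M q \<sigma> \<omega> u x"
    using assms unfolding is_solution_def by blast+
  show "G (total u) x = u x"
    using u(2) unfolding potential_operator_eq[OF u(1)] potential_total[OF u(1)] by (rule sym)
qed

lemma total_finite_on_balls:
  assumes u: "u \<in> borel_measurable borel" and loc: "\<And>i. i \<in> {1..M} \<Longrightarrow> in_Lp_loc (q i) (\<sigma> i) u"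
  shows "sets (total u) = sets borel" "emeasure (total u) (cball 0 (real m)) < \<infinity>" "sigma_finite_borel (total u)"
proof -
  show sets: "sets (total u) = sets borel" by (simp add: total_def)
  have fin: "emeasure (total u) (cball 0 (real m)) < \<infinity>" for m
  proof -
    have "emeasure (total u) (cball 0 (real m)) = (\<integral>\<^sup>+x. indicator (cball 0 (real m)) x \<partial>total u)"
      by (subst nn_integral_indicator) (auto simp: sets)
    also have "\<dots> = (\<Sum>i = 1..M. \<integral>\<^sup>+x. u x epowr q i * indicator (cball 0 (real m)) x \<partial>\<sigma> i)
        + emeasure \<omega> (cball 0 (real m))"
      by (subst nn_integral_total[OF u borel_measurable_indicator]) (auto simp: sigma_finite_borelD(1)[OF \<omega>_sf])
    also have "\<dots> < \<infinity>"
      using loc locally_finite_borel_compact[OF \<omega>_lf, of "cball 0 (real m)"]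
      by (auto simp: in_Lp_loc_def ennreal_sum_less_top)
    finally show ?thesis .
  qed
  then show "emeasure (total u) (cball 0 (real m)) < \<infinity>" .
  show "sigma_finite_borel (total u)" by (rule sigma_finite_borelI[OF sets fin])
qed

lemma solution_total:
  assumes "is_solution \<alpha> M q \<sigma> \<omega> u"
  shows "sets (total u) = sets borel" "emeasure (total u) (cball 0 (real m)) < \<infinity>" "sigma_finite_borel (total u)"
proof -
  have u: "u \<in> borel_measurable borel" "\<And>i. i \<in> {1..M} \<Longrightarrow> in_Lp_loc (q i) (\<sigma> i) u"
    using assms unfolding is_solution_def by blast+
  show "sets (total u) = sets borel" using u by (rule total_finite_on_balls(1))
  show "emeasure (total u) (cball 0 (real m)) < \<infinity>" using u by (rule total_finite_on_balls(2))
  show "sigma_finite_borel (total u)" using u by (rule total_finite_on_balls(3))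
qed

lemma solution_imp_supersolution: "is_solution \<alpha> M q \<sigma> \<omega> u \<Longrightarrow> is_supersolution \<alpha> M q \<sigma> \<omega> u"
  by (simp add: is_solution_def is_supersolution_def)

lemma nontrivial_of_pos:
  assumes "\<And>x. 0 < u x"
  shows "nontrivial M \<sigma> \<omega> u"
proof (rule ccontr)
  assume "\<not> ?thesis"
  then have *: "\<And>i. i \<in> {1..M} \<Longrightarrow> AE x in \<sigma> i. u x = 0" "AE x in \<omega>. u x = 0"
    by (auto simp: nontrivial_def)
  have "emeasure \<mu> UNIV = 0" if "sigma_finite_borel \<mu>" "AE x in \<mu>. u x = 0" for \<mu>
  proof (rule AE_False_imp_null[OF that(1)])
    show "AE x in \<mu>. False"
      using that(2) by eventually_elim (use assms in \<open>auto simp: less_le\<close>)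
  qed
  then show False
    using nonzero_measure * \<sigma>_sf \<omega>_sf by blast
qed

section \<open>Existence, integrability and finite energy\<close>

lemma cond_A_iff:
  "cond_A \<alpha> M q \<sigma> \<gamma> \<longleftrightarrow> (\<forall>i\<in>{1..M}. (\<integral>\<^sup>+y. G (\<sigma> i) y epowr ((\<gamma> + q i) / (1 - q i)) \<partial>\<sigma> i) < \<infinity>)"
  using measurable_potential[OF \<sigma>_sf]
  by (auto simp: cond_A_def in_Lp_def riesz_potential_eq \<sigma>_sf)

lemma cond_B_iff: "cond_B \<alpha> \<omega> \<gamma> \<longleftrightarrow> (\<integral>\<^sup>+y. G \<omega> y epowr \<gamma> \<partial>\<omega>) < \<infinity>"
  using measurable_potential[OF \<omega>_sf]
  by (auto simp: cond_B_def in_Lp_def riesz_potential_eq \<omega>_sf)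

lemma AE_finite_of_Lp:
  assumes \<mu>: "sigma_finite_borel \<mu>" and "(\<integral>\<^sup>+y. G \<mu> y epowr p \<partial>\<mu>) < \<infinity>"
  shows "AE y in \<mu>. G \<mu> y < \<infinity>"
proof -
  note [measurable_cong] = sigma_finite_borelD(1)[OF \<mu>]
  note [measurable] = measurable_potential[OF \<mu>]
  have "AE y in \<mu>. G \<mu> y epowr p \<noteq> \<infinity>"
    using assms(2) by (intro nn_integral_PInf_AE) (auto simp: less_top)
  then show ?thesis
    by eventually_elim (auto simp: less_top[symmetric])
qed

lemma iter_le_sol: "iter m j x \<le> sol x"
proof -
  have inc: "incseq (\<lambda>j. iter m j x)" for m using iter_le_Suc by (intro incseq_SucI)
  have "iter m j x \<le> iter m (max m j) x" by (rule incseqD[OF inc]) simp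
  also have "\<dots> \<le> iter (max m j) (max m j) x" by (rule iter_le_trunc) simp
  also have "\<dots> \<le> sol x" unfolding sol_def by (rule SUP_upper) simp
  finally show ?thesis .
qed

lemma minimal_solution:
  assumes \<gamma>: "0 < \<gamma>" and A: "cond_A \<alpha> M q \<sigma> \<gamma>" and B: "cond_B \<alpha> \<omega> \<gamma>"
  shows "0 < sol x" "is_minimal_solution \<alpha> M q \<sigma> \<omega> sol" "(\<integral>\<^sup>+x. sol x epowr \<gamma> \<partial>total sol) < \<infinity>"
proof -
  have A': "(\<integral>\<^sup>+y. G (\<sigma> i) y epowr ((\<gamma> + q i) / (1 - q i)) \<partial>\<sigma> i) < \<infinity>" if "i \<in> {1..M}" for i
    using A that by (simp add: cond_A_iff)
  have B': "(\<integral>\<^sup>+y. G \<omega> y epowr \<gamma> \<partial>\<omega>) < \<infinity>"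
    using B by (simp add: cond_B_iff)
  have finA: "AE y in \<sigma> i. G (\<sigma> i) y < \<infinity>" if "i \<in> {1..M}" for i
    using A'[OF that] by (rule AE_finite_of_Lp[OF \<sigma>_sf[OF that]])
  have finB: "AE y in \<omega>. G \<omega> y < \<infinity>"
    using B' by (rule AE_finite_of_Lp[OF \<omega>_sf])
  have bnd: "(\<integral>\<^sup>+y. sol y epowr (\<gamma> + q i) \<partial>\<sigma> i) < \<infinity>" if "i \<in> {1..M}" for i
    using \<gamma> A' B' finA finB that by (rule sol_integral_bound(1))
  have bnd\<omega>: "(\<integral>\<^sup>+y. sol y epowr \<gamma> \<partial>\<omega>) < \<infinity>"
    using \<gamma> A' B' finA finB by (rule sol_integral_bound(2))
  have fixp: "sol x = (\<Sum>i = 1..M. G (density (\<sigma> i) (\<lambda>y. sol y epowr q i)) x) + G \<omega> x" for x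
    using finA finB by (rule sol_fixed_point)
  have loc: "in_Lp_loc (q i) (\<sigma> i) sol" if i: "i \<in> {1..M}" for i
    unfolding in_Lp_loc_def
  proof (intro conjI allI impI)
    note [measurable_cong] = sigma_finite_borelD(1)[OF \<sigma>_sf[OF i]]
    show "sol \<in> borel_measurable (\<sigma> i)" by measurable
    fix K :: "'a set" assume K: "compact K"
    then have [measurable]: "K \<in> sets borel" by (rule borel_compact)
    have "(\<integral>\<^sup>+x\<in>K. sol x epowr q i \<partial>\<sigma> i) \<le> (\<integral>\<^sup>+x. indicator K x + sol x epowr (\<gamma> + q i) \<partial>\<sigma> i)"
      using epowr_le_one_plus[of "q i" \<gamma>] q[OF i] \<gamma> by (intro nn_integral_mono) (auto split: split_indicator)
    also have "\<dots> = emeasure (\<sigma> i) K + (\<integral>\<^sup>+x. sol x epowr (\<gamma> + q i) \<partial>\<sigma> i)"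
      by (subst nn_integral_add) (auto simp: sigma_finite_borelD(1)[OF \<sigma>_sf[OF i]])
    also have "\<dots> < \<infinity>"
      using locally_finite_borel_compact[OF \<sigma>_lf[OF i] K] bnd[OF i] by simp
    finally show "(\<integral>\<^sup>+x\<in>K. sol x epowr q i \<partial>\<sigma> i) < \<infinity>" .
  qed
  have sol: "is_solution \<alpha> M q \<sigma> \<omega> sol"
    unfolding is_solution_def
  proof (intro conjI ballI allI loc)
    show "sol x = potential_operator \<alpha> M q \<sigma> \<omega> sol x" for x
      unfolding potential_operator_eq[OF sol_measurable] by (rule fixp)
  qed simp
  show pos: "0 < sol x" for x
  proof (cases "emeasure \<omega> UNIV = 0")
    case False
    show ?thesis
      by (rule less_le_trans[OF potential_pos[OF \<omega>_sf False]])
        (rule supersolution_ge(2)[OF solution_imp_supersolution[OF sol]])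
  next
    case True
    then obtain i where i: "i \<in> {1..M}" "emeasure (\<sigma> i) UNIV \<noteq> 0"
      using nonzero_measure by auto
    \<comment> \<open>With \<open>\<omega>\<close> zero, positivity comes from the start of the
      iteration: truncations of a nonzero \<open>\<sigma> i\<close> eventually have positive
      potential at \<open>x\<close>, and \<open>\<phi> m\<close> lies below the limit.\<close>
    have "eventually (\<lambda>m. 0 < G (trunc (\<sigma> i) m) x) sequentially"
      using potential_trunc_LIMSEQ[OF \<sigma>_sf[OF i(1)] finA[OF i(1)]] potential_pos[OF \<sigma>_sf[OF i(1)] i(2)]
      by (rule order_tendstoD(1))
    then obtain m where m: "0 < G (trunc (\<sigma> i) m) x" by (auto simp: eventually_sequentially)
    have "0 < ennreal (lower_const (q i)) * G (trunc (\<sigma> i) m) x epowr (1 / (1 - q i))"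
      using epowr_pos[OF m] lower_const_pos by (simp add: ennreal_zero_less_mult_iff)
    also have "\<dots> \<le> \<phi> m x"
      unfolding \<phi>_def using i(1) by (intro member_le_sum) auto
    also have "\<dots> \<le> sol x"
      using iter_le_sol[of m 0 x] by (simp add: iter_simps)
    finally show ?thesis .
  qed
  show "is_minimal_solution \<alpha> M q \<sigma> \<omega> sol"
    unfolding is_minimal_solution_def
  proof (intro conjI allI impI sol nontrivial_of_pos pos)
    fix v x assume "is_supersolution \<alpha> M q \<sigma> \<omega> v \<and> nontrivial M \<sigma> \<omega> v"
    then show "sol x \<le> v x"
      unfolding sol_def by (intro SUP_least iter_le_supersolution) auto
  qed
  have "(\<integral>\<^sup>+x. sol x epowr \<gamma> \<partial>total sol) = (\<Sum>i = 1..M. \<integral>\<^sup>+x. sol x epowr q i * sol x epowr \<gamma> \<partial>\<sigma> i) + (\<integral>\<^sup>+x. sol x epowr \<gamma> \<partial>\<omega>)"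
    by (rule nn_integral_total) measurable
  also have "\<dots> = (\<Sum>i = 1..M. \<integral>\<^sup>+x. sol x epowr (\<gamma> + q i) \<partial>\<sigma> i) + (\<integral>\<^sup>+x. sol x epowr \<gamma> \<partial>\<omega>)"
    by (simp add: epowr_add mult.commute)
  also have "\<dots> < \<infinity>"
    using bnd bnd\<omega> by (simp add: ennreal_sum_less_top)
  finally show "(\<integral>\<^sup>+x. sol x epowr \<gamma> \<partial>total sol) < \<infinity>" .
qed

lemma minimal_solution_lorentz:
  assumes "0 < \<gamma>" "cond_A \<alpha> M q \<sigma> \<gamma>" "cond_B \<alpha> \<omega> \<gamma>"
  shows "sol \<in> lorentz_space (N * (\<gamma> + 1) / (N - \<alpha>)) (\<gamma> + 1)"
proof -
  have sol: "is_solution \<alpha> M q \<sigma> \<omega> sol"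
    using minimal_solution(2)[OF assms] by (simp add: is_minimal_solution_def)
  have "G (total sol) \<in> lorentz_space (N * (\<gamma> + 1) / (N - \<alpha>)) (\<gamma> + 1)"
    using minimal_solution(3)[OF assms] solution_eq_potential[OF sol]
    by (intro potential_in_lorentz_space solution_total(3)[OF sol] assms(1)) simp
  then show ?thesis
    using solution_eq_potential[OF sol] by simp
qed

lemma minimal_solution_finite_energy:
  assumes "cond_A \<alpha> M q \<sigma> 1" "cond_B \<alpha> \<omega> 1"
  shows "is_finite_energy_solution \<alpha> M q \<sigma> \<omega> sol"
proof -
  have sol: "is_solution \<alpha> M q \<sigma> \<omega> sol"
    using minimal_solution(2)[OF zero_less_one assms] by (simp add: is_minimal_solution_def)
  have "(\<lambda>x. enn2ereal (G (total sol) x)) \<in> homogeneous_sobolev (\<alpha> / 2)"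
    using minimal_solution(3)[OF zero_less_one assms] solution_eq_potential[OF sol]
    by (intro finite_energy_imp_sobolev solution_total(3)[OF sol]) simp
  then show ?thesis
    using sol solution_eq_potential[OF sol] by (simp add: is_finite_energy_solution_def)
qed

lemma finite_energy_solution_energy:
  assumes "is_finite_energy_solution \<alpha> M q \<sigma> \<omega> u"
  shows "(\<integral>\<^sup>+x. u x \<partial>total u) < \<infinity>"
proof -
  have u: "is_solution \<alpha> M q \<sigma> \<omega> u" and sob: "(\<lambda>x. enn2ereal (u x)) \<in> homogeneous_sobolev (\<alpha> / 2)"
    using assms by (auto simp: is_finite_energy_solution_def)
  have "(\<integral>\<^sup>+x. G (total u) x \<partial>total u) < \<infinity>"
    using sob solution_eq_potential[OF u]
    by (intro sobolev_imp_finite_energy solution_total(1,2)[OF u]) simp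
  then show ?thesis
    using solution_eq_potential[OF u] by simp
qed

text \<open>The energy is the sum of the integrals of \<open>u epowr (1 + q i)\<close> against
  \<open>\<sigma> i\<close> and of \<open>u\<close> against \<open>\<omega>\<close>. Inserting the
  lower bounds for \<open>u\<close> by a power of \<open>G (\<sigma> i)\<close> and by
  \<open>G \<omega>\<close> gives the two conditions.\<close>

lemma finite_energy_imp_conditions:
  assumes u: "is_finite_energy_solution \<alpha> M q \<sigma> \<omega> u" and pos: "\<And>x. 0 < u x"
  shows "cond_A \<alpha> M q \<sigma> 1" "cond_B \<alpha> \<omega> 1"
proof -
  have sol: "is_solution \<alpha> M q \<sigma> \<omega> u" using u by (simp add: is_finite_energy_solution_def)
  have super: "is_supersolution \<alpha> M q \<sigma> \<omega> u" using sol by (rule solution_imp_supersolution)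
  have [measurable]: "u \<in> borel_measurable borel" using sol by (simp add: is_solution_def)
  have "(\<Sum>i = 1..M. \<integral>\<^sup>+x. u x epowr q i * u x \<partial>\<sigma> i) + (\<integral>\<^sup>+x. u x \<partial>\<omega>) < \<infinity>"
    using finite_energy_solution_energy[OF u] by (simp add: nn_integral_total)
  then have fin: "\<And>i. i \<in> {1..M} \<Longrightarrow> (\<integral>\<^sup>+x. u x epowr q i * u x \<partial>\<sigma> i) < \<infinity>" "(\<integral>\<^sup>+x. u x \<partial>\<omega>) < \<infinity>"
    by (auto simp: ennreal_sum_less_top)
  have "(\<integral>\<^sup>+y. G \<omega> y \<partial>\<omega>) \<le> (\<integral>\<^sup>+x. u x \<partial>\<omega>)"
    by (intro nn_integral_mono supersolution_ge(2)[OF super])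
  then show "cond_B \<alpha> \<omega> 1"
    unfolding cond_B_iff using fin(2) by (simp add: le_less_trans)
  show "cond_A \<alpha> M q \<sigma> 1"
    unfolding cond_A_iff
  proof
    fix i assume i: "i \<in> {1..M}"
    note [measurable_cong] = sigma_finite_borelD(1)[OF \<sigma>_sf[OF i]]
    note [measurable] = measurable_potential[OF \<sigma>_sf[OF i]]
    define b where "b = lower_const (q i) powr (1 + q i)"
    have b: "0 < b" using lower_const_pos[of "q i"] by (simp add: b_def)
    have "ennreal b * (\<integral>\<^sup>+y. G (\<sigma> i) y epowr ((1 + q i) / (1 - q i)) \<partial>\<sigma> i)
        = (\<integral>\<^sup>+y. ennreal b * G (\<sigma> i) y epowr ((1 + q i) / (1 - q i)) \<partial>\<sigma> i)"
      by (rule nn_integral_cmult[symmetric]) measurable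
    also have "\<dots> \<le> (\<integral>\<^sup>+x. u x epowr q i * u x \<partial>\<sigma> i)"
    proof (rule nn_integral_mono)
      fix y
      have "ennreal b * G (\<sigma> i) y epowr ((1 + q i) / (1 - q i))
          = (ennreal (lower_const (q i)) * G (\<sigma> i) y epowr (1 / (1 - q i))) epowr (1 + q i)"
        using q[OF i] lower_const_pos[of "q i"] by (simp add: epowr_mult epowr_epowr epowr_ennreal b_def)
      also have "\<dots> \<le> u y epowr (1 + q i)"
        using q[OF i] by (intro epowr_mono supersolution_ge_power[OF super nontrivial_of_pos[OF pos] i]) auto
      also have "\<dots> = u y epowr q i * u y"
        by (simp add: epowr_add mult.commute)
      finally show "ennreal b * G (\<sigma> i) y epowr ((1 + q i) / (1 - q i)) \<le> u y epowr q i * u y" .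
    qed
    also have "\<dots> < \<infinity>" by (rule fin(1)[OF i])
    finally show "(\<integral>\<^sup>+y. G (\<sigma> i) y epowr ((1 + q i) / (1 - q i)) \<partial>\<sigma> i) < \<infinity>"
      using b by (auto simp: ennreal_mult_less_top)
  qed
qed

text \<open>Symmetry of the kernel gives \<open>\<integral> v d\<mu>\<^sub>u = \<integral> u d\<mu>\<^sub>v\<close> for the right-hand sides \<open>\<mu>\<^sub>u\<close>, \<open>\<mu>\<^sub>v\<close>
  of the equation. As \<open>u \<le> v\<close>, every term on the left dominates the corresponding one on the right.\<close>

lemma ordered_solutions_eq:
  assumes u: "is_solution \<alpha> M q \<sigma> \<omega> u" and v: "is_solution \<alpha> M q \<sigma> \<omega> v"
    and pos: "\<And>x. 0 < u x" and uv: "\<And>x. u x \<le> v x" and fin: "(\<integral>\<^sup>+x. v x \<partial>total v) < \<infinity>"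
  shows "v = u"
proof -
  have [measurable]: "u \<in> borel_measurable borel" "v \<in> borel_measurable borel"
    using u v by (auto simp: is_solution_def)
  define I where "I i = (\<integral>\<^sup>+x. v x epowr q i * u x \<partial>\<sigma> i)" for i
  define J where "J i = (\<integral>\<^sup>+x. u x epowr q i * v x \<partial>\<sigma> i)" for i
  have "(\<integral>\<^sup>+x. v x \<partial>total u) = (\<integral>\<^sup>+x. u x \<partial>total v)"
    using potential_symmetric[OF solution_total(3)[OF v] solution_total(3)[OF u], of "\<lambda>_. 1" "\<lambda>_. 1" \<alpha>]
      solution_eq_potential[OF u] solution_eq_potential[OF v] by (simp add: density_1)
  then have eq: "(\<Sum>i = 1..M. J i) + (\<integral>\<^sup>+x. v x \<partial>\<omega>) = (\<Sum>i = 1..M. I i) + (\<integral>\<^sup>+x. u x \<partial>\<omega>)"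
    by (simp add: nn_integral_total I_def J_def)
  \<comment> \<open>Both sides contain the factor \<open>u x epowr p * v x epowr p\<close>; what
    remains is the comparison of \<open>u\<close> and \<open>v\<close> to the power
    \<open>1 - p\<close>.\<close>
  have pt: "v x epowr p * u x \<le> u x epowr p * v x" if "0 < p" "p < 1" for x p
  proof -
    have "v x epowr p * u x = v x epowr p * (u x epowr p * u x epowr (1 - p))"
      by (simp flip: epowr_add)
    also have "\<dots> \<le> v x epowr p * (u x epowr p * v x epowr (1 - p))"
      using that uv by (intro mult_left_mono epowr_mono) auto
    also have "\<dots> = u x epowr p * (v x epowr p * v x epowr (1 - p))"
      by (simp add: mult_ac)
    also have "\<dots> = u x epowr p * v x"
      by (simp flip: epowr_add)
    finally show ?thesis .
  qed
  have IJ: "I i \<le> J i" if "i \<in> {1..M}" for i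
    unfolding I_def J_def using q[OF that] by (intro nn_integral_mono pt) auto
  have "(\<integral>\<^sup>+x. v x \<partial>total u) \<le> (\<integral>\<^sup>+x. v x \<partial>total v)"
  proof -
    have "u x epowr q i * v x \<le> v x epowr q i * v x" if "i \<in> {1..M}" for i x
      using q[OF that] uv by (intro mult_right_mono epowr_mono) auto
    then show ?thesis
      by (subst (1 2) nn_integral_total) (auto intro!: add_mono sum_mono nn_integral_mono)
  qed
  then have "(\<integral>\<^sup>+x. v x \<partial>total u) < \<infinity>"
    using fin by (rule le_less_trans)
  moreover have "(\<integral>\<^sup>+x. v x \<partial>total u) = (\<Sum>i = 1..M. J i) + (\<integral>\<^sup>+x. v x \<partial>\<omega>)"
    unfolding J_def by (rule nn_integral_total) measurable
  ultimately have "(\<Sum>i = 1..M. J i) + (\<integral>\<^sup>+x. v x \<partial>\<omega>) < \<infinity>"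
    by simp
  then have Jfin: "\<And>i. i \<in> {1..M} \<Longrightarrow> J i < \<infinity>" and vfin: "(\<integral>\<^sup>+x. v x \<partial>\<omega>) < \<infinity>"
    by (auto simp: ennreal_sum_less_top)
  \<comment> \<open>All terms are finite because \<open>v\<close> has finite energy, so equality of
    the sums forces equality term by term. The computation passes to real numbers in order to
    subtract.\<close>
  have JI: "J i = I i" if i: "i \<in> {1..M}" for i
  proof -
    have Ifin: "I i < \<infinity>" if "i \<in> {1..M}" for i using IJ[OF that] Jfin[OF that] by (rule le_less_trans)
    have uv_int: "(\<integral>\<^sup>+x. u x \<partial>\<omega>) \<le> (\<integral>\<^sup>+x. v x \<partial>\<omega>)" by (intro nn_integral_mono uv)
    define j r where "j i = enn2real (J i)" and "r i = enn2real (I i)" for i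
    define a b where "a = enn2real (\<integral>\<^sup>+x. u x \<partial>\<omega>)" and "b = enn2real (\<integral>\<^sup>+x. v x \<partial>\<omega>)"
    have jr: "J i = ennreal (j i)" "I i = ennreal (r i)" "0 \<le> j i" "0 \<le> r i" "r i \<le> j i" if "i \<in> {1..M}" for i
      using Jfin[OF that] Ifin[OF that] IJ[OF that] by (auto simp: j_def r_def enn2real_mono)
    have ab: "(\<integral>\<^sup>+x. u x \<partial>\<omega>) = ennreal a" "(\<integral>\<^sup>+x. v x \<partial>\<omega>) = ennreal b" "0 \<le> a" "a \<le> b"
      using vfin uv_int le_less_trans[OF uv_int vfin] by (auto simp: a_def b_def enn2real_mono)
    have "ennreal ((\<Sum>i = 1..M. j i) + b) = ennreal ((\<Sum>i = 1..M. r i) + a)"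
    proof -
      have "(\<Sum>i = 1..M. J i) = ennreal (\<Sum>i = 1..M. j i)" "(\<Sum>i = 1..M. I i) = ennreal (\<Sum>i = 1..M. r i)"
        using jr by (subst sum_ennreal[symmetric]; auto intro!: sum.cong)+
      moreover have "0 \<le> (\<Sum>i = 1..M. j i)" "0 \<le> (\<Sum>i = 1..M. r i)" "0 \<le> b"
        using jr ab by (auto intro!: sum_nonneg)
      ultimately show ?thesis
        using eq ab by (simp only: ennreal_plus)
    qed
    then have "(\<Sum>i = 1..M. j i) + b = (\<Sum>i = 1..M. r i) + a"
      using jr ab by (subst (asm) ennreal_inj) (auto intro!: add_nonneg_nonneg sum_nonneg)
    then have "(\<Sum>i = 1..M. j i - r i) = a - b"
      by (simp add: sum_subtractf)
    moreover have "0 \<le> (\<Sum>i = 1..M. j i - r i)"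
      using jr(5) by (intro sum_nonneg) auto
    ultimately have "(\<Sum>i = 1..M. j i - r i) = 0"
      using ab(4) by linarith
    then have "j i - r i = 0"
      using i jr(5) by (subst (asm) sum_nonneg_eq_0_iff) auto
    then show ?thesis using jr[OF i] by simp
  qed
  have ae: "AE x in \<sigma> i. v x = u x" if i: "i \<in> {1..M}" for i
  proof -
    note [measurable_cong] = sigma_finite_borelD(1)[OF \<sigma>_sf[OF i]]
    have "(\<integral>\<^sup>+x. u x epowr q i * v x - v x epowr q i * u x \<partial>\<sigma> i) = J i - I i"
      unfolding I_def J_def using Jfin[OF i] IJ[OF i] q[OF i]
      by (intro nn_integral_diff AE_I2 pt) (auto simp: I_def J_def top_unique)
    also have "\<dots> = 0" using JI[OF i] Jfin[OF i] by (cases "J i") (auto simp: ennreal_minus)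
    finally have "AE x in \<sigma> i. u x epowr q i * v x - v x epowr q i * u x = 0"
      by (subst (asm) nn_integral_0_iff_AE) auto
    moreover have "AE x in \<sigma> i. v x < \<infinity>"
    proof (rule in_Lp_loc_AE_finite[OF \<sigma>_lf[OF i]])
      show "in_Lp_loc (q i) (\<sigma> i) v" using v i unfolding is_solution_def by blast
    qed
    ultimately show ?thesis
    proof eventually_elim
      case (elim x)
      obtain r where r: "v x = ennreal r" "0 \<le> r" using elim by (cases "v x") auto
      have "u x < \<infinity>" using elim uv[of x] by (auto intro: le_less_trans)
      then obtain s where s: "u x = ennreal s" "0 < s" using pos[of x] by (cases "u x") auto
      have "s \<le> r" using uv[of x] r s by simp
      then have "0 < r" using s by simp
      have "ennreal (s powr q i * r - r powr q i * s) = 0"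
        using elim(1) r s by (simp add: epowr_ennreal ennreal_mult[symmetric] ennreal_minus)
      then have "s powr q i * r \<le> r powr q i * s" by (simp add: ennreal_eq_0_iff)
      then have "s powr q i * r powr q i * r powr (1 - q i) \<le> s powr q i * r powr q i * s powr (1 - q i)"
        using \<open>0 < r\<close> s(2) by (simp add: mult.assoc powr_add[symmetric] mult.left_commute[of "s powr q i" "r powr q i"])
      then have "r powr (1 - q i) \<le> s powr (1 - q i)"
        using \<open>0 < r\<close> s(2) by simp
      then have "r \<le> s"
        using q[OF i] \<open>0 < r\<close> s(2) powr_less_mono2[of "1 - q i" s r] by (meson diff_gt_0_iff_gt less_imp_le not_le)
      then show ?case using \<open>s \<le> r\<close> r s by simp
    qed
  qed
  \<comment> \<open>Equality almost everywhere for each \<open>\<sigma> i\<close> makes the two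
    right-hand side measures coincide, and their potentials then agree at every point.\<close>
  show ?thesis
  proof
    fix x
    have "density (\<sigma> i) (\<lambda>y. v y epowr q i) = density (\<sigma> i) (\<lambda>y. u y epowr q i)" if i: "i \<in> {1..M}" for i
    proof (rule density_cong)
      note [measurable_cong] = sigma_finite_borelD(1)[OF \<sigma>_sf[OF i]]
      show "(\<lambda>y. v y epowr q i) \<in> borel_measurable (\<sigma> i)" "(\<lambda>y. u y epowr q i) \<in> borel_measurable (\<sigma> i)"
        by measurable
      show "AE y in \<sigma> i. v y epowr q i = u y epowr q i"
        using ae[OF i] by eventually_elim simp
    qed
    then have "G (total v) x = G (total u) x"
      by (simp add: potential_total)
    then show "v x = u x"
      using solution_eq_potential[OF u] solution_eq_potential[OF v] by metis
  qed
qed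

end

theorem theorem1p1:
  fixes \<alpha> :: real and M :: nat and q :: "nat \<Rightarrow> real"
    and \<sigma> :: "nat \<Rightarrow> (real ^ 'n) measure" and \<omega> :: "(real ^ 'n) measure"
  assumes "CARD('n) \<ge> 2"
    and "0 < \<alpha>" and "\<alpha> < real CARD('n)"
    and "M \<ge> 1"
    and "\<And>i. i \<in> {1..M} \<Longrightarrow> 0 < q i \<and> q i < 1"
    and "\<And>i. i \<in> {1..M} \<Longrightarrow> locally_finite_borel (\<sigma> i)"
    and "locally_finite_borel \<omega>"
    and "\<not> ((\<forall>i\<in>{1..M}. \<sigma> i = null_measure borel) \<and> \<omega> = null_measure borel)"
  shows
    "(\<forall>\<gamma>>0. cond_A \<alpha> M q \<sigma> \<gamma> \<and> cond_B \<alpha> \<omega> \<gamma> \<longrightarrow>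
        (\<exists>u. (\<forall>x. 0 < u x) \<and> is_minimal_solution \<alpha> M q \<sigma> \<omega> u \<and>
             u \<in> lorentz_space (real CARD('n) * (\<gamma> + 1) / (real CARD('n) - \<alpha>)) (\<gamma> + 1)))
   \<and> (cond_A \<alpha> M q \<sigma> 1 \<and> cond_B \<alpha> \<omega> 1 \<longleftrightarrow>
        (\<exists>u. (\<forall>x. 0 < u x) \<and> is_finite_energy_solution \<alpha> M q \<sigma> \<omega> u))
   \<and> (cond_A \<alpha> M q \<sigma> 1 \<and> cond_B \<alpha> \<omega> 1 \<longrightarrow>
        (\<exists>u. (\<forall>x. 0 < u x) \<and> is_minimal_solution \<alpha> M q \<sigma> \<omega> u \<and>
             is_finite_energy_solution \<alpha> M q \<sigma> \<omega> u \<and>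
             (\<alpha> \<le> 2 \<longrightarrow>
               (\<forall>v. is_finite_energy_solution \<alpha> M q \<sigma> \<omega> v \<and> nontrivial M \<sigma> \<omega> v \<longrightarrow> v = u))))"
proof -
  interpret sublinear_problem \<alpha> "real CARD('n)" "riesz_const (real CARD('n)) \<alpha>" "TYPE(real ^ 'n)" M q \<sigma> \<omega>
    using assms by unfold_locales auto
  have part1: "\<exists>u. (\<forall>x. 0 < u x) \<and> is_minimal_solution \<alpha> M q \<sigma> \<omega> u \<and>
      u \<in> lorentz_space (real CARD('n) * (\<gamma> + 1) / (real CARD('n) - \<alpha>)) (\<gamma> + 1)"
    if "0 < \<gamma>" "cond_A \<alpha> M q \<sigma> \<gamma>" "cond_B \<alpha> \<omega> \<gamma>" for \<gamma>
    using that
    by (intro exI[of _ sol] conjI allI minimal_solution[of \<gamma>] minimal_solution_lorentz)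
  have part3: "\<exists>u. (\<forall>x. 0 < u x) \<and> is_minimal_solution \<alpha> M q \<sigma> \<omega> u \<and>
      is_finite_energy_solution \<alpha> M q \<sigma> \<omega> u \<and>
      (\<alpha> \<le> 2 \<longrightarrow> (\<forall>v. is_finite_energy_solution \<alpha> M q \<sigma> \<omega> v \<and> nontrivial M \<sigma> \<omega> v \<longrightarrow> v = u))"
    if AB: "cond_A \<alpha> M q \<sigma> 1" "cond_B \<alpha> \<omega> 1"
  proof (intro exI[of _ sol] conjI allI impI)
    show min: "is_minimal_solution \<alpha> M q \<sigma> \<omega> sol" by (rule minimal_solution(2)[OF zero_less_one AB])
    show pos: "0 < sol x" for x by (rule minimal_solution(1)[OF zero_less_one AB])
    show fe: "is_finite_energy_solution \<alpha> M q \<sigma> \<omega> sol" by (rule minimal_solution_finite_energy[OF AB])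
    fix v assume v: "is_finite_energy_solution \<alpha> M q \<sigma> \<omega> v \<and> nontrivial M \<sigma> \<omega> v"
    then have v_sol: "is_solution \<alpha> M q \<sigma> \<omega> v" by (simp add: is_finite_energy_solution_def)
    show "v = sol"
    proof (rule ordered_solutions_eq)
      show "is_solution \<alpha> M q \<sigma> \<omega> sol" using min by (simp add: is_minimal_solution_def)
      show "sol x \<le> v x" for x
        using min solution_imp_supersolution[OF v_sol] v by (simp add: is_minimal_solution_def)
      show "(\<integral>\<^sup>+x. v x \<partial>total v) < \<infinity>" using v by (intro finite_energy_solution_energy) simp
    qed (use v_sol pos in auto)
  qed
  show ?thesis
  proof (intro conjI)
    show "\<forall>\<gamma>>0. cond_A \<alpha> M q \<sigma> \<gamma> \<and> cond_B \<alpha> \<omega> \<gamma> \<longrightarrow>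
        (\<exists>u. (\<forall>x. 0 < u x) \<and> is_minimal_solution \<alpha> M q \<sigma> \<omega> u \<and>
             u \<in> lorentz_space (real CARD('n) * (\<gamma> + 1) / (real CARD('n) - \<alpha>)) (\<gamma> + 1))"
    proof (intro allI impI)
      fix \<gamma> :: real assume "0 < \<gamma>" and AB: "cond_A \<alpha> M q \<sigma> \<gamma> \<and> cond_B \<alpha> \<omega> \<gamma>"
      show "\<exists>u. (\<forall>x. 0 < u x) \<and> is_minimal_solution \<alpha> M q \<sigma> \<omega> u \<and>
          u \<in> lorentz_space (real CARD('n) * (\<gamma> + 1) / (real CARD('n) - \<alpha>)) (\<gamma> + 1)"
        by (rule part1[OF \<open>0 < \<gamma>\<close> conjunct1[OF AB] conjunct2[OF AB]])
    qed
    show "cond_A \<alpha> M q \<sigma> 1 \<and> cond_B \<alpha> \<omega> 1 \<longleftrightarrow>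
        (\<exists>u. (\<forall>x. 0 < u x) \<and> is_finite_energy_solution \<alpha> M q \<sigma> \<omega> u)"
    proof
      assume "cond_A \<alpha> M q \<sigma> 1 \<and> cond_B \<alpha> \<omega> 1"
      then have "cond_A \<alpha> M q \<sigma> 1" "cond_B \<alpha> \<omega> 1" by auto
      then show "\<exists>u. (\<forall>x. 0 < u x) \<and> is_finite_energy_solution \<alpha> M q \<sigma> \<omega> u"
        by (intro exI[of _ sol] conjI allI minimal_solution(1)[OF zero_less_one] minimal_solution_finite_energy)
    next
      assume "\<exists>u. (\<forall>x. 0 < u x) \<and> is_finite_energy_solution \<alpha> M q \<sigma> \<omega> u"
      then obtain u where u: "\<And>x. 0 < u x" "is_finite_energy_solution \<alpha> M q \<sigma> \<omega> u"
        by auto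
      show "cond_A \<alpha> M q \<sigma> 1 \<and> cond_B \<alpha> \<omega> 1"
        using finite_energy_imp_conditions[OF u(2,1)] by (rule conjI)
    qed
  qed (rule impI, elim conjE, rule part3, assumption+)
qed

end
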